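(* Let $Y$ be a MUCOGARCH$(1,1)$ volatility process with parameters $A,B\in M_d(\mathbb{R})$, $C\in\mathbb{S}_d^{++}$ driven by a $d$-dimensional Lévy process $L$ with Lévy measure $\nu_L$, and let $V_t=C+Y_t$. Assume that there exists $\sigma_L\in\mathbb{R}^+$ such that $\int_{\mathbb{R}^d}xx^*\,\nu_L(dx)=\sigma_LI_d$ (in particular this integral is finite). Set $\mathscr{B}:=B\otimes I_d+I_d\otimes B+\sigma_LA\otimes A$. (i) If $E(\|Y_0\|)<\infty$, then for all $t\in\mathbb{R}^+$ $$E(\operatorname{vec}(Y_t))=e^{\mathscr{B}t}E(\operatorname{vec}(Y_0))+\int_0^te^{\mathscr{B}(t-s)}\,ds\;\sigma_L(A\otimes A)\operatorname{vec}(C).$$ If $\mathscr{B}$ is invertible, then $$E(\operatorname{vec}(Y_t))=e^{\mathscr{B}t}\bigl(E(\operatorname{vec}(Y_0))+\sigma_L\mathscr{B}^{-1}(A\otimes A)\operatorname{vec}(C)\bigr)-\sigma_L\mathscr{B}^{-1}(A\otimes A)\operatorname{vec}(C)$$ for all $t\in\mathbb{R}^+$. (ii) If $Y$ is second-order stationary, then the stationary expected value $E(Y_0)$ satisfies $$BE(Y_0)+E(Y_0)B^*+\sigma_LAE(Y_0)A^*=-\sigma_LACA^*.$$ If $\mathscr{B}$ is invertible, then moreover $$E(\operatorname{vec}(Y_0))=-\sigma_L\mathscr{B}^{-1}(A\otimes A)\operatorname{vec}(C)\quad\text{and}\quad E(\operatorname{vec}(V_0))=\mathscr{B}^{-1}(B\otimes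 I_d+I_d\otimes B)\operatorname{vec}(C).$$
   Context: $M_d(\mathbb{R})$: real $d\times d$ matrices; $I_d$ the identity; $\mathbb{S}_d^+$ (resp. $\mathbb{S}_d^{++}$): positive semidefinite (resp. positive definite) symmetric $d\times d$ matrices; $X^*$ is the transpose; $X^{1/2}$ the positive semidefinite square root; $\otimes$ the Kronecker product; $\operatorname{vec}$ stacks the columns of a matrix; $\mathbb{R}^+=[0,\infty)$. All processes live on a filtered probability space satisfying the usual conditions; $L$ is a càdlàg $\mathbb{R}^d$-valued Lévy process with respect to this filtration, $L_0=0$; $Y_0$ is $\mathcal{F}_0$-measurable. $[L,L]^{\mathfrak{d}}_t=\sum_{0\le s\le t}(\Delta L_s)(\Delta L_s)^*$. The MUCOGARCH$(1,1)$ volatility process with parameters $A,B,C$ driven by $L$ is the (unique) $\mathbb{S}_d^+$-valued càdlàg adapted solution of $$dY_t=(BY_{t-}+Y_{t-}B^* )\,dt+A(C+Y_{t-})^{1/2}\,d[L,L]_t^{\mathfrak{d}}\,(C+Y_{t-})^{1/2}A^*$$ with initial value $Y_0$ in $\mathbb{S}_d^+$. Second-order stationary means finite second moments, mean constant in time, and $\operatorname{cov}(\operatorname{vec}(Y_{t+h}),\operatorname{vec}(Y_t))$ depending only on $h\ge0$. *)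

theory Defs
  imports "HOL-Probability.Probability"
begin

section \<open>Matrices\<close>

definition psd :: "real^'n^'n \<Rightarrow> bool" where
  "psd X \<longleftrightarrow> transpose X = X \<and> (\<forall>v. 0 \<le> v \<bullet> (X *v v))"

definition pd :: "real^'n^'n \<Rightarrow> bool" where
  "pd X \<longleftrightarrow> transpose X = X \<and> (\<forall>v. v \<noteq> 0 \<longrightarrow> 0 < v \<bullet> (X *v v))"

definition psd_sqrt :: "real^'n^'n \<Rightarrow> real^'n^'n" where
  "psd_sqrt X = (THE S. psd S \<and> S ** S = X)"

definition outer :: "real^'m \<Rightarrow> real^'n \<Rightarrow> real^'n^'m" where
  "outer u v = (\<chi> i j. u $ i * v $ j)"

text \<open>The coordinates of \<open>vec X\<close> are indexed by pairs in lexicographic (block) order. As columns are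
  stacked, the first component of a pair is the column index of the matrix and the second one the
  row index. (The library's \<open>vec\<close> is the constant vector.)\<close>

definition mvec :: "real^'n^'m \<Rightarrow> real^('n \<times> 'm)" where
  "mvec X = (\<chi> p. X $ snd p $ fst p)"

definition kron :: "real^'b^'a \<Rightarrow> real^'d^'c \<Rightarrow> real^('b \<times> 'd)^('a \<times> 'c)"  (infixl "\<otimes>" 75) where
  "P \<otimes> Q = (\<chi> p q. P $ fst p $ fst q * Q $ snd p $ snd q)"

text \<open>The two index conventions match, as the following identity shows.\<close>

lemma kron_mult_mvec: "(P \<otimes> Q) *v mvec X = mvec (Q ** X ** transpose P)"
  by (simp add: vec_eq_iff kron_def mvec_def matrix_vector_mult_def matrix_matrix_mult_def
      transpose_def UNIV_Times_UNIV[symmetric] sum.cartesian_product split_def sum_distrib_left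
      sum_distrib_right mult_ac del: UNIV_Times_UNIV)

text \<open>The library has no Banach algebra structure on square matrices, hence no \<open>exp\<close> for them.\<close>

definition mexp :: "real^'n^'n \<Rightarrow> real^'n^'n" where
  "mexp X = (\<Sum>k. (((**) X) ^^ k) (mat 1) /\<^sub>R fact k)"

section \<open>Paths\<close>

text \<open>Paths are indexed by the reals, but only times \<open>t \<ge> 0\<close> matter. By convention the
  left limit at time 0 is the value at time 0, so that there is no jump at time 0.\<close>

definition cadlag :: "(real \<Rightarrow> 'b::topological_space) \<Rightarrow> bool" where
  "cadlag f \<longleftrightarrow> (\<forall>t\<ge>0. (f \<longlongrightarrow> f t) (at_right t)) \<and> (\<forall>t>0. \<exists>l. (f \<longlongrightarrow> l) (at_left t))"

definition left_lim :: "(real \<Rightarrow> 'b::t2_space) \<Rightarrow> real \<Rightarrow> 'b" where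
  "left_lim f t = (if t = 0 then f 0 else Lim (at_left t) f)"

definition jump :: "(real \<Rightarrow> 'b::real_normed_vector) \<Rightarrow> real \<Rightarrow> 'b" where
  "jump f t = f t - left_lim f t"

definition discont_qv :: "(real \<Rightarrow> real^'d) \<Rightarrow> real \<Rightarrow> real^'d^'d" where
  "discont_qv l t = (\<Sum>\<^sub>\<infinity>s\<in>{0..t}. outer (jump l s) (jump l s))"

text \<open>\<open>has_ls_integral H X t I\<close>: the pathwise Lebesgue-Stieltjes integral of \<open>H\<close> over \<open>(0, t]\<close>
  with respect to the right-continuous function \<open>X\<close> of finite variation on \<open>[0, t]\<close> exists and
  equals \<open>I\<close>. The value does not depend on the chosen decomposition of \<open>X\<close> into a difference of
  increasing right-continuous functions.\<close>

definition has_ls_integral :: "(real \<Rightarrow> real) \<Rightarrow> (real \<Rightarrow> real) \<Rightarrow> real \<Rightarrow> real \<Rightarrow> bool" where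
  "has_ls_integral H X t I \<longleftrightarrow>
    (\<exists>P N. mono P \<and> mono N \<and> (\<forall>a. continuous (at_right a) P) \<and> (\<forall>a. continuous (at_right a) N) \<and>
      (\<forall>s\<in>{0..t}. X s = P s - N s) \<and>
      set_integrable (interval_measure P) {0<..t} H \<and> set_integrable (interval_measure N) {0<..t} H \<and>
      I = (LINT s:{0<..t}|interval_measure P. H s) - (LINT s:{0<..t}|interval_measure N. H s))"

text \<open>\<open>\<integral>\<^bsub>(0,t]\<^esub> G\<^sub>s dX\<^sub>s K\<^sub>s = J\<close>, whose \<open>(i,j)\<close> entry is the sum over \<open>k, l\<close> of the integrals of
  \<open>G\<^sub>i\<^sub>k K\<^sub>l\<^sub>j\<close> with respect to \<open>X\<^sub>k\<^sub>l\<close>.\<close>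

definition has_matrix_ls_integral ::
  "(real \<Rightarrow> real^'n^'m) \<Rightarrow> (real \<Rightarrow> real^'p^'n) \<Rightarrow> (real \<Rightarrow> real^'q^'p) \<Rightarrow> real \<Rightarrow> real^'q^'m \<Rightarrow> bool" where
  "has_matrix_ls_integral G X K t J \<longleftrightarrow>
    (\<exists>I. (\<forall>i j k l. has_ls_integral (\<lambda>s. G s $ i $ k * K s $ l $ j) (\<lambda>s. X s $ k $ l) t (I i j k l)) \<and>
      J = (\<chi> i j. \<Sum>k\<in>UNIV. \<Sum>l\<in>UNIV. I i j k l))"

section \<open>Processes\<close>

locale usual_filtered_prob_space = prob_space M for M :: "'a measure" +
  fixes F :: "real \<Rightarrow> 'a measure"
  assumes subalgebra_F: "0 \<le> t \<Longrightarrow> subalgebra M (F t)"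
    and F_mono: "0 \<le> s \<Longrightarrow> s \<le> t \<Longrightarrow> sets (F s) \<subseteq> sets (F t)"
    and F_right_cont: "0 \<le> t \<Longrightarrow> sets (F t) = (\<Inter>s\<in>{t<..}. sets (F s))"
    and F_complete: "N \<in> null_sets M \<Longrightarrow> N' \<subseteq> N \<Longrightarrow> N' \<in> sets (F 0)"

definition adapted ::
  "(real \<Rightarrow> 'a measure) \<Rightarrow> (real \<Rightarrow> 'a \<Rightarrow> 'b::topological_space) \<Rightarrow> bool" where
  "adapted F X \<longleftrightarrow> (\<forall>t\<ge>0. X t \<in> borel_measurable (F t))"

definition levy_process ::
  "'a measure \<Rightarrow> (real \<Rightarrow> 'a measure) \<Rightarrow> (real \<Rightarrow> 'a \<Rightarrow> real^'d) \<Rightarrow> bool" where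
  "levy_process M F L \<longleftrightarrow>
    adapted F L \<and>
    (AE \<omega> in M. L 0 \<omega> = 0) \<and>
    (AE \<omega> in M. cadlag (\<lambda>t. L t \<omega>)) \<and>
    (\<forall>s t. 0 \<le> s \<and> s \<le> t \<longrightarrow>
      prob_space.indep_set M (sets (F s))
        {(\<lambda>\<omega>. L t \<omega> - L s \<omega>) -` S \<inter> space M | S. S \<in> sets borel} \<and>
      distr M borel (\<lambda>\<omega>. L t \<omega> - L s \<omega>) = distr M borel (L (t - s)))"

text \<open>\<open>\<nu> S\<close> is the expected number of nonzero jumps in \<open>S\<close> during the unit time interval.\<close>

definition has_levy_measure ::
  "'a measure \<Rightarrow> (real \<Rightarrow> 'a \<Rightarrow> real^'d) \<Rightarrow> (real^'d) measure \<Rightarrow> bool" where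
  "has_levy_measure M L \<nu> \<longleftrightarrow> sets \<nu> = sets borel \<and>
    (\<forall>S\<in>sets borel. emeasure \<nu> S =
      (\<integral>\<^sup>+\<omega>. emeasure (count_space UNIV) {s\<in>{0<..1}. jump (\<lambda>t. L t \<omega>) s \<in> S - {0}} \<partial>M))"

definition mucogarch_volatility ::
  "'a measure \<Rightarrow> (real \<Rightarrow> 'a measure) \<Rightarrow> (real \<Rightarrow> 'a \<Rightarrow> real^'d) \<Rightarrow>
    real^'d^'d \<Rightarrow> real^'d^'d \<Rightarrow> real^'d^'d \<Rightarrow> (real \<Rightarrow> 'a \<Rightarrow> real^'d^'d) \<Rightarrow> bool" where
  "mucogarch_volatility M F L A B C Y \<longleftrightarrow>
    adapted F Y \<and>
    (AE \<omega> in M. cadlag (\<lambda>t. Y t \<omega>)) \<and>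
    (AE \<omega> in M. \<forall>t\<ge>0. psd (Y t \<omega>)) \<and>
    (AE \<omega> in M. \<forall>t\<ge>0. \<exists>J.
      has_matrix_ls_integral
        (\<lambda>s. A ** psd_sqrt (C + left_lim (\<lambda>u. Y u \<omega>) s))
        (discont_qv (\<lambda>u. L u \<omega>))
        (\<lambda>s. psd_sqrt (C + left_lim (\<lambda>u. Y u \<omega>) s) ** transpose A) t J \<and>
      Y t \<omega> = Y 0 \<omega>
        + integral {0..t} (\<lambda>s. B ** left_lim (\<lambda>u. Y u \<omega>) s + left_lim (\<lambda>u. Y u \<omega>) s ** transpose B)
        + J)"

definition cov_matrix :: "'a measure \<Rightarrow> ('a \<Rightarrow> real^'m) \<Rightarrow> ('a \<Rightarrow> real^'n) \<Rightarrow> real^'n^'m" where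
  "cov_matrix M X Z =
    (LINT \<omega>|M. outer (X \<omega> - (LINT \<omega>'|M. X \<omega>')) (Z \<omega> - (LINT \<omega>'|M. Z \<omega>')))"

definition second_order_stationary ::
  "'a measure \<Rightarrow> (real \<Rightarrow> 'a \<Rightarrow> real^'n^'m) \<Rightarrow> bool" where
  "second_order_stationary M Y \<longleftrightarrow>
    (\<forall>t\<ge>0. Y t \<in> borel_measurable M \<and> integrable M (\<lambda>\<omega>. (norm (Y t \<omega>))\<^sup>2)) \<and>
    (\<forall>t\<ge>0. (LINT \<omega>|M. Y t \<omega>) = (LINT \<omega>|M. Y 0 \<omega>)) \<and>
    (\<forall>s\<ge>0. \<forall>t\<ge>0. \<forall>h\<ge>0.
      cov_matrix M (\<lambda>\<omega>. mvec (Y (t + h) \<omega>)) (\<lambda>\<omega>. mvec (Y t \<omega>)) =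
      cov_matrix M (\<lambda>\<omega>. mvec (Y (s + h) \<omega>)) (\<lambda>\<omega>. mvec (Y s \<omega>)))"

end

theory Submission
  imports Defs "HOL-Real_Asymp.Real_Asymp"
begin

text \<open>The jumps of the Levy process are accessible through Riemann sums: for \<open>f\<close> continuous and
  vanishing near 0, the sum of \<open>f\<close> over the increments of \<open>L\<close> along finer and finer grids converges to the sum
  of \<open>f\<close> over the jumps. Laplace transforms turn the independence and stationarity of the increments into the
  same properties of the jump sums, whose means are therefore linear in time with slope the integral of \<open>f\<close>
  with respect to the Levy measure. Riemann sums for adapted integrands with left limits then give the
  compensation formula, which replaces \<open>d[L,L]\<close> by \<open>\<sigma> I dt\<close> under the expectation. A Gronwall argument on the
  event that the path has stayed bounded by \<open>K\<close>, uniform in \<open>K\<close>, yields integrability; the mean then solves a linear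
  differential equation with matrix \<open>BB\<close>.\<close>

section \<open>Matrices\<close>

text \<open>The Levy process enters only through independent stationary increments and through \<nu>
  as a mean jump count; no Poisson random measure is set up. Sums of f over increments have no
  evident integrable majorant, so their means cannot be passed to the limit directly.
  \<open>exp\<close> of minus such a sum is a product of factors at most 1: it is dominated, and it
  factorizes over the increments. First moments then return as derivatives at 0 of these transforms.
  A cadlag path has only finitely many jumps outside a ball around 0, hence the detour over f
  vanishing near 0; monotone limits and a splitting into signs lead to the products x_k x_l. The
  other obstacle is a circle: Gronwall needs a mean already known to be finite, yet finiteness of
  the mean of Y_t is the claim. Restricting to paths that stayed below K strictly before time t
  gives the a priori bound K, because the left limit at t obeys the same bound. The two roots (C +
  Y)^(1/2) grow like the square root of Y, so the jump term grows linearly. As the integral of x x^*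
  is diagonal, the roots recombine under the expectation into A (C + Y) A^*, and the equation for
  the mean is closed.\<close>

lemma norm_matrix_vector_mult_le: "norm (A *v x) \<le> norm A * norm (x :: real^'n)"
proof -
  have "norm (A *v x) = L2_set (\<lambda>i. norm ((A *v x) $ i)) UNIV"
    by (simp add: norm_vec_def)
  also have "\<dots> \<le> L2_set (\<lambda>i. norm (A $ i) * norm x) UNIV"
    by (intro L2_set_mono) (simp_all add: matrix_vector_mul_component Cauchy_Schwarz_ineq2)
  also have "\<dots> = norm A * norm x"
    by (simp add: L2_set_left_distrib[symmetric] norm_vec_def[of A])
  finally show ?thesis .
qed

lemma power2_norm_matrix: "(norm (A :: real^'n^'m))\<^sup>2 = (\<Sum>i\<in>UNIV. \<Sum>j\<in>UNIV. (A $ i $ j)\<^sup>2)"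
  by (simp add: norm_vec_def L2_set_def sum_nonneg)

lemma norm_transpose [simp]: "norm (transpose (A :: real^'n^'m)) = norm A"
proof -
  have "(norm (transpose A))\<^sup>2 = (norm A)\<^sup>2"
    unfolding power2_norm_matrix transpose_def by (simp, rule sum.swap)
  thus ?thesis by simp
qed

text \<open>The norm on matrices is the Frobenius norm. Row \<open>i\<close> of the product is
  \<open>transpose B\<close> applied to row \<open>i\<close> of \<open>A\<close>, so the bound for
  vectors applies row by row.\<close>

lemma norm_matrix_mult_le: "norm (A ** B) \<le> norm A * norm (B :: real^'p^'n)"
proof -
  have row: "(A ** B) $ i = transpose B *v (A $ i)" for i
    by (simp add: vec_eq_iff matrix_matrix_mult_def matrix_vector_mult_def transpose_def mult.commute)
  have "norm (A ** B) = L2_set (\<lambda>i. norm ((A ** B) $ i)) UNIV"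
    by (simp add: norm_vec_def)
  also have "\<dots> \<le> L2_set (\<lambda>i. norm (A $ i) * norm B) UNIV"
    unfolding row
    by (intro L2_set_mono norm_ge_zero) (metis mult.commute norm_matrix_vector_mult_le norm_transpose)
  also have "\<dots> = norm A * norm B"
    by (simp add: L2_set_left_distrib[symmetric] norm_vec_def[of A])
  finally show ?thesis .
qed

lemma bounded_bilinear_matrix_mult:
  "bounded_bilinear ((**) :: real^'n^'m \<Rightarrow> real^'p^'n \<Rightarrow> real^'p^'m)"
proof (rule bounded_bilinear.intro)
  show "\<exists>K. \<forall>a b. norm ((a::real^'n^'m) ** (b::real^'p^'n)) \<le> norm a * norm b * K"
    by (intro exI[of _ 1]) (simp add: norm_matrix_mult_le)
qed (simp_all add: matrix_matrix_mult_def vec_eq_iff algebra_simps sum.distrib sum_distrib_left)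

lemma bounded_bilinear_matrix_vector_mult:
  "bounded_bilinear ((*v) :: real^'n^'m \<Rightarrow> real^'n \<Rightarrow> real^'m)"
proof (rule bounded_bilinear.intro)
  show "\<exists>K. \<forall>a b. norm ((a::real^'n^'m) *v b) \<le> norm a * norm b * K"
    by (intro exI[of _ 1]) (simp add: norm_matrix_vector_mult_le)
qed (simp_all add: matrix_vector_mult_def vec_eq_iff algebra_simps sum.distrib sum_distrib_left)

lemmas tendsto_matrix_mult = bounded_bilinear.tendsto[OF bounded_bilinear_matrix_mult]
  and continuous_on_matrix_mult = bounded_bilinear.continuous_on[OF bounded_bilinear_matrix_mult]

lemma norm_outer: "norm (outer u v) = norm u * norm v"
proof -
  have "norm ((outer u v) $ i) = \<bar>u $ i\<bar> * norm v" for i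
  proof -
    have "outer u v $ i = u $ i *\<^sub>R v" by (simp add: outer_def vec_eq_iff)
    thus ?thesis by simp
  qed
  thus ?thesis by (simp add: norm_vec_def[of "outer u v"] L2_set_left_distrib[symmetric] norm_vec_def[of u])
qed

lemma abs_matrix_nth_le_norm: "\<bar>(A :: real^'n^'m) $ i $ j\<bar> \<le> norm A"
  using component_le_norm_cart[of "A $ i" j] Finite_Cartesian_Product.norm_nth_le[of A i] by linarith

lemma bounded_linear_transpose: "bounded_linear (transpose :: real^'n^'m \<Rightarrow> real^'m^'n)"
  by (simp add: linear_conv_bounded_linear[symmetric] linear_iff transpose_def vec_eq_iff)

lemma bounded_linear_mvec: "bounded_linear (mvec :: real^'n^'m \<Rightarrow> real^('n \<times> 'm))"
  by (simp add: linear_conv_bounded_linear[symmetric] linear_iff mvec_def vec_eq_iff)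

lemma mvec_add: "mvec (X + Y) = mvec X + mvec Y"
  and mvec_scaleR: "mvec (c *\<^sub>R X) = c *\<^sub>R mvec X"
  by (simp_all add: mvec_def vec_eq_iff)

section \<open>The positive semidefinite square root\<close>

text \<open>Spectral theorem by induction on the dimension of an invariant subspace: a maximiser of
  the quadratic form on the unit sphere of \<open>S\<close> is an eigenvector, and its orthogonal
  complement in \<open>S\<close> is again invariant. The last conjunct, the expansion, is the form
  in which the basis is used.\<close>

lemma selfadjoint_eigenbasis:
  fixes f :: "'a::euclidean_space \<Rightarrow> 'a"
  assumes "linear f" and sa: "\<And>x y. x \<bullet> f y = f x \<bullet> y"
    and "subspace S" "f ` S \<subseteq> S"
  shows "\<exists>B. finite B \<and> (\<forall>b\<in>B. norm b = 1 \<and> (\<exists>l. f b = l *\<^sub>R b)) \<and>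
    (\<forall>b\<in>B. \<forall>c\<in>B. b \<noteq> c \<longrightarrow> b \<bullet> c = 0) \<and> B \<subseteq> S \<and> (\<forall>x\<in>S. x = (\<Sum>b\<in>B. (x \<bullet> b) *\<^sub>R b))"
  using assms(3,4)
proof (induction "dim S" arbitrary: S rule: less_induct)
  case less
  interpret f: linear f by fact
  show ?case
  proof (cases "S \<subseteq> {0}")
    case True
    thus ?thesis by (intro exI[of _ "{}"]) auto
  next
    case False
    then obtain z where z: "z \<in> S" "z \<noteq> 0" by auto
    define P where "P = sphere 0 1 \<inter> S"
    have cP: "compact P" unfolding P_def
      by (intro compact_Int_closed closed_subspace less.prems) simp
    have neP: "P \<noteq> {}"
    proof -
      have "(1 / norm z) *\<^sub>R z \<in> P" using z less.prems(1) by (simp add: P_def subspace_scale)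
      thus ?thesis by auto
    qed
    have cont: "continuous_on P (\<lambda>x. x \<bullet> f x)"
      by (intro continuous_intros linear_continuous_on linear_conv_bounded_linear[THEN iffD1] assms(1))
    obtain b where b: "b \<in> P" and max: "\<And>x. x \<in> P \<Longrightarrow> x \<bullet> f x \<le> b \<bullet> f b"
      using continuous_attains_sup[OF cP neP cont] by auto
    define l where "l = b \<bullet> f b"
    have nb: "norm b = 1" and bS: "b \<in> S" using b by (auto simp: P_def)
    have bb: "b \<bullet> b = 1" using nb by (simp add: norm_eq_1)
    \<comment> \<open>Homogeneity extends the maximum over the unit sphere to all of
      \<open>S\<close>.\<close>
    have q: "x \<bullet> f x \<le> l * (x \<bullet> x)" if "x \<in> S" for x
    proof (cases "x = 0")
      case False
      define u where "u = (1 / norm x) *\<^sub>R x"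
      have "u \<in> P" using that False less.prems(1) by (simp add: P_def subspace_scale u_def)
      from max[OF this] have "(x \<bullet> f x) / (norm x)\<^sup>2 \<le> l"
        by (simp add: u_def f.scaleR l_def power2_eq_square)
      thus ?thesis using False by (simp add: field_simps power2_norm_eq_inner)
    qed (simp add: f.zero)
    \<comment> \<open>First-order condition at the maximiser: along the line through
      \<open>b\<close> in direction \<open>y\<close>, the inequality \<open>q\<close> is a
      nonnegative quadratic in \<open>t\<close> without constant term, so its linear coefficient
      vanishes.\<close>
    have orth: "y \<bullet> (l *\<^sub>R b - f b) = 0" if y: "y \<in> S" for y
    proof -
      define \<beta> where "\<beta> = y \<bullet> (l *\<^sub>R b - f b)"
      define \<gamma> where "\<gamma> = l * (y \<bullet> y) - y \<bullet> f y"
      have "0 \<le> 2 * t * \<beta> + t\<^sup>2 * \<gamma>" for t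
      proof -
        have "b + t *\<^sub>R y \<in> S" using bS y less.prems(1) by (simp add: subspace_add subspace_scale)
        from q[OF this] show ?thesis
          using sa[of b y] bb
          by (simp add: f.add f.scaleR inner_add_left inner_add_right inner_diff_right \<beta>_def \<gamma>_def
              l_def[symmetric] power2_eq_square algebra_simps inner_commute)
      qed
      hence *: "0 \<le> 2 * (-\<beta> * e) * \<beta> + (-\<beta> * e)\<^sup>2 * \<gamma>" for e by blast
      have "0 \<le> - \<beta>\<^sup>2 / (1 + \<bar>\<gamma>\<bar>)"
      proof -
        \<comment> \<open>A step size with \<open>e * \<gamma> \<le> 1\<close>, whatever the sign of
          \<open>\<gamma>\<close>; the linear term then outweighs the quadratic one.\<close>
        define e where "e = 1 / (1 + \<bar>\<gamma>\<bar>)"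
        have e: "e > 0" "e * \<gamma> \<le> 1" by (auto simp: e_def field_simps)
        have "0 \<le> \<beta>\<^sup>2 * e * (e * \<gamma> - 2)"
          using *[of e] by (simp add: power2_eq_square algebra_simps)
        also have "\<dots> \<le> \<beta>\<^sup>2 * e * (-1)" using e by (intro mult_left_mono) auto
        finally show ?thesis by (simp add: e_def)
      qed
      hence "\<beta>\<^sup>2 \<le> 0" by (simp add: field_simps)
      thus ?thesis by (simp add: \<beta>_def)
    qed
    \<comment> \<open>The residual lies in \<open>S\<close> by invariance, and \<open>orth\<close>
      makes it orthogonal to \<open>S\<close>, hence to itself.\<close>
    have fb: "f b = l *\<^sub>R b"
    proof -
      have "l *\<^sub>R b - f b \<in> S" using bS less.prems by (simp add: subspace_diff subspace_scale image_subset_iff)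
      from orth[OF this] show ?thesis by simp
    qed
    define S' where "S' = {x \<in> S. x \<bullet> b = 0}"
    have S': "subspace S'" using less.prems(1)
      by (auto simp: S'_def subspace_def inner_add_left)
    have inv: "f ` S' \<subseteq> S'"
    proof
      fix y assume "y \<in> f ` S'"
      then obtain x where x: "y = f x" "x \<in> S" "x \<bullet> b = 0" by (auto simp: S'_def)
      have "f x \<bullet> b = x \<bullet> f b" using sa by simp
      hence "f x \<bullet> b = 0" using x by (simp add: fb)
      thus "y \<in> S'" using x less.prems(2) by (auto simp: S'_def)
    qed
    have "b \<notin> S'" by (simp add: S'_def bb)
    hence "S' \<subset> S" using bS unfolding S'_def by blast
    hence "dim S' < dim S"
      by (metis S' less.prems(1) dim_psubset span_eq_iff)
    from less.hyps[OF this S' inv] obtain B where B0: "finite B"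
      "\<forall>c\<in>B. norm c = 1 \<and> (\<exists>l. f c = l *\<^sub>R c)"
      "\<forall>c\<in>B. \<forall>d\<in>B. c \<noteq> d \<longrightarrow> c \<bullet> d = 0" "B \<subseteq> S'"
      "\<forall>x\<in>S'. x = (\<Sum>b\<in>B. (x \<bullet> b) *\<^sub>R b)" by (elim exE conjE)
    note B = B0(1) B0(2)[rule_format] B0(3)[rule_format] B0(4) B0(5)[rule_format]
    have bB: "b \<notin> B" using B(4) \<open>b \<notin> S'\<close> by auto
    have Bb: "c \<bullet> b = 0" "b \<bullet> c = 0" if "c \<in> B" for c using B(4) that by (auto simp: S'_def inner_commute)
    have "x = (\<Sum>c\<in>insert b B. (x \<bullet> c) *\<^sub>R c)" if x: "x \<in> S" for x
    proof -
      define x' where "x' = x - (x \<bullet> b) *\<^sub>R b"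
      have "x' \<in> S'" using x bS less.prems(1)
        by (simp add: S'_def x'_def subspace_diff subspace_scale inner_diff_left bb)
      hence "x' = (\<Sum>c\<in>B. (x' \<bullet> c) *\<^sub>R c)" by (rule B(5))
      also have "\<dots> = (\<Sum>c\<in>B. (x \<bullet> c) *\<^sub>R c)"
        by (intro sum.cong) (simp_all add: x'_def inner_diff_left Bb)
      finally show ?thesis using B(1) bB by (simp add: x'_def algebra_simps)
    qed
    thus ?thesis using B bB Bb nb bS fb
      by (intro exI[of _ "insert b B"]) (auto simp: S'_def)
  qed
qed

lemma symmetric_nth: "transpose X = X \<Longrightarrow> X $ i $ j = X $ j $ i"
  by (simp add: transpose_def vec_eq_iff)

lemma symmetric_inner: "transpose X = X \<Longrightarrow> x \<bullet> (X *v y) = (X *v x) \<bullet> (y :: real^'n)"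
  by (metis dot_lmul_matrix vector_transpose_matrix)

text \<open>In an eigenbasis the root multiplies each eigenvector by the square root of its
  eigenvalue. The eigenvalue is nonnegative, being a value of the quadratic form.\<close>

lemma psd_sqrt_exists:
  assumes "psd X" shows "\<exists>S. psd S \<and> S ** S = X"
proof -
  define f where "f = (*v) X"
  have lin: "linear f" unfolding f_def by simp
  have tr: "transpose X = X" and pos: "0 \<le> v \<bullet> f v" for v using assms by (auto simp: psd_def f_def)
  have "\<exists>B. finite B \<and> (\<forall>b\<in>B. norm b = 1 \<and> (\<exists>l. f b = l *\<^sub>R b)) \<and>
      (\<forall>b\<in>B. \<forall>c\<in>B. b \<noteq> c \<longrightarrow> b \<bullet> c = 0) \<and> B \<subseteq> UNIV \<and> (\<forall>x\<in>UNIV. x = (\<Sum>b\<in>B. (x \<bullet> b) *\<^sub>R b))"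
    by (rule selfadjoint_eigenbasis[OF lin]) (simp_all add: f_def symmetric_inner[OF tr])
  then obtain B where B: "finite B" "\<forall>b\<in>B. norm b = 1 \<and> (\<exists>l. f b = l *\<^sub>R b)"
    "\<forall>b\<in>B. \<forall>c\<in>B. b \<noteq> c \<longrightarrow> b \<bullet> c = 0"
    and rep: "\<forall>x\<in>UNIV. x = (\<Sum>b\<in>B. (x \<bullet> b) *\<^sub>R b)" by (elim exE conjE)
  define l where "l b = b \<bullet> f b" for b
  have bb: "b \<bullet> b = 1" if "b \<in> B" for b using B(2) that by (simp add: norm_eq_1)
  have fb: "f b = l b *\<^sub>R b" if "b \<in> B" for b
    using B(2) that bb[OF that] by (fastforce simp: l_def)
  have l0: "l b \<ge> 0" for b using pos by (simp add: l_def)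
  define g where "g x = (\<Sum>b\<in>B. (sqrt (l b) * (x \<bullet> b)) *\<^sub>R b)" for x
  have g: "linear g"
    by (intro linearI) (simp_all add: g_def inner_add_left algebra_simps sum.distrib scaleR_sum_right)
  have gb: "g x \<bullet> b = sqrt (l b) * (x \<bullet> b)" if "b \<in> B" for x b
  proof -
    have "g x \<bullet> b = (\<Sum>c\<in>B. if c = b then sqrt (l b) * (x \<bullet> b) else 0)"
      unfolding g_def inner_sum_left using B(3) that bb by (intro sum.cong) auto
    thus ?thesis using B(1) that by simp
  qed
  have gg: "g (g x) = f x" for x
  proof -
    have "g (g x) = (\<Sum>b\<in>B. (x \<bullet> b) *\<^sub>R f b)"
      unfolding g_def[of "g x"] by (intro sum.cong) (simp_all add: gb fb l0 flip: mult.assoc)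
    also have "\<dots> = f (\<Sum>b\<in>B. (x \<bullet> b) *\<^sub>R b)"
      by (simp add: linear_sum[OF lin] linear_cmul[OF lin])
    finally show ?thesis using rep[THEN bspec, of x] by simp
  qed
  have gsym: "x \<bullet> g y = g x \<bullet> y" for x y
    unfolding g_def inner_sum_left inner_sum_right by (intro sum.cong) (simp_all add: inner_commute)
  have gpos: "0 \<le> x \<bullet> g x" for x
    unfolding g_def inner_sum_right by (intro sum_nonneg) (simp add: l0 mult.assoc)
  define S where "S = matrix g"
  have Sg: "S *v x = g x" for x unfolding S_def by (simp add: matrix_works g)
  have "S $ i $ j = S $ j $ i" for i j
  proof -
    have "S $ i $ j = axis i 1 \<bullet> g (axis j 1)" for i j
      unfolding Sg[symmetric] by (simp add: matrix_vector_mul_component inner_axis inner_axis')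
    thus ?thesis using gsym by (metis inner_commute)
  qed
  hence "transpose S = S" by (simp add: transpose_def vec_eq_iff)
  moreover have "S ** S = X"
    unfolding matrix_eq by (simp add: matrix_vector_mul_assoc[symmetric] Sg gg f_def)
  ultimately show ?thesis using gpos by (auto simp: psd_def Sg)
qed

text \<open>With a root \<open>R\<close> of \<open>S\<close>, the quadratic form is the squared norm
  of \<open>R *v v\<close>. Only the existence of roots enters, so the lemma may serve in the proof
  of their uniqueness.\<close>

lemma psd_quadratic_zero:
  assumes "psd S" "v \<bullet> (S *v v) = 0" shows "S *v v = 0"
proof -
  obtain R where R: "psd R" "R ** R = S" using psd_sqrt_exists[OF assms(1)] by auto
  have "v \<bullet> (S *v v) = (R *v v) \<bullet> (R *v v)"
    using R symmetric_inner[of R v "R *v v"] by (auto simp: psd_def matrix_vector_mul_assoc)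
  hence "R *v v = 0" using assms(2) by simp
  thus ?thesis by (simp add: R(2)[symmetric] matrix_vector_mul_assoc[symmetric])
qed

text \<open>With D = S - T one has S D + D T = 0; the traces of D S D and D T D are nonnegative
  with sum 0.\<close>

lemma psd_sqrt_unique:
  assumes "psd S" "psd T" "S ** S = T ** T" shows "S = T"
proof -
  define D where "D = S - T"
  have tS: "transpose S = S" and tT: "transpose T = T" using assms by (auto simp: psd_def)
  have tD: "transpose D = D" using tS tT by (simp add: D_def transpose_def vec_eq_iff)
  have SD: "S ** D + D ** T = 0" using assms(3)
    by (simp add: D_def bounded_bilinear.diff_left[OF bounded_bilinear_matrix_mult]
        bounded_bilinear.diff_right[OF bounded_bilinear_matrix_mult])
  \<comment> \<open>Row \<open>i\<close> of the symmetric \<open>D\<close> is also its column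
    \<open>i\<close>, so summing the quadratic form over the rows gives a trace.\<close>
  have tr: "(\<Sum>i\<in>UNIV. D $ i \<bullet> (R *v (D $ i))) = trace (D ** R ** D)" for R
    unfolding trace_def
  proof (intro sum.cong refl)
    fix i
    have sym: "D $ a $ b = D $ b $ a" for a b using tD by (rule symmetric_nth)
    show "D $ i \<bullet> (R *v (D $ i)) = (D ** R ** D) $ i $ i"
      unfolding matrix_mul_assoc[symmetric]
      by (simp add: inner_vec_def matrix_matrix_mult_def matrix_vector_mult_def sym[of i])
  qed
  have "trace (D ** S ** D) + trace (D ** T ** D) = trace (D ** (S ** D + D ** T))"
    by (simp add: matrix_add_ldistrib trace_add matrix_mul_assoc trace_mul_sym[of "D ** T" D])
  also have "\<dots> = 0" by (simp add: SD trace_def)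
  finally have sum0: "(\<Sum>i\<in>UNIV. D $ i \<bullet> (S *v (D $ i))) + (\<Sum>i\<in>UNIV. D $ i \<bullet> (T *v (D $ i))) = 0"
    by (simp add: tr)
  have nn: "0 \<le> v \<bullet> (S *v v)" "0 \<le> v \<bullet> (T *v v)" for v using assms by (auto simp: psd_def)
  hence z: "(\<Sum>i\<in>UNIV. D $ i \<bullet> (S *v (D $ i))) = 0" "(\<Sum>i\<in>UNIV. D $ i \<bullet> (T *v (D $ i))) = 0"
    using sum0 by (smt (verit) sum_nonneg)+
  have "D $ i \<bullet> (S *v (D $ i)) = 0" "D $ i \<bullet> (T *v (D $ i)) = 0" for i
    using z nn by (simp_all add: sum_nonneg_eq_0_iff)
  hence *: "S *v (D $ i) = 0" "T *v (D $ i) = 0" for i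
    using psd_quadratic_zero assms by blast+
  have "D *v (D $ i) = 0" for i using * by (simp add: D_def matrix_vector_mult_diff_rdistrib)
  hence "D $ i \<bullet> D $ i = 0" for i
    by (metis matrix_vector_mul_component zero_index)
  hence "D = 0" by (simp add: vec_eq_iff)
  thus ?thesis by (simp add: D_def)
qed

lemma
  assumes "psd X"
  shows psd_psd_sqrt: "psd (psd_sqrt X)" and psd_sqrt_mult_self: "psd_sqrt X ** psd_sqrt X = X"
proof -
  have "\<exists>!S. psd S \<and> S ** S = X" using psd_sqrt_exists[OF assms] psd_sqrt_unique by metis
  from theI'[OF this] show "psd (psd_sqrt X)" "psd_sqrt X ** psd_sqrt X = X"
    by (auto simp: psd_sqrt_def)
qed

lemma psd_sqrt_eqI: "psd S \<Longrightarrow> S ** S = X \<Longrightarrow> psd_sqrt X = S"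
  unfolding psd_sqrt_def using psd_sqrt_unique by blast

text \<open>The root is symmetric, so its squared Frobenius norm is the trace of its square
  \<open>X\<close>, a sum of \<open>CARD('n)\<close> entries each bounded by
  \<open>norm X\<close>.\<close>

lemma norm_psd_sqrt_le:
  assumes "psd (X :: real^'n^'n)" shows "(norm (psd_sqrt X))\<^sup>2 \<le> real CARD('n) * norm X"
proof -
  define S where "S = psd_sqrt X"
  have S: "transpose S = S" "S ** S = X"
    using psd_psd_sqrt[OF assms] psd_sqrt_mult_self[OF assms] by (auto simp: S_def psd_def)
  have sym: "S $ a $ b = S $ b $ a" for a b using S(1) by (rule symmetric_nth)
  have "(norm S)\<^sup>2 = (\<Sum>i\<in>UNIV. \<Sum>j\<in>UNIV. S $ i $ j * S $ j $ i)"
    unfolding power2_norm_matrix by (intro sum.cong refl) (metis sym power2_eq_square)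
  also have "\<dots> = (\<Sum>i\<in>UNIV. (S ** S) $ i $ i)"
    by (simp add: matrix_matrix_mult_def)
  also have "\<dots> \<le> (\<Sum>i\<in>(UNIV::'n set). norm X)"
    unfolding S(2) using abs_matrix_nth_le_norm[of X] by (intro sum_mono) (meson abs_le_D1)
  finally show ?thesis by (simp add: S_def)
qed

lemma closed_psd: "closed {X :: real^'n^'n. psd X}"
proof -
  have "{X :: real^'n^'n. psd X} = {X. transpose X = X} \<inter> (\<Inter>v. {X. 0 \<le> v \<bullet> (X *v v)})"
    by (auto simp: psd_def)
  moreover have "closed {X :: real^'n^'n. transpose X = X}"
    by (intro closed_Collect_eq linear_continuous_on bounded_linear_transpose continuous_intros)
  moreover have "closed {X :: real^'n^'n. 0 \<le> v \<bullet> (X *v v)}" for v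
    by (intro closed_Collect_le continuous_intros
        bounded_bilinear.continuous_on[OF bounded_bilinear_matrix_vector_mult])
  ultimately show ?thesis by (auto intro!: closed_Int closed_INT)
qed

text \<open>Squaring is a continuous injection on the psd matrices of bounded norm. These form a
  compact set, so the inverse is continuous on the image; \<open>norm_psd_sqrt_le\<close> shows that
  the image covers every psd matrix of norm below \<open>r\<close>. Continuity is local, hence it
  holds on the whole cone.\<close>

lemma continuous_on_psd_sqrt: "continuous_on {X :: real^'n^'n. psd X} psd_sqrt"
proof -
  have *: "continuous_on {X :: real^'n^'n. psd X \<and> norm X < r} psd_sqrt" for r
  proof -
    define K where "K = {S :: real^'n^'n. psd S} \<inter> cball 0 (sqrt (real CARD('n) * r))"
    have K: "compact K" unfolding K_def
      by (intro closed_Int_compact closed_psd compact_cball)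
    have "continuous_on ((\<lambda>S. S ** S) ` K) psd_sqrt"
    proof (rule continuous_on_inv[OF _ K])
      show "continuous_on K (\<lambda>S. S ** S)"
        by (intro continuous_on_matrix_mult continuous_on_id)
      show "\<forall>S\<in>K. psd_sqrt (S ** S) = S"
        using psd_sqrt_eqI[OF _ refl] unfolding K_def by blast
    qed
    moreover have "{X :: real^'n^'n. psd X \<and> norm X < r} \<subseteq> (\<lambda>S. S ** S) ` K"
    proof
      fix X :: "real^'n^'n" assume "X \<in> {X. psd X \<and> norm X < r}"
      hence X: "psd X" "norm X < r" by auto
      have "(norm (psd_sqrt X))\<^sup>2 \<le> real CARD('n) * r"
        using norm_psd_sqrt_le[OF X(1)] X(2)
        by (smt (verit) mult_left_mono of_nat_0_le_iff)
      hence "psd_sqrt X \<in> K" using psd_psd_sqrt[OF X(1)]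
        by (simp add: K_def real_le_rsqrt)
      thus "X \<in> (\<lambda>S. S ** S) ` K" using psd_sqrt_mult_self[OF X(1)]
        by (intro image_eqI[of _ _ "psd_sqrt X"]) simp_all
    qed
    ultimately show ?thesis by (rule continuous_on_subset)
  qed
  show ?thesis unfolding continuous_on_def
  proof
    fix X :: "real^'n^'n" assume X: "X \<in> {X. psd X}"
    define r where "r = norm X + 1"
    have "(psd_sqrt \<longlongrightarrow> psd_sqrt X) (at X within {X. psd X \<and> norm X < r})"
      using *[of r] X by (simp add: continuous_on_def r_def)
    moreover have "at X within {X. psd X \<and> norm X < r} = at X within {X. psd X}"
      by (rule at_within_nhd[of _ "ball 0 r"]) (auto simp: r_def)
    ultimately show "(psd_sqrt \<longlongrightarrow> psd_sqrt X) (at X within {X. psd X})" by simp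
  qed
qed

lemma psd_add: "psd X \<Longrightarrow> psd Y \<Longrightarrow> psd (X + Y)"
  by (simp add: psd_def transpose_def vec_eq_iff matrix_vector_mult_add_rdistrib inner_add_right)

lemma pd_imp_psd: "pd X \<Longrightarrow> psd X"
  unfolding pd_def psd_def by (metis inner_zero_left order_le_less)

lemma psd_0: "psd 0"
  by (simp add: psd_def transpose_def vec_eq_iff)

section \<open>The matrix exponential and linear differential equations\<close>

definition mpow :: "real^'n^'n \<Rightarrow> nat \<Rightarrow> real^'n^'n" where
  "mpow X k = (((**) X) ^^ k) (mat 1)"

lemma mpow_0: "mpow X 0 = mat 1"
  and mpow_Suc: "mpow X (Suc k) = X ** mpow X k"
  by (simp_all add: mpow_def)

lemma mpow_commute: "mpow X k ** X = X ** mpow X k"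
  by (induction k) (simp_all add: mpow_0 mpow_Suc flip: matrix_mul_assoc)

lemma mpow_scaleR: "mpow (t *\<^sub>R X) k = t ^ k *\<^sub>R mpow X k"
proof (induction k)
  case (Suc k)
  thus ?case
    by (simp add: mpow_Suc bounded_bilinear.scaleR_left[OF bounded_bilinear_matrix_mult]
        bounded_bilinear.scaleR_right[OF bounded_bilinear_matrix_mult] mult.commute)
qed (simp add: mpow_0)

text \<open>The factor \<open>norm (mat 1)\<close> is the price of the Frobenius norm, for which the
  identity does not have norm 1 in general.\<close>

lemma norm_mpow_le: "norm (mpow X k) \<le> norm X ^ k * norm (mat 1 :: real^'n^'n)" for X :: "real^'n^'n"
proof (induction k)
  case (Suc k)
  have "norm (mpow X (Suc k)) \<le> norm X * norm (mpow X k)"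
    unfolding mpow_Suc by (rule norm_matrix_mult_le)
  also have "\<dots> \<le> norm X * (norm X ^ k * norm (mat 1 :: real^'n^'n))"
    by (intro mult_left_mono Suc.IH) simp
  finally show ?case by (simp add: mult.assoc)
qed (simp add: mpow_0)

lemma summable_mexp: "summable (\<lambda>k. mpow X k /\<^sub>R fact k)"
proof (rule summable_comparison_test')
  show "summable (\<lambda>k. inverse (fact k) * norm X ^ k * norm (mat 1 :: real^'a^'a))"
    by (intro summable_mult2 summable_exp)
  show "norm (mpow X k /\<^sub>R fact k) \<le> inverse (fact k) * norm X ^ k * norm (mat 1 :: real^'a^'a)" if "k \<ge> 0" for k
    using norm_mpow_le[of X k] by (simp add: mult.assoc mult_left_mono)
qed

lemma mexp_sums: "(\<lambda>k. mpow X k /\<^sub>R fact k) sums mexp X"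
  unfolding mexp_def mpow_def[symmetric] by (rule summable_sums[OF summable_mexp])

lemma mexp_0: "mexp (0 :: real^'n^'n) = mat 1"
proof -
  have "(\<lambda>k. mpow (0 :: real^'n^'n) k /\<^sub>R fact k) = (\<lambda>k. if k = 0 then mat 1 else 0)"
  proof
    fix k :: nat
    show "mpow (0 :: real^'n^'n) k /\<^sub>R fact k = (if k = 0 then mat 1 else 0)"
      by (cases k) (simp_all add: mpow_0 mpow_Suc bounded_bilinear.zero_left[OF bounded_bilinear_matrix_mult])
  qed
  hence "(\<lambda>k. if k = 0 then mat 1 else 0) sums mexp (0 :: real^'n^'n)"
    using mexp_sums[of "0 :: real^'n^'n"] by simp
  thus ?thesis using sums_single[of 0 "\<lambda>_. mat 1 :: real^'n^'n"] sums_unique2 by blast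
qed

lemma mexp_commute: "mexp (t *\<^sub>R X) ** X = X ** mexp (t *\<^sub>R X)"
proof -
  let ?a = "\<lambda>k. mpow (t *\<^sub>R X) k /\<^sub>R fact k"
  have "(\<lambda>k. ?a k ** X) sums (mexp (t *\<^sub>R X) ** X)"
    by (rule bounded_linear.sums[OF bounded_bilinear.bounded_linear_left[OF bounded_bilinear_matrix_mult] mexp_sums])
  moreover have "(\<lambda>k. X ** ?a k) sums (X ** mexp (t *\<^sub>R X))"
    by (rule bounded_linear.sums[OF bounded_bilinear.bounded_linear_right[OF bounded_bilinear_matrix_mult] mexp_sums])
  moreover have "?a k ** X = X ** ?a k" for k
    by (simp add: mpow_scaleR mpow_commute bounded_bilinear.scaleR_left[OF bounded_bilinear_matrix_mult]
        bounded_bilinear.scaleR_right[OF bounded_bilinear_matrix_mult])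
  ultimately show ?thesis using sums_unique2 by simp
qed

lemma has_vector_derivative_matrixI:
  fixes f :: "real \<Rightarrow> real^'n^'m"
  assumes "\<And>i j. ((\<lambda>t. f t $ i $ j) has_vector_derivative D $ i $ j) F"
  shows "(f has_vector_derivative D) F"
proof -
  have if_sum: "(\<Sum>y\<in>A. if P then g y else (0::real)) = (if P then sum g A else 0)" for A :: "'n set" and P g
    by simp
  have eq: "X = (\<Sum>i\<in>UNIV. \<Sum>j\<in>UNIV. X $ i $ j *\<^sub>R (axis i (axis j 1) :: real^'n^'m))" for X :: "real^'n^'m"
    by (simp add: vec_eq_iff axis_def if_distrib[of "\<lambda>x. x $ _"] if_distrib[of "\<lambda>x. _ * x"] if_sum cong: if_cong)
  have "((\<lambda>t. \<Sum>i\<in>UNIV. \<Sum>j\<in>UNIV. f t $ i $ j *\<^sub>R (axis i (axis j 1) :: real^'n^'m)) has_vector_derivative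
      (\<Sum>i\<in>UNIV. \<Sum>j\<in>UNIV. D $ i $ j *\<^sub>R axis i (axis j 1))) F"
    by (intro has_vector_derivative_sum bounded_linear.has_vector_derivative[OF bounded_linear_scaleR_left] assms)
  thus ?thesis using eq by simp
qed

text \<open>Each entry is a scalar power series in \<open>t\<close> that converges everywhere, so
  the termwise differentiation theorem for scalar series applies.\<close>

lemma has_vector_derivative_mexp:
  "((\<lambda>t. mexp (t *\<^sub>R X)) has_vector_derivative X ** mexp (t *\<^sub>R X)) (at t within S)"
proof (rule has_vector_derivative_matrixI)
  fix i j
  define c where "c k = (mpow X k /\<^sub>R fact k) $ i $ j" for k
  have lin: "bounded_linear (\<lambda>Z :: real^'a^'a. Z $ i $ j)"
    by (intro bounded_linear_compose[OF bounded_linear_vec_nth bounded_linear_vec_nth])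
  have c: "(\<lambda>k. c k * y ^ k) sums (mexp (y *\<^sub>R X) $ i $ j)" for y
    using bounded_linear.sums[OF lin mexp_sums[of "y *\<^sub>R X"]] by (simp add: c_def mpow_scaleR mult.commute mult.left_commute mult.assoc)
  have lin': "bounded_linear (\<lambda>Z :: real^'a^'a. (X ** Z) $ i $ j)"
    using bounded_linear_compose[OF lin bounded_bilinear.bounded_linear_right[OF bounded_bilinear_matrix_mult, of X]] .
  \<comment> \<open>The factor \<open>k + 1\<close> produced by differentiation turns
    \<open>1 / fact (k + 1)\<close> into \<open>1 / fact k\<close>, and one factor \<open>X\<close>
    is split off the power.\<close>
  have "diffs c k = (X ** (mpow X k /\<^sub>R fact k)) $ i $ j" for k
    by (simp add: diffs_def c_def mpow_Suc bounded_bilinear.scaleR_right[OF bounded_bilinear_matrix_mult]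
        field_simps del: of_nat_Suc)
  hence "(\<lambda>k. diffs c k * t ^ k) sums ((X ** mexp (t *\<^sub>R X)) $ i $ j)"
    using bounded_linear.sums[OF lin' mexp_sums[of "t *\<^sub>R X"]]
    by (simp add: mpow_scaleR bounded_bilinear.scaleR_right[OF bounded_bilinear_matrix_mult] mult.commute mult.left_commute mult.assoc)
  hence d: "(\<Sum>k. diffs c k * t ^ k) = (X ** mexp (t *\<^sub>R X)) $ i $ j" by (simp add: sums_iff)
  have "((\<lambda>y. \<Sum>k. c k * y ^ k) has_field_derivative (\<Sum>k. diffs c k * t ^ k)) (at t)"
    using c by (intro termdiffs_strong_converges_everywhere) (auto simp: sums_iff)
  hence "((\<lambda>y. mexp (y *\<^sub>R X) $ i $ j) has_field_derivative (X ** mexp (t *\<^sub>R X)) $ i $ j) (at t)"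
    unfolding d using c by (simp add: sums_iff)
  thus "((\<lambda>y. mexp (y *\<^sub>R X) $ i $ j) has_vector_derivative (X ** mexp (t *\<^sub>R X)) $ i $ j) (at t within S)"
    by (simp add: has_field_derivative_at_within has_real_derivative_iff_has_vector_derivative[symmetric])
qed

lemma has_vector_derivative_mexp_diff:
  "((\<lambda>s. mexp ((t - s) *\<^sub>R X)) has_vector_derivative - (X ** mexp ((t - s) *\<^sub>R X))) (at s within S)"
proof -
  have "((\<lambda>s. t - s) has_vector_derivative -1) (at s within S)"
    by (auto intro!: derivative_eq_intros)
  from vector_diff_chain_within[OF this has_vector_derivative_mexp] show ?thesis
    by (simp add: o_def)
qed

lemma continuous_on_mexp_diff: "continuous_on S (\<lambda>s. mexp ((t - s) *\<^sub>R X))"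
  unfolding continuous_on_eq_continuous_within
  using has_vector_derivative_continuous[OF has_vector_derivative_mexp_diff] by blast

text \<open>Variation of constants: in the derivative of
  \<open>mexp ((t - s) *\<^sub>R X) *v m s\<close> the terms containing \<open>m\<close> cancel,
  because \<open>X\<close> commutes with its exponential. Integrating what remains over
  \<open>[0, t]\<close> gives the formula, and with it uniqueness.\<close>

lemma linear_ode_solution:
  fixes m :: "real \<Rightarrow> real^'n"
  assumes "0 \<le> t" and cont: "continuous_on {0..t} m"
    and eq: "\<And>s. 0 \<le> s \<Longrightarrow> s \<le> t \<Longrightarrow> m s = m 0 + integral {0..s} (\<lambda>u. X *v m u + b)"
  shows "m t = mexp (t *\<^sub>R X) *v m 0 + integral {0..t} (\<lambda>s. mexp ((t - s) *\<^sub>R X)) *v b"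
proof -
  let ?E = "\<lambda>s. mexp ((t - s) *\<^sub>R X)"
  \<comment> \<open>Continuity of the integrand is what turns the integral equation into a
    differential equation at every point.\<close>
  have c: "continuous_on {0..t} (\<lambda>u. X *v m u + b)"
    by (intro continuous_intros bounded_bilinear.continuous_on[OF bounded_bilinear_matrix_vector_mult] cont)
  have D: "(m has_vector_derivative (X *v m s + b)) (at s within {0..t})" if "s \<in> {0..t}" for s
  proof -
    have "((\<lambda>s. m 0 + integral {0..s} (\<lambda>u. X *v m u + b)) has_vector_derivative (0 + (X *v m s + b))) (at s within {0..t})"
      by (intro has_vector_derivative_add has_vector_derivative_const integral_has_vector_derivative[OF c that])
    hence 1: "((\<lambda>s. m 0 + integral {0..s} (\<lambda>u. X *v m u + b)) has_vector_derivative (X *v m s + b)) (at s within {0..t})"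
      unfolding add_0 .
    show ?thesis
      by (rule has_vector_derivative_weaken[OF 1 that order_refl], rule eq[symmetric]) auto
  qed
  have "((\<lambda>s. ?E s *v b) has_integral (?E t *v m t - ?E 0 *v m 0)) {0..t}"
  proof (rule fundamental_theorem_of_calculus[OF assms(1)])
    fix s assume s: "s \<in> {0..t}"
    have "((\<lambda>s. ?E s *v m s) has_vector_derivative (?E s *v (X *v m s + b) + - (X ** ?E s) *v m s)) (at s within {0..t})"
      by (rule bounded_bilinear.has_vector_derivative[OF bounded_bilinear_matrix_vector_mult
            has_vector_derivative_mexp_diff D[OF s]])
    moreover have "?E s *v (X *v m s + b) + - (X ** ?E s) *v m s = ?E s *v b"
      by (simp add: matrix_vector_right_distrib matrix_vector_mul_assoc mexp_commute
          bounded_bilinear.minus_left[OF bounded_bilinear_matrix_vector_mult])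
    ultimately show "((\<lambda>s. ?E s *v m s) has_vector_derivative ?E s *v b) (at s within {0..t})" by simp
  qed
  moreover have "((\<lambda>s. ?E s *v b) has_integral (integral {0..t} ?E *v b)) {0..t}"
    using has_integral_linear[OF integrable_integral[OF integrable_continuous_real[OF continuous_on_mexp_diff]]
        bounded_bilinear.bounded_linear_left[OF bounded_bilinear_matrix_vector_mult, of b]]
    by (simp add: o_def)
  ultimately have "?E t *v m t - ?E 0 *v m 0 = integral {0..t} ?E *v b"
    by (rule has_integral_unique)
  thus ?thesis by (simp add: mexp_0 algebra_simps)
qed

text \<open>The product of \<open>X\<close> with the integrand is minus the derivative in
  \<open>s\<close> of \<open>mexp ((t - s) *\<^sub>R X)\<close>. For invertible \<open>X\<close>
  this evaluates the integral.\<close>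

lemma mult_integral_mexp:
  assumes "0 \<le> t" shows "X ** integral {0..t} (\<lambda>s. mexp ((t - s) *\<^sub>R X)) = mexp (t *\<^sub>R X) - mat 1"
proof -
  let ?E = "\<lambda>s. mexp ((t - s) *\<^sub>R X)"
  have "((\<lambda>s. - (X ** ?E s)) has_integral (?E t - ?E 0)) {0..t}"
    by (intro fundamental_theorem_of_calculus assms has_vector_derivative_mexp_diff)
  from has_integral_neg[OF this]
  have "((\<lambda>s. X ** ?E s) has_integral (mexp (t *\<^sub>R X) - mat 1)) {0..t}"
    by (simp add: mexp_0)
  moreover have "((\<lambda>s. X ** ?E s) has_integral (X ** integral {0..t} ?E)) {0..t}"
    using has_integral_linear[OF integrable_integral[OF integrable_continuous_real[OF continuous_on_mexp_diff]]
        bounded_bilinear.bounded_linear_right[OF bounded_bilinear_matrix_mult, of X]]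
    by (simp add: o_def)
  ultimately show ?thesis by (rule has_integral_unique[symmetric])
qed

lemma matrix_inv_left_right:
  assumes "invertible (X :: real^'n^'n)"
  shows "matrix_inv X ** X = mat 1" "X ** matrix_inv X = mat 1"
  using someI_ex[OF assms[unfolded invertible_def]] unfolding matrix_inv_def by simp_all

lemma matrix_inv_mexp_commute:
  assumes "invertible X" shows "matrix_inv X ** mexp (t *\<^sub>R X) = mexp (t *\<^sub>R X) ** matrix_inv X"
proof -
  have "matrix_inv X ** mexp (t *\<^sub>R X) = matrix_inv X ** (mexp (t *\<^sub>R X) ** X) ** matrix_inv X"
    by (simp add: matrix_mul_assoc[symmetric] matrix_inv_left_right[OF assms])
  also have "\<dots> = mexp (t *\<^sub>R X) ** matrix_inv X"
    unfolding mexp_commute by (simp add: matrix_mul_assoc matrix_inv_left_right[OF assms])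
  finally show ?thesis .
qed

lemma integral_mexp_mult:
  assumes "0 \<le> t" "invertible X"
  shows "integral {0..t} (\<lambda>s. mexp ((t - s) *\<^sub>R X)) *v b =
    mexp (t *\<^sub>R X) *v (matrix_inv X *v b) - matrix_inv X *v b"
proof -
  have "integral {0..t} (\<lambda>s. mexp ((t - s) *\<^sub>R X)) = matrix_inv X ** (mexp (t *\<^sub>R X) - mat 1)"
    by (simp add: mult_integral_mexp[OF assms(1), symmetric] matrix_mul_assoc matrix_inv_left_right[OF assms(2)])
  also have "\<dots> = mexp (t *\<^sub>R X) ** matrix_inv X - matrix_inv X"
    by (simp add: bounded_bilinear.diff_right[OF bounded_bilinear_matrix_mult] matrix_inv_mexp_commute[OF assms(2)])
  finally show ?thesis by (simp add: matrix_vector_mult_diff_rdistrib matrix_vector_mul_assoc)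
qed

section \<open>Cadlag paths\<close>

lemma left_lim_0: "left_lim f 0 = f 0"
  by (simp add: left_lim_def)

lemma tendsto_imp_left_lim: "(f \<longlongrightarrow> l) (at_left t) \<Longrightarrow> t > 0 \<Longrightarrow> left_lim f t = l"
  by (simp add: left_lim_def tendsto_Lim)

lemma tendsto_left_lim:
  assumes "cadlag f" "s > 0" shows "(f \<longlongrightarrow> left_lim f s) (at_left s)"
  using assms tendsto_imp_left_lim unfolding cadlag_def by metis

text \<open>Bisection: the property passes to adjacent intervals, and near each point it holds with
  that point as the only exception. The interval \<open>{u<..v}\<close> is open at \<open>u\<close>,
  so \<open>u\<close> itself may belong to \<open>R\<close>; this matches right-continuity and
  covers the pieces between consecutive points of \<open>R\<close>, closed on the left and open on
  the right.\<close>

lemma cadlag_partition: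
  fixes f :: "real \<Rightarrow> 'b::metric_space"
  assumes "cadlag f" "0 \<le> t" "0 < e"
  shows "\<exists>R. finite R \<and> (\<forall>u v. 0 \<le> u \<and> u \<le> v \<and> v \<le> t \<and> {u<..v} \<inter> R = {} \<longrightarrow> dist (f u) (f v) < e)"
proof -
  define P where "P a b \<longleftrightarrow> (\<exists>R. finite R \<and> (\<forall>u v. 0 \<le> u \<and> a \<le> u \<and> u \<le> v \<and> v \<le> b \<and> {u<..v} \<inter> R = {} \<longrightarrow> dist (f u) (f v) < e))" for a b
  have "P 0 t"
    using assms(2)
  proof (induction rule: Bolzano)
    case (trans a b c)
    obtain R where R: "finite R" "\<And>u v. 0 \<le> u \<Longrightarrow> a \<le> u \<Longrightarrow> u \<le> v \<Longrightarrow> v \<le> b \<Longrightarrow> {u<..v} \<inter> R = {} \<Longrightarrow> dist (f u) (f v) < e"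
      using trans(1) unfolding P_def by blast
    obtain Q where Q: "finite Q" "\<And>u v. 0 \<le> u \<Longrightarrow> b \<le> u \<Longrightarrow> u \<le> v \<Longrightarrow> v \<le> c \<Longrightarrow> {u<..v} \<inter> Q = {} \<Longrightarrow> dist (f u) (f v) < e"
      using trans(2) unfolding P_def by blast
    \<comment> \<open>With \<open>b\<close> among the exceptional points, no admissible pair
      \<open>u\<close>, \<open>v\<close> lies on both sides of \<open>b\<close>.\<close>
    show ?case unfolding P_def
    proof (intro exI[of _ "insert b (R \<union> Q)"] conjI allI impI)
      fix u v assume *: "0 \<le> u \<and> a \<le> u \<and> u \<le> v \<and> v \<le> c \<and> {u<..v} \<inter> insert b (R \<union> Q) = {}"
      hence "b \<le> u \<or> v < b" by force
      thus "dist (f u) (f v) < e"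
        using * R(2)[of u v] Q(2)[of u v] by force
    qed (use R Q in simp)
  next
    case (local x)
    have "(f \<longlongrightarrow> f x) (at_right x)" using assms(1) local by (simp add: cadlag_def)
    hence "\<forall>\<^sub>F u in at_right x. dist (f u) (f x) < e/2"
      by (rule tendstoD) (use assms(3) in simp)
    then obtain d where d: "d > x" "\<And>u. x < u \<Longrightarrow> u < d \<Longrightarrow> dist (f u) (f x) < e/2"
      unfolding eventually_at_right_field by blast
    have d': "dist (f u) (f x) < e/2" if "x \<le> u" "u < d" for u
      using that d(2)[of u] assms(3) by (cases "u = x") auto
    \<comment> \<open>At \<open>x = 0\<close> the clause is vacuous, as no \<open>u\<close>
      satisfies \<open>0 \<le> u\<close> and \<open>u < 0\<close>; any negative \<open>c\<close>
      will do.\<close>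
    obtain c l where c: "c < x" "\<And>u. 0 \<le> u \<Longrightarrow> c < u \<Longrightarrow> u < x \<Longrightarrow> dist (f u) l < e/2"
    proof (cases "x = 0")
      case True
      thus ?thesis using that[of "-1"] by simp
    next
      case False
      then obtain l where "(f \<longlongrightarrow> l) (at_left x)" using assms(1) local unfolding cadlag_def by force
      hence "\<forall>\<^sub>F u in at_left x. dist (f u) l < e/2"
        by (rule tendstoD) (use assms(3) in simp)
      then obtain c where "c < x" "\<And>u. c < u \<Longrightarrow> u < x \<Longrightarrow> dist (f u) l < e/2"
        unfolding eventually_at_left_field by blast
      thus ?thesis using that by blast
    qed
    have "P a b" if ab: "a \<le> x" "x \<le> b" "b - a < min (d - x) (x - c)" for a b
      unfolding P_def
    proof (intro exI[of _ "{x}"] conjI allI impI)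
      fix u v assume *: "0 \<le> u \<and> a \<le> u \<and> u \<le> v \<and> v \<le> b \<and> {u<..v} \<inter> {x} = {}"
      hence "x \<le> u \<or> v < x" by force
      thus "dist (f u) (f v) < e"
      proof
        assume "x \<le> u"
        hence "dist (f u) (f x) < e/2" "dist (f v) (f x) < e/2" using * ab by (intro d'; linarith)+
        thus ?thesis by (rule dist_triangle_half_l)
      next
        assume "v < x"
        hence "dist (f u) l < e/2" "dist (f v) l < e/2" using * ab by (intro c(2); linarith)+
        thus ?thesis by (rule dist_triangle_half_l)
      qed
    qed simp
    thus ?case using d(1) c(1) by (intro exI[of _ "min (d - x) (x - c)"]) auto
  qed
  thus ?thesis unfolding P_def by auto
qed

lemma cadlag_bounded:
  fixes f :: "real \<Rightarrow> 'b::real_normed_vector"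
  assumes "cadlag f" "0 \<le> t"
  shows "\<exists>K. \<forall>s\<in>{0..t}. norm (f s) \<le> K"
proof -
  obtain R where R: "finite R"
    "\<And>u v. 0 \<le> u \<Longrightarrow> u \<le> v \<Longrightarrow> v \<le> t \<Longrightarrow> {u<..v} \<inter> R = {} \<Longrightarrow> dist (f u) (f v) < 1"
    using cadlag_partition[OF assms, of 1] by auto
  define K where "K = Max ((\<lambda>r. norm (f r)) ` insert 0 R)"
  have "norm (f s) \<le> K + 1" if s: "s \<in> {0..t}" for s
  proof -
    \<comment> \<open>The point 0 is added so that a last partition point \<open>r\<close> before
      \<open>s\<close> always exists; from \<open>r\<close> to \<open>s\<close> the path moves by
      less than 1.\<close>
    define S where "S = insert 0 (R \<inter> {0..s})"
    define r where "r = Max S"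
    have S: "finite S" "S \<noteq> {}" using R(1) by (auto simp: S_def)
    have rS: "r \<in> S" unfolding r_def by (rule Max_in[OF S])
    have max: "q \<le> r" if "q \<in> S" for q unfolding r_def by (rule Max_ge[OF S(1) that])
    have r: "0 \<le> r" "r \<le> s" "r \<in> insert 0 R" using rS s by (auto simp: S_def)
    have "{r<..s} \<inter> R = {}" 
    proof (intro equals0I)
      fix q assume q: "q \<in> {r<..s} \<inter> R"
      hence "q \<in> S" using r(1) by (auto simp: S_def)
      from max[OF this] q show False by simp
    qed
    hence "dist (f r) (f s) < 1" using R(2)[of r s] r s by simp
    moreover have "norm (f r) \<le> K" unfolding K_def using r(3) R(1) by (intro Max_ge) auto
    moreover have "norm (f s) \<le> norm (f r) + dist (f r) (f s)"
      using norm_triangle_sub[of "f s" "f r"] by (simp add: dist_norm norm_minus_commute)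
    ultimately show ?thesis by linarith
  qed
  thus ?thesis by blast
qed

lemma norm_left_lim_le:
  fixes f :: "real \<Rightarrow> 'b::real_normed_vector"
  assumes "cadlag f" "0 \<le> s" "s \<le> t" "\<And>u. 0 \<le> u \<Longrightarrow> u \<le> t \<Longrightarrow> norm (f u) \<le> K"
  shows "norm (left_lim f s) \<le> K"
proof (cases "s = 0")
  case False
  hence "s > 0" using assms by simp
  have "\<forall>\<^sub>F u in at_left s. norm (f u) \<le> K"
    unfolding eventually_at_left_field using \<open>s > 0\<close> assms(3,4) by (intro exI[of _ 0]) auto
  thus ?thesis
    using tendsto_upperbound[OF tendsto_norm[OF tendsto_left_lim[OF assms(1) \<open>s > 0\<close>]]] by simp
qed (use assms in \<open>simp add: left_lim_0\<close>)

text \<open>The integrands of the volatility equation are functions of left limits; this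
  left-continuity makes their integrals accessible to left-endpoint Riemann sums.\<close>

lemma tendsto_left_lim_left_lim:
  fixes f :: "real \<Rightarrow> 'b::metric_space"
  assumes "cadlag f" "s > 0" shows "(left_lim f \<longlongrightarrow> left_lim f s) (at_left s)"
proof (rule tendstoI)
  fix e :: real assume e: "e > 0"
  have "\<forall>\<^sub>F u in at_left s. dist (f u) (left_lim f s) < e/2"
    by (rule tendstoD[OF tendsto_left_lim[OF assms]]) (use e in simp)
  then obtain c where c: "c < s" "\<And>u. c < u \<Longrightarrow> u < s \<Longrightarrow> dist (f u) (left_lim f s) < e/2"
    unfolding eventually_at_left_field by blast
  have "dist (left_lim f u) (left_lim f s) < e" if u: "max c 0 < u" "u < s" for u
  proof -
    have "\<forall>\<^sub>F v in at_left u. dist (f v) (left_lim f s) \<le> e/2"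
      unfolding eventually_at_left_field using c(2) u by (intro exI[of _ c]) (force intro: less_imp_le)
    hence "dist (left_lim f u) (left_lim f s) \<le> e/2"
      by (rule tendsto_upperbound[OF tendsto_dist[OF tendsto_left_lim[OF assms(1)] tendsto_const], rotated])
        (use u in auto)
    thus ?thesis using e by simp
  qed
  thus "\<forall>\<^sub>F u in at_left s. dist (left_lim f u) (left_lim f s) < e"
    unfolding eventually_at_left_field using c(1) assms(2) by (intro exI[of _ "max c 0"]) auto
qed

lemma tendsto_jump:
  fixes f :: "real \<Rightarrow> 'b::real_normed_vector"
  assumes "cadlag f" "s > 0" shows "((\<lambda>u. f s - f u) \<longlongrightarrow> jump f s) (at_left s)"
  unfolding jump_def by (intro tendsto_intros tendsto_left_lim assms)

section \<open>Riemann sums\<close>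

text \<open>Equidistant points. For \<open>n = 0\<close> the division by zero makes all points equal
  to \<open>a\<close>, so they stay at or above \<open>a\<close> for every \<open>n\<close>.\<close>

definition grid :: "real \<Rightarrow> real \<Rightarrow> nat \<Rightarrow> nat \<Rightarrow> real" where
  "grid a b n i = a + (b - a) * real i / real n"

text \<open>Index of the cell containing \<open>s\<close>. Cells are open on the left and closed on
  the right, hence a ceiling minus one instead of a floor.\<close>

definition cell :: "real \<Rightarrow> real \<Rightarrow> nat \<Rightarrow> real \<Rightarrow> nat" where
  "cell a b n s = nat (\<lceil>(s - a) * real n / (b - a)\<rceil> - 1)"

lemma grid_0: "grid a b n 0 = a"
  and grid_n: "n > 0 \<Longrightarrow> grid a b n n = b"
  by (simp_all add: grid_def)

lemma grid_mono: "a \<le> b \<Longrightarrow> i \<le> j \<Longrightarrow> grid a b n i \<le> grid a b n j"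
  unfolding grid_def by (intro add_left_mono divide_right_mono mult_left_mono) auto

lemma grid_bounds:
  assumes "a \<le> b" "n > 0" "i \<le> n" shows "a \<le> grid a b n i" "grid a b n i \<le> b"
  using grid_mono[OF assms(1), of 0 i n] grid_mono[OF assms(1,3), of n] assms(2)
  by (simp_all add: grid_0 grid_n)

lemma grid_Suc_diff: "grid a b n (Suc i) - grid a b n i = (b - a) / real n"
  by (cases "n = 0") (simp_all add: grid_def field_simps)

lemma cell_bounds:
  assumes s: "a < s" "s \<le> b" and n: "n > 0"
  shows "cell a b n s < n" "grid a b n (cell a b n s) < s" "s \<le> grid a b n (Suc (cell a b n s))"
proof -
  define x where "x = (s - a) * real n / (b - a)"
  have x: "0 < x" "x \<le> real n" using s n by (auto simp: x_def field_simps)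
  hence c: "1 \<le> \<lceil>x\<rceil>" "\<lceil>x\<rceil> \<le> int n" by (auto simp: ceiling_le_iff)
  have cell: "cell a b n s = nat (\<lceil>x\<rceil> - 1)" by (simp add: cell_def x_def)
  show "cell a b n s < n" using c n unfolding cell by linarith
  have r: "real (cell a b n s) = of_int \<lceil>x\<rceil> - 1" using c unfolding cell by simp
  have lt: "real (cell a b n s) < x" and le: "x \<le> real (cell a b n s) + 1"
    unfolding r by linarith+
  have sx: "s = a + (b - a) * x / real n" using s n by (simp add: x_def)
  show "grid a b n (cell a b n s) < s"
    unfolding grid_def by (subst sx) (use s n lt in \<open>simp add: divide_strict_right_mono mult_strict_left_mono\<close>)
  show "s \<le> grid a b n (Suc (cell a b n s))"
    unfolding grid_def by (subst sx) (use s n le in \<open>simp add: divide_right_mono mult_left_mono add.commute\<close>)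
qed

lemma cell_unique:
  assumes "a < b" "n > 0" "grid a b n i < s" "s \<le> grid a b n (Suc i)"
  shows "cell a b n s = i"
proof -
  have "real i < (s - a) * real n / (b - a)" "(s - a) * real n / (b - a) \<le> real i + 1"
    using assms by (simp_all add: grid_def field_simps)
  hence "\<lceil>(s - a) * real n / (b - a)\<rceil> = int i + 1" by linarith
  thus ?thesis by (simp add: cell_def)
qed

lemma sum_cells:
  fixes h :: "nat \<Rightarrow> 'c::{comm_monoid_add}"
  assumes "a < s" "s \<le> b" "n > 0"
  shows "(\<Sum>i<n. if s \<in> {grid a b n i<..grid a b n (Suc i)} then h i else 0) = h (cell a b n s)"
proof -
  have "s \<in> {grid a b n i<..grid a b n (Suc i)} \<longleftrightarrow> i = cell a b n s" for i
  proof
    assume "s \<in> {grid a b n i<..grid a b n (Suc i)}"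
    thus "i = cell a b n s" using assms by (intro cell_unique[symmetric]) auto
  qed (use cell_bounds(2,3)[OF assms] in simp)
  thus ?thesis using cell_bounds(1)[OF assms] by simp
qed

text \<open>The left end of the cell approaches \<open>s\<close> while staying strictly below it, so
  evaluating there yields a left limit in the limit.\<close>

lemma filterlim_grid_cell:
  assumes "a < s" "s \<le> b"
  shows "filterlim (\<lambda>n. grid a b n (cell a b n s)) (at_left s) sequentially"
  unfolding filterlim_at
proof (intro conjI)
  have "(\<lambda>n. (b - a) / real n) \<longlonglongrightarrow> 0" by (rule lim_const_over_n)
  hence 1: "(\<lambda>n. s - (b - a) / real n) \<longlonglongrightarrow> s" using tendsto_diff[OF tendsto_const] by fastforce
  show "(\<lambda>n. grid a b n (cell a b n s)) \<longlonglongrightarrow> s"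
  proof (rule tendsto_sandwich[OF _ _ 1 tendsto_const])
    show "\<forall>\<^sub>F n in sequentially. s - (b - a) / real n \<le> grid a b n (cell a b n s)"
      using eventually_gt_at_top[of 0]
    proof eventually_elim
      case (elim n)
      from cell_bounds(3)[OF assms elim] show ?case
        using grid_Suc_diff[of a b n "cell a b n s"] by linarith
    qed
    show "\<forall>\<^sub>F n in sequentially. grid a b n (cell a b n s) \<le> s"
      using eventually_gt_at_top[of 0] by eventually_elim (use cell_bounds(2)[OF assms] in \<open>auto intro: less_imp_le\<close>)
  qed
  show "\<forall>\<^sub>F n in sequentially. grid a b n (cell a b n s) \<in> {..<s} \<and> grid a b n (cell a b n s) \<noteq> s"
    using eventually_gt_at_top[of 0] 
  proof eventually_elim
    case (elim n)
    from cell_bounds(2)[OF assms elim] show ?case by simp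
  qed
qed

lemma tendsto_grid_Suc_cell:
  assumes "a < s" "s \<le> b"
  shows "filterlim (\<lambda>n. grid a b n (Suc (cell a b n s))) (nhds s) sequentially"
    and "n > 0 \<Longrightarrow> s \<le> grid a b n (Suc (cell a b n s))"
proof -
  have "(\<lambda>n. grid a b n (cell a b n s) + (b - a) / real n) \<longlonglongrightarrow> s + 0"
    using filterlim_grid_cell[OF assms] by (intro tendsto_add lim_const_over_n) (simp add: filterlim_at)
  moreover have "grid a b n (Suc (cell a b n s)) = grid a b n (cell a b n s) + (b - a) / real n" for n
    using grid_Suc_diff[of a b n "cell a b n s"] by linarith
  ultimately show "filterlim (\<lambda>n. grid a b n (Suc (cell a b n s))) (nhds s) sequentially" by simp
qed (rule cell_bounds(3)[OF assms])

text \<open>The right end of the cell approaches \<open>s\<close> from above and may coincide with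
  it. Together with the left ends, the increment of the path over the cell of \<open>s\<close> tends
  to the jump at \<open>s\<close>.\<close>

lemma cadlag_tendsto_grid_Suc_cell:
  assumes "cadlag f" "0 \<le> a" "a < s" "s \<le> b"
  shows "(\<lambda>n. f (grid a b n (Suc (cell a b n s)))) \<longlonglongrightarrow> f s"
proof -
  have "{s..} - {s} = {s<..} - {s}" by auto
  hence "at s within {s..} = at_right s" by (simp add: at_within_def)
  hence "continuous (at s within {s..}) f" using assms by (simp add: cadlag_def continuous_within)
  moreover have "\<forall>\<^sub>F n in sequentially. grid a b n (Suc (cell a b n s)) \<in> {s..}"
    using eventually_gt_at_top[of 0] by eventually_elim (use tendsto_grid_Suc_cell(2)[OF assms(3,4)] in auto)
  ultimately show ?thesis
    using tendsto_grid_Suc_cell(1)[OF assms(3,4)] by (rule continuous_within_tendsto_compose)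
qed

lemma grid_tendsto_left_lim:
  assumes "(H \<longlongrightarrow> l) (at_left s)" "a < s" "s \<le> b"
  shows "(\<lambda>n. H (grid a b n (cell a b n s))) \<longlonglongrightarrow> l"
  by (rule filterlim_compose[OF assms(1) filterlim_grid_cell[OF assms(2,3)]])

text \<open>Dominated convergence for the step functions \<open>h n\<close>, with majorant
  \<open>K\<close> times the absolute weight; the limit inherits its measurability from them. The
  measure is left general because two cases occur: interval measures with weight 1, and counting
  measure with products of jumps as weight.\<close>

lemma riemann_sums_tendsto:
  fixes H Hm w :: "real \<Rightarrow> real"
  assumes ab: "a < b" and w: "set_integrable \<mu> {a<..b} w"
    and sets: "\<And>c d. {c<..d} \<in> sets \<mu>"
    and bd: "\<And>s. a \<le> s \<Longrightarrow> s < b \<Longrightarrow> \<bar>H s\<bar> \<le> K"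
    and lim: "\<And>s. a < s \<Longrightarrow> s \<le> b \<Longrightarrow> (H \<longlongrightarrow> Hm s) (at_left s)"
  shows "(\<lambda>n. \<Sum>i<n. H (grid a b n i) * (LINT s:{grid a b n i<..grid a b n (Suc i)}|\<mu>. w s))
        \<longlonglongrightarrow> (LINT s:{a<..b}|\<mu>. Hm s * w s)"
proof -
  define I where "I n i = {grid a b n i<..grid a b n (Suc i)}" for n i
  have Isub: "I n i \<subseteq> {a<..b}" if "i < n" for n i
    using grid_bounds(1)[of a b n i] grid_bounds(2)[of a b n "Suc i"] ab that by (auto simp: I_def)
  have K: "K \<ge> 0" using bd[of a] ab by simp
  define h where "h n s = (\<Sum>i<n. if s \<in> I n i then H (grid a b n i) * w s else 0)" for n s
  have h_cell: "h n s = H (grid a b n (cell a b n s)) * w s" if "a < s" "s \<le> b" "n > 0" for n s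
    unfolding h_def I_def by (rule sum_cells[OF that])
  have h_0: "h n s = 0" if "s \<notin> {a<..b}" for n s
    unfolding h_def using Isub that by (intro sum.neutral ballI) (metis lessThan_iff subsetD)
  have int: "set_integrable \<mu> (I n i) (\<lambda>s. H (grid a b n i) * w s)" if "i < n" for n i
    by (intro set_integrable_mult_right set_integrable_subset[OF w _ Isub[OF that]]) (simp add: I_def sets)
  have h_ind: "h n s = (\<Sum>i<n. indicator (I n i) s *\<^sub>R (H (grid a b n i) * w s))" for n s
    unfolding h_def by (intro sum.cong) (simp_all add: indicator_def)
  have h_int: "integrable \<mu> (h n)" for n
    unfolding h_ind[abs_def] using int by (intro Bochner_Integration.integrable_sum) (simp add: set_integrable_def)
  have h_integral: "integral\<^sup>L \<mu> (h n) = (\<Sum>i<n. H (grid a b n i) * (LINT s:I n i|\<mu>. w s))" for n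
  proof -
    have "integral\<^sup>L \<mu> (h n) = (\<Sum>i<n. LINT s:I n i|\<mu>. H (grid a b n i) * w s)"
      unfolding h_ind[abs_def] set_lebesgue_integral_def using int
      by (intro Bochner_Integration.integral_sum) (simp add: set_integrable_def)
    thus ?thesis by simp
  qed
  define f where "f s = indicator {a<..b} s *\<^sub>R (Hm s * w s)" for s
  have h_lim: "(\<lambda>n. h n s) \<longlonglongrightarrow> f s" for s
  proof (cases "s \<in> {a<..b}")
    case True
    hence "(\<lambda>n. H (grid a b n (cell a b n s)) * w s) \<longlonglongrightarrow> Hm s * w s"
      by (intro tendsto_intros grid_tendsto_left_lim lim) auto
    moreover have "\<forall>\<^sub>F n in sequentially. H (grid a b n (cell a b n s)) * w s = h n s"
      using eventually_gt_at_top[of 0] by eventually_elim (use h_cell True in simp)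
    ultimately have "(\<lambda>n. h n s) \<longlonglongrightarrow> Hm s * w s" by (rule Lim_transform_eventually)
    thus ?thesis using True by (simp add: f_def)
  qed (simp add: h_0 f_def)
  have h_bd: "norm (h n s) \<le> K * norm (indicator {a<..b} s *\<^sub>R w s)" for n s
  proof (cases "s \<in> {a<..b} \<and> n > 0")
    case True
    hence s: "a < s" "s \<le> b" "n > 0" by auto
    have "\<bar>H (grid a b n (cell a b n s))\<bar> \<le> K"
      using cell_bounds[OF s] grid_bounds(1)[of a b n "cell a b n s"] ab s by (intro bd) auto
    thus ?thesis using h_cell[OF s] True by (simp add: abs_mult mult_right_mono)
  next
    case False
    hence "h n s = 0" using h_0 by (cases "n = 0") (auto simp: h_def)
    thus ?thesis using K by simp
  qed
  have meas: "f \<in> borel_measurable \<mu>"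
    by (rule borel_measurable_LIMSEQ_real[OF h_lim]) (rule borel_measurable_integrable[OF h_int])
  have dom: "integrable \<mu> (\<lambda>s. K * norm (indicator {a<..b} s *\<^sub>R w s))"
    by (intro integrable_mult_right integrable_norm) (use w in \<open>simp add: set_integrable_def\<close>)
  note * = meas borel_measurable_integrable[OF h_int] dom AE_I2[OF h_lim] AE_I2[OF h_bd]
  show "(\<lambda>n. \<Sum>i<n. H (grid a b n i) * (LINT s:{grid a b n i<..grid a b n (Suc i)}|\<mu>. w s))
        \<longlonglongrightarrow> (LINT s:{a<..b}|\<mu>. Hm s * w s)"
    using integral_dominated_convergence[OF *]
    by (simp add: h_integral I_def f_def[abs_def] set_lebesgue_integral_def)
qed

lemma interval_measure_riemann_sums:
  assumes "mono P" "\<And>a. continuous (at_right a) P" "0 < t"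
    and bd: "\<And>s. 0 \<le> s \<Longrightarrow> s \<le> t \<Longrightarrow> \<bar>H s\<bar> \<le> K"
    and lim: "\<And>s. 0 < s \<Longrightarrow> s \<le> t \<Longrightarrow> (H \<longlongrightarrow> H s) (at_left s)"
  shows "(\<lambda>n. \<Sum>i<n. H (grid 0 t n i) * (P (grid 0 t n (Suc i)) - P (grid 0 t n i)))
    \<longlonglongrightarrow> (LINT s:{0<..t}|interval_measure P. H s)"
proof -
  have m: "(LINT s:{a<..b}|interval_measure P. 1) = P b - P a" if "a \<le> b" for a b
    using that assms(1,2) by (simp add: set_lebesgue_integral_def measure_interval_measure_Ioc mono_def)
  have "emeasure (interval_measure P) {0<..t} = ennreal (P t - P 0)"
    using assms by (intro emeasure_interval_measure_Ioc) (auto simp: mono_def)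
  hence "set_integrable (interval_measure P) {0<..t} (\<lambda>_. 1 :: real)"
    by (simp add: set_integrable_def)
  from riemann_sums_tendsto[OF assms(3) this, of H K H] show ?thesis
    using bd lim assms(3) by (simp add: m grid_mono)
qed

text \<open>The sums involve only the values of \<open>X\<close> on the grid, so they determine the
  integral whichever decomposition \<open>P\<close>, \<open>N\<close> witnesses it.\<close>

lemma has_ls_integral_riemann_sums:
  assumes "has_ls_integral H X t I" "0 < t"
    and bd: "\<And>s. 0 \<le> s \<Longrightarrow> s \<le> t \<Longrightarrow> \<bar>H s\<bar> \<le> K"
    and lim: "\<And>s. 0 < s \<Longrightarrow> s \<le> t \<Longrightarrow> (H \<longlongrightarrow> H s) (at_left s)"
  shows "(\<lambda>n. \<Sum>i<n. H (grid 0 t n i) * (X (grid 0 t n (Suc i)) - X (grid 0 t n i))) \<longlonglongrightarrow> I"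
proof -
  obtain P N where P: "mono P" "\<And>a. continuous (at_right a) P" and N: "mono N" "\<And>a. continuous (at_right a) N"
    and X: "\<And>s. s \<in> {0..t} \<Longrightarrow> X s = P s - N s"
    and I: "I = (LINT s:{0<..t}|interval_measure P. H s) - (LINT s:{0<..t}|interval_measure N. H s)"
    using assms(1) unfolding has_ls_integral_def by blast
  have "(\<lambda>n. (\<Sum>i<n. H (grid 0 t n i) * (P (grid 0 t n (Suc i)) - P (grid 0 t n i)))
     - (\<Sum>i<n. H (grid 0 t n i) * (N (grid 0 t n (Suc i)) - N (grid 0 t n i)))) \<longlonglongrightarrow> I"
    unfolding I
    by (intro tendsto_diff interval_measure_riemann_sums[where K = K] P N assms)
  moreover have "(\<Sum>i<n. H (grid 0 t n i) * (P (grid 0 t n (Suc i)) - P (grid 0 t n i)))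
     - (\<Sum>i<n. H (grid 0 t n i) * (N (grid 0 t n (Suc i)) - N (grid 0 t n i))) =
     (\<Sum>i<n. H (grid 0 t n i) * (X (grid 0 t n (Suc i)) - X (grid 0 t n i)))" for n
    unfolding sum_subtractf[symmetric]
  proof (intro sum.cong refl)
    fix i assume "i \<in> {..<n}"
    hence "grid 0 t n i \<in> {0..t}" "grid 0 t n (Suc i) \<in> {0..t}"
      using grid_bounds[of 0 t n i] grid_bounds[of 0 t n "Suc i"] assms(2) by auto
    thus "H (grid 0 t n i) * (P (grid 0 t n (Suc i)) - P (grid 0 t n i)) -
      H (grid 0 t n i) * (N (grid 0 t n (Suc i)) - N (grid 0 t n i)) =
      H (grid 0 t n i) * (X (grid 0 t n (Suc i)) - X (grid 0 t n i))"
      by (simp add: X algebra_simps)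
  qed
  ultimately show ?thesis by simp
qed

lemma jump_0: "jump f 0 = 0"
  by (simp add: jump_def left_lim_0)

lemma set_integrable_jump_products:
  assumes "set_integrable (count_space UNIV) S (\<lambda>s. (norm (jump l s))\<^sup>2)"
  shows "set_integrable (count_space UNIV) S (\<lambda>s. outer (jump l s) (jump l s))"
    and "set_integrable (count_space UNIV) S (\<lambda>s. jump l s $ i * jump l s $ j)"
proof -
  show 1: "set_integrable (count_space UNIV) S (\<lambda>s. outer (jump l s) (jump l s))"
    using assms by (rule set_integrable_bound) (auto simp: norm_outer power2_eq_square set_borel_measurable_def)
  have "integrable (count_space UNIV) (\<lambda>s. (indicator S s *\<^sub>R outer (jump l s) (jump l s)) $ i $ j)"
    using 1 unfolding set_integrable_def
    by (intro integrable_bounded_linear[OF bounded_linear_vec_nth] )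
  thus "set_integrable (count_space UNIV) S (\<lambda>s. jump l s $ i * jump l s $ j)"
    by (simp add: set_integrable_def outer_def)
qed

text \<open>Square summability of the jumps makes the infinite sum absolutely convergent, so that it
  agrees with an integral for counting measure, which is additive over adjacent intervals.\<close>

lemma discont_qv_increment:
  fixes l :: "real \<Rightarrow> real^'n"
  assumes int: "set_integrable (count_space UNIV) {0<..t} (\<lambda>s. (norm (jump l s))\<^sup>2)"
    and ab: "0 \<le> a" "a \<le> b" "b \<le> t"
  shows "discont_qv l b $ i $ j - discont_qv l a $ i $ j =
    (LINT s:{a<..b}|count_space UNIV. jump l s $ i * jump l s $ j)"
proof -
  have lin: "bounded_linear (\<lambda>Z :: real^'n^'n. Z $ i $ j)"
    by (intro bounded_linear_compose[OF bounded_linear_vec_nth bounded_linear_vec_nth])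
  have entry: "discont_qv l c $ i $ j = (LINT s:{0<..c}|count_space UNIV. jump l s $ i * jump l s $ j)"
    if c: "0 \<le> c" "c \<le> t" for c
  proof -
    let ?O = "\<lambda>s. outer (jump l s) (jump l s)"
    \<comment> \<open>By convention there is no jump at time 0, so \<open>{0..c}\<close> and
      \<open>{0<..c}\<close> give the same sum.\<close>
    have eq: "indicator {0..c} s *\<^sub>R ?O s = indicator {0<..c} s *\<^sub>R ?O s" for s
      by (cases "s = 0") (auto simp: jump_0 outer_def vec_eq_iff split: split_indicator)
    have "set_integrable (count_space UNIV) {0<..c} (\<lambda>s. (norm (jump l s))\<^sup>2)"
      using int by (rule set_integrable_subset) (use c in auto)
    from set_integrable_jump_products(1)[OF this]
    have O: "integrable (count_space UNIV) (\<lambda>s. indicator {0<..c} s *\<^sub>R ?O s)"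
      by (simp add: set_integrable_def)
    hence "Infinite_Set_Sum.abs_summable_on ?O {0..c}"
      unfolding abs_summable_on_altdef set_integrable_def eq .
    from infsetsum_infsum[OF this]
    have "discont_qv l c = (LINT s|count_space UNIV. indicator {0<..c} s *\<^sub>R ?O s)"
      unfolding discont_qv_def infsetsum_altdef set_lebesgue_integral_def eq by simp
    hence "discont_qv l c $ i $ j = (LINT s|count_space UNIV. (indicator {0<..c} s *\<^sub>R ?O s) $ i $ j)"
      using integral_bounded_linear[OF lin O] by simp
    thus ?thesis by (simp add: set_lebesgue_integral_def outer_def)
  qed
  have un: "{0<..b} = {0<..a} \<union> {a<..b}" using ab by auto
  have "set_integrable (count_space UNIV) {0<..t} (\<lambda>s. jump l s $ i * jump l s $ j)"
    by (rule set_integrable_jump_products[OF int])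
  hence "set_integrable (count_space UNIV) {0<..a} (\<lambda>s. jump l s $ i * jump l s $ j)"
    "set_integrable (count_space UNIV) {a<..b} (\<lambda>s. jump l s $ i * jump l s $ j)"
    using ab by (auto intro: set_integrable_subset)
  hence "(LINT s:{0<..b}|count_space UNIV. jump l s $ i * jump l s $ j) =
     (LINT s:{0<..a}|count_space UNIV. jump l s $ i * jump l s $ j) +
     (LINT s:{a<..b}|count_space UNIV. jump l s $ i * jump l s $ j)"
    unfolding un by (intro set_integral_Un) auto
  thus ?thesis using ab by (simp add: entry)
qed

text \<open>Both sides are limits of the same Riemann sums: those of the Stieltjes integral, and
  those for counting measure weighted by the jump products. From here on no Stieltjes integral is
  needed.\<close>

lemma has_ls_integral_discont_qv:
  assumes "has_ls_integral H (\<lambda>s. discont_qv l s $ i $ j) t I" "0 < t"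
    and int: "set_integrable (count_space UNIV) {0<..t} (\<lambda>s. (norm (jump l s))\<^sup>2)"
    and bd: "\<And>s. 0 \<le> s \<Longrightarrow> s \<le> t \<Longrightarrow> \<bar>H s\<bar> \<le> K"
    and lim: "\<And>s. 0 < s \<Longrightarrow> s \<le> t \<Longrightarrow> (H \<longlongrightarrow> H s) (at_left s)"
  shows "I = (LINT s:{0<..t}|count_space UNIV. H s * (jump l s $ i * jump l s $ j))"
proof -
  have "(\<lambda>n. \<Sum>k<n. H (grid 0 t n k) * (LINT s:{grid 0 t n k<..grid 0 t n (Suc k)}|count_space UNIV. jump l s $ i * jump l s $ j))
    \<longlonglongrightarrow> (LINT s:{0<..t}|count_space UNIV. H s * (jump l s $ i * jump l s $ j))"
    by (intro riemann_sums_tendsto[where K = K] set_integrable_jump_products int assms(2) bd lim) auto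
  moreover have "(\<Sum>k<n. H (grid 0 t n k) * (LINT s:{grid 0 t n k<..grid 0 t n (Suc k)}|count_space UNIV. jump l s $ i * jump l s $ j))
     = (\<Sum>k<n. H (grid 0 t n k) * (discont_qv l (grid 0 t n (Suc k)) $ i $ j - discont_qv l (grid 0 t n k) $ i $ j))" for n
  proof (intro sum.cong refl)
    fix k assume "k \<in> {..<n}"
    hence "0 \<le> grid 0 t n k" "grid 0 t n k \<le> grid 0 t n (Suc k)" "grid 0 t n (Suc k) \<le> t"
      using grid_bounds[of 0 t n k] grid_bounds[of 0 t n "Suc k"] grid_mono[of 0 t k "Suc k" n] assms(2) by auto
    from discont_qv_increment[OF int this] show
      "H (grid 0 t n k) * (LINT s:{grid 0 t n k<..grid 0 t n (Suc k)}|count_space UNIV. jump l s $ i * jump l s $ j) =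
       H (grid 0 t n k) * (discont_qv l (grid 0 t n (Suc k)) $ i $ j - discont_qv l (grid 0 t n k) $ i $ j)" by simp
  qed
  moreover have "(\<lambda>n. \<Sum>k<n. H (grid 0 t n k) * (discont_qv l (grid 0 t n (Suc k)) $ i $ j - discont_qv l (grid 0 t n k) $ i $ j)) \<longlonglongrightarrow> I"
    by (rule has_ls_integral_riemann_sums[OF assms(1,2) bd lim])
  ultimately show ?thesis using LIMSEQ_unique by simp
qed

text \<open>Outside a finite set \<open>R\<close> the path moves too little for \<open>f\<close> to
  notice. On a fine grid the points of \<open>R\<close> lie in different cells; all other cells
  contribute 0, and the increments over the cells of \<open>R\<close> tend to the jumps
  there.\<close>

lemma increment_sums_tendsto:
  fixes l :: "real \<Rightarrow> 'b::real_normed_vector" and f :: "'b \<Rightarrow> real"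
  assumes cad: "cadlag l" and ab: "0 \<le> a" "a < b" and cf: "continuous_on UNIV f"
    and d: "0 < d" "\<And>x. norm x < d \<Longrightarrow> f x = 0"
  obtains R where "finite R" "R \<subseteq> {a<..b}" "\<And>u. u \<in> {a<..b} \<Longrightarrow> u \<notin> R \<Longrightarrow> f (jump l u) = 0"
    "(\<lambda>n. \<Sum>i<n. f (l (grid a b n (Suc i)) - l (grid a b n i))) \<longlonglongrightarrow> (\<Sum>u\<in>R. f (jump l u))"
proof -
  \<comment> \<open>The oscillation bound \<open>d/2\<close> leaves room for limits: jumps outside
    \<open>R0\<close> have norm at most \<open>d/2\<close>, still strictly below
    \<open>d\<close>.\<close>
  obtain R0 where R0: "finite R0"
    "\<And>u v. 0 \<le> u \<Longrightarrow> u \<le> v \<Longrightarrow> v \<le> b \<Longrightarrow> {u<..v} \<inter> R0 = {} \<Longrightarrow> dist (l u) (l v) < d/2"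
    using cadlag_partition[OF cad, of b "d/2"] ab d(1) by auto
  define R where "R = R0 \<inter> {a<..b}"
  have R: "finite R" "R \<subseteq> {a<..b}" using R0(1) by (auto simp: R_def)
  have R_jump: "f (jump l u) = 0" if u: "u \<in> {a<..b}" "u \<notin> R" for u
  proof -
    have "\<forall>\<^sub>F v in at_left u. \<forall>r\<in>R0. r \<notin> {v<..u}"
    proof (rule eventually_ball_finite[OF R0(1)], rule ballI)
      fix r assume r: "r \<in> R0"
      hence "r \<noteq> u" using u by (auto simp: R_def)
      show "\<forall>\<^sub>F v in at_left u. r \<notin> {v<..u}"
      proof (cases "r < u")
        case True
        show ?thesis unfolding eventually_at_left_field using True by (intro exI[of _ r]) auto
      qed (use \<open>r \<noteq> u\<close> in auto)
    qed
    moreover have "\<forall>\<^sub>F v in at_left u. 0 \<le> v \<and> v \<le> u"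
      unfolding eventually_at_left_field using u ab by (intro exI[of _ 0]) auto
    ultimately have "\<forall>\<^sub>F v in at_left u. norm (l u - l v) \<le> d/2"
    proof eventually_elim
      case (elim v)
      have "dist (l v) (l u) < d/2" using elim u by (intro R0(2)) auto
      thus ?case by (simp add: dist_norm norm_minus_commute)
    qed
    hence "norm (jump l u) \<le> d/2"
      by (rule tendsto_upperbound[OF tendsto_norm[OF tendsto_jump[OF cad]], rotated]) (use u ab in auto)
    thus ?thesis using d(1) by (intro d(2)) simp
  qed
  have "\<forall>\<^sub>F n in sequentially. \<forall>r\<in>R. \<forall>q\<in>R. r \<noteq> q \<longrightarrow> cell a b n r \<noteq> cell a b n q"
  proof (intro eventually_ball_finite[OF R(1)] ballI)
    fix r q assume rq: "r \<in> R" "q \<in> R"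
    show "\<forall>\<^sub>F n in sequentially. r \<noteq> q \<longrightarrow> cell a b n r \<noteq> cell a b n q"
    proof (cases "r = q")
      case False
      \<comment> \<open>Two points of a common cell differ by at most the mesh, so a mesh below
        their distance separates them.\<close>
      have "(\<lambda>n. (b - a) / real n) \<longlonglongrightarrow> 0" by (rule lim_const_over_n)
      hence "\<forall>\<^sub>F n in sequentially. (b - a) / real n < \<bar>r - q\<bar>"
        using False by (intro order_tendstoD) auto
      thus ?thesis using eventually_gt_at_top[of 0]
      proof eventually_elim
        case (elim n)
        have "a < r" "r \<le> b" "a < q" "q \<le> b" using rq R(2) by auto
        hence "\<bar>r - q\<bar> \<le> (b - a) / real n" if "cell a b n r = cell a b n q"
          using cell_bounds(2,3)[OF _ _ elim(2), of a r b, unfolded that]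
            cell_bounds(2,3)[OF _ _ elim(2), of a q b]
            grid_Suc_diff[of a b n "cell a b n q"] by linarith
        thus ?case using elim by linarith
      qed
    qed simp
  qed
  hence ev: "\<forall>\<^sub>F n in sequentially. (\<Sum>r\<in>R. f (l (grid a b n (Suc (cell a b n r))) - l (grid a b n (cell a b n r)))) =
      (\<Sum>i<n. f (l (grid a b n (Suc i)) - l (grid a b n i)))"
    using eventually_gt_at_top[of 0]
  proof eventually_elim
    case (elim n)
    have inj: "inj_on (cell a b n) R" using elim(1) by (intro inj_onI) blast
    have sub: "cell a b n ` R \<subseteq> {..<n}" using cell_bounds(1)[of a _ b n] R(2) elim(2) by force
    have zero: "f (l (grid a b n (Suc i)) - l (grid a b n i)) = 0" if i: "i \<in> {..<n} - cell a b n ` R" for i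
    proof -
      have g: "a \<le> grid a b n i" "grid a b n i \<le> grid a b n (Suc i)" "grid a b n (Suc i) \<le> b"
        using grid_bounds[of a b n i] grid_bounds[of a b n "Suc i"] grid_mono[of a b i "Suc i" n] ab i by auto
      have "{grid a b n i<..grid a b n (Suc i)} \<inter> R0 = {}"
      proof (intro equals0I)
        fix r assume r: "r \<in> {grid a b n i<..grid a b n (Suc i)} \<inter> R0"
        hence "cell a b n r = i" using ab elim by (intro cell_unique) auto
        moreover have "r \<in> R" using r g by (auto simp: R_def)
        ultimately show False using i by auto
      qed
      hence "dist (l (grid a b n i)) (l (grid a b n (Suc i))) < d/2" using g ab by (intro R0(2)) auto
      thus ?thesis using d(1) by (intro d(2)) (simp add: dist_norm norm_minus_commute)
    qed
    have "(\<Sum>i<n. f (l (grid a b n (Suc i)) - l (grid a b n i))) =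
      (\<Sum>i\<in>cell a b n ` R. f (l (grid a b n (Suc i)) - l (grid a b n i)))"
      using sub zero by (intro sum.mono_neutral_right) auto
    thus ?case by (simp add: sum.reindex[OF inj])
  qed
  have "(\<lambda>n. \<Sum>r\<in>R. f (l (grid a b n (Suc (cell a b n r))) - l (grid a b n (cell a b n r))))
      \<longlonglongrightarrow> (\<Sum>r\<in>R. f (jump l r))"
  proof (rule tendsto_sum)
    fix r assume "r \<in> R"
    hence r: "a < r" "r \<le> b" using R(2) by auto
    have "(\<lambda>n. l (grid a b n (Suc (cell a b n r))) - l (grid a b n (cell a b n r))) \<longlonglongrightarrow> jump l r"
      unfolding jump_def using r ab
      by (intro tendsto_diff cadlag_tendsto_grid_Suc_cell[OF cad] grid_tendsto_left_lim tendsto_left_lim[OF cad]) auto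
    thus "(\<lambda>n. f (l (grid a b n (Suc (cell a b n r))) - l (grid a b n (cell a b n r)))) \<longlonglongrightarrow> f (jump l r)"
      by (rule continuous_on_tendsto_compose[OF cf]) auto
  qed
  from Lim_transform_eventually[OF this ev] show ?thesis using that R R_jump by blast
qed

section \<open>Sums over the jumps of a Levy process\<close>

text \<open>With values in \<open>ennreal\<close> the sum over the jumps in \<open>{a<..b}\<close>
  is meaningful for every path, summable or not.\<close>

definition jsum :: "('b \<Rightarrow> ennreal) \<Rightarrow> (real \<Rightarrow> 'b::real_normed_vector) \<Rightarrow> real \<Rightarrow> real \<Rightarrow> ennreal" where
  "jsum f l a b = (\<integral>\<^sup>+u. indicator {a<..b} u * f (jump l u) \<partial>count_space UNIV)"

lemma jsum_add: "a \<le> b \<Longrightarrow> b \<le> c \<Longrightarrow> jsum f l a c = jsum f l a b + jsum f l b c"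
  unfolding jsum_def
  by (subst nn_integral_add[symmetric]) (auto intro!: nn_integral_cong split: split_indicator)

lemma jsum_eq_sum:
  assumes "finite R" "R \<subseteq> {a<..b}" "\<And>u. u \<in> {a<..b} \<Longrightarrow> u \<notin> R \<Longrightarrow> f (jump l u) = 0"
  shows "jsum f l a b = (\<Sum>u\<in>R. f (jump l u))"
proof -
  have "jsum f l a b = (\<Sum>u\<in>R. indicator {a<..b} u * f (jump l u))"
    unfolding jsum_def using assms by (intro nn_integral_count_space') (auto split: split_indicator)
  also have "\<dots> = (\<Sum>u\<in>R. f (jump l u))"
    using assms(2) by (intro sum.cong) (auto split: split_indicator)
  finally show ?thesis .
qed

lemma jsum_LIMSEQ:
  assumes "\<And>x. incseq (\<lambda>k. f k x)" "\<And>x. (\<lambda>k. f k x) \<longlonglongrightarrow> g x"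
  shows "(\<lambda>k. jsum (f k) l a b) \<longlonglongrightarrow> jsum g l a b" "incseq (\<lambda>k. jsum (f k) l a b)"
proof -
  show "(\<lambda>k. jsum (f k) l a b) \<longlonglongrightarrow> jsum g l a b"
    unfolding jsum_def
  proof (rule nn_integral_LIMSEQ)
    show "incseq (\<lambda>k u. indicator {a<..b} u * f k (jump l u))"
      using assms(1) by (auto simp: incseq_def le_fun_def intro!: mult_left_mono)
    show "(\<lambda>k. indicator {a<..b} u * f k (jump l u)) \<longlonglongrightarrow> indicator {a<..b} u * g (jump l u)" for u
      using assms(2) by (auto split: split_indicator)
  qed simp
  show "incseq (\<lambda>k. jsum (f k) l a b)"
    unfolding jsum_def using assms(1)
    by (auto simp: incseq_def intro!: nn_integral_mono mult_left_mono)
qed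

lemma jsum_mono: "(\<And>x. f x \<le> g x) \<Longrightarrow> jsum f l a b \<le> jsum g l a b"
  unfolding jsum_def by (intro nn_integral_mono mult_left_mono) auto

lemma jsum_cmult: "jsum (\<lambda>x. c * f x) l a b = c * jsum f l a b"
  unfolding jsum_def by (subst nn_integral_cmult[symmetric]) (auto simp: mult_ac)

text \<open>The increments are used only through the factorization property \<open>increment\<close>, which combines
  their independence of the past and their stationarity.\<close>

locale levy_jumps = usual_filtered_prob_space M F
  for M :: "'a measure" and F +
  fixes L :: "real \<Rightarrow> 'a \<Rightarrow> real^'d" and \<nu> :: "(real^'d) measure"
  assumes cadlag_L: "cadlag (\<lambda>t. L t \<omega>)"
    and adapted_L: "0 \<le> t \<Longrightarrow> L t \<in> borel_measurable (F t)"
    and increment: "\<And>s t (Z :: 'a \<Rightarrow> ennreal) g. 0 \<le> s \<Longrightarrow> s \<le> t \<Longrightarrow> Z \<in> borel_measurable (F s) \<Longrightarrow>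
      g \<in> borel_measurable borel \<Longrightarrow>
      (\<integral>\<^sup>+\<omega>. Z \<omega> * g (L t \<omega> - L s \<omega>) \<partial>M) = (\<integral>\<^sup>+\<omega>. Z \<omega> \<partial>M) * (\<integral>\<^sup>+\<omega>. g (L (t - s) \<omega>) \<partial>M)"
    and levy_measure: "has_levy_measure M L \<nu>"
begin

lemma measurable_F_imp_M: "0 \<le> t \<Longrightarrow> f \<in> measurable (F t) N \<Longrightarrow> f \<in> measurable M N"
  using measurable_from_subalg[OF subalgebra_F] .

lemma measurable_F_mono: "0 \<le> s \<Longrightarrow> s \<le> t \<Longrightarrow> f \<in> measurable (F s) N \<Longrightarrow> f \<in> measurable (F t) N"
  by (rule measurable_from_subalg[of "F t" "F s"])
    (use F_mono[of s t] subalgebra_F[of s] subalgebra_F[of t] in \<open>simp_all add: subalgebra_def\<close>)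

lemma L_measurable: "0 \<le> s \<Longrightarrow> s \<le> t \<Longrightarrow> L s \<in> borel_measurable (F t)" "0 \<le> s \<Longrightarrow> L s \<in> borel_measurable M"
  using adapted_L measurable_F_mono measurable_F_imp_M by blast+

text \<open>The latest factor is split off first: everything before it is measurable at the left end
  of its cell and can take the role of \<open>Z\<close> in \<open>increment\<close>. By stationarity
  each cell contributes the same number.\<close>

lemma nn_integral_increments:
  assumes "0 \<le> a" "a \<le> b" and Z: "Z \<in> borel_measurable (F a)"
    and e[measurable]: "e \<in> borel_measurable borel" and n: "0 < n" "m \<le> n"
  shows "(\<integral>\<^sup>+\<omega>. Z \<omega> * (\<Prod>i<m. e (L (grid a b n (Suc i)) \<omega> - L (grid a b n i) \<omega>)) \<partial>M) =
    (\<integral>\<^sup>+\<omega>. Z \<omega> \<partial>M) * (\<integral>\<^sup>+\<omega>. e (L ((b - a) / real n) \<omega>) \<partial>M) ^ m"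
  using n(2)
proof (induction m)
  case (Suc m)
  let ?P = "\<lambda>\<omega>. Z \<omega> * (\<Prod>i<m. e (L (grid a b n (Suc i)) \<omega> - L (grid a b n i) \<omega>))"
  have g: "a \<le> grid a b n i" for i using grid_mono[OF assms(2), of 0 i n] by (simp add: grid_0)
  have "?P \<in> borel_measurable (F (grid a b n m))"
  proof (intro borel_measurable_times_ennreal borel_measurable_prod_ennreal)
    show "Z \<in> borel_measurable (F (grid a b n m))"
      using measurable_F_mono[OF assms(1) g Z] .
    fix i assume "i \<in> {..<m}"
    hence [measurable]: "L (grid a b n (Suc i)) \<in> borel_measurable (F (grid a b n m))"
      "L (grid a b n i) \<in> borel_measurable (F (grid a b n m))"
      using assms(1) g[of i] g[of "Suc i"] by (auto intro!: L_measurable grid_mono assms(2))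
    show "(\<lambda>\<omega>. e (L (grid a b n (Suc i)) \<omega> - L (grid a b n i) \<omega>)) \<in> borel_measurable (F (grid a b n m))"
      by measurable
  qed
  from increment[OF _ _ this e, of "grid a b n (Suc m)"]
  have "(\<integral>\<^sup>+\<omega>. ?P \<omega> * e (L (grid a b n (Suc m)) \<omega> - L (grid a b n m) \<omega>) \<partial>M) =
      (\<integral>\<^sup>+\<omega>. ?P \<omega> \<partial>M) * (\<integral>\<^sup>+\<omega>. e (L ((b - a) / real n) \<omega>) \<partial>M)"
    using assms(1) g[of m] by (simp add: grid_mono[OF assms(2)] grid_Suc_diff)
  thus ?case using Suc by (simp add: mult_ac)
qed simp

abbreviation J :: "(real^'d \<Rightarrow> real) \<Rightarrow> real \<Rightarrow> real \<Rightarrow> 'a \<Rightarrow> ennreal" where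
  "J f a b \<omega> \<equiv> jsum (\<lambda>x. ennreal (f x)) (\<lambda>t. L t \<omega>) a b"

section \<open>Jump sums of continuous functions vanishing near 0\<close>

context
  fixes f :: "real^'d \<Rightarrow> real" and d :: real
  assumes cont: "continuous_on UNIV f" and nonneg: "\<And>x. 0 \<le> f x"
    and d: "0 < d" and vanish: "\<And>x. norm x < d \<Longrightarrow> f x = 0"
begin

lemma
  assumes "0 \<le> a" "a < b"
  shows J_finite': "J f a b \<omega> < \<infinity>"
    and J_LIMSEQ: "(\<lambda>n. \<Sum>i<n. f (L (grid a b n (Suc i)) \<omega> - L (grid a b n i) \<omega>)) \<longlonglongrightarrow> enn2real (J f a b \<omega>)"
proof -
  obtain R where R: "finite R" "R \<subseteq> {a<..b}" "\<And>u. u \<in> {a<..b} \<Longrightarrow> u \<notin> R \<Longrightarrow> f (jump (\<lambda>t. L t \<omega>) u) = 0"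
    and lim: "(\<lambda>n. \<Sum>i<n. f (L (grid a b n (Suc i)) \<omega> - L (grid a b n i) \<omega>)) \<longlonglongrightarrow> (\<Sum>u\<in>R. f (jump (\<lambda>t. L t \<omega>) u))"
    by (rule increment_sums_tendsto[OF cadlag_L[of \<omega>] assms cont d vanish]) (assumption, rule that)
  have eq: "J f a b \<omega> = ennreal (\<Sum>u\<in>R. f (jump (\<lambda>t. L t \<omega>) u))"
    using jsum_eq_sum[OF R(1,2), of "\<lambda>x. ennreal (f x)" "\<lambda>t. L t \<omega>"] R(3) nonneg by simp
  show "J f a b \<omega> < \<infinity>" by (simp add: eq)
  show "(\<lambda>n. \<Sum>i<n. f (L (grid a b n (Suc i)) \<omega> - L (grid a b n i) \<omega>)) \<longlonglongrightarrow> enn2real (J f a b \<omega>)"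
    using lim by (simp add: eq sum_nonneg nonneg)
qed

lemma J_measurable':
  assumes "0 \<le> a" "a < b" shows "J f a b \<in> borel_measurable M"
proof -
  have [measurable]: "f \<in> borel_measurable borel" using cont by (rule borel_measurable_continuous_onI)
  have "(\<lambda>\<omega>. enn2real (J f a b \<omega>)) \<in> borel_measurable M"
  proof (rule borel_measurable_LIMSEQ_real[OF J_LIMSEQ[OF assms]])
    fix n
    have [measurable]: "L (grid a b n i) \<in> borel_measurable M" for i
      using assms grid_mono[of a b 0 i n] by (intro L_measurable) (simp add: grid_0)
    show "(\<lambda>\<omega>. \<Sum>i<n. f (L (grid a b n (Suc i)) \<omega> - L (grid a b n i) \<omega>)) \<in> borel_measurable M"
      by measurable
  qed
  hence "(\<lambda>\<omega>. ennreal (enn2real (J f a b \<omega>))) \<in> borel_measurable M" by measurable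
  moreover have "(\<lambda>\<omega>. ennreal (enn2real (J f a b \<omega>))) = J f a b"
    using J_finite'[OF assms] by (intro ext) simp
  ultimately show ?thesis by (simp only:)
qed

text \<open>For the increment sums on a grid the factorization is exact, and the second factor
  depends only on the length \<open>b - a\<close>. Products of factors at most 1 are dominated by
  \<open>Z\<close>, so the identity survives refinement of the grid.\<close>

lemma nn_integral_exp_J:
  assumes "0 \<le> a" "a < b" and Z: "Z \<in> borel_measurable (F a)" "(\<integral>\<^sup>+\<omega>. Z \<omega> \<partial>M) < \<infinity>"
  shows "(\<integral>\<^sup>+\<omega>. Z \<omega> * ennreal (exp (- enn2real (J f a b \<omega>))) \<partial>M) =
    (\<integral>\<^sup>+\<omega>. Z \<omega> \<partial>M) * (\<integral>\<^sup>+\<omega>. ennreal (exp (- enn2real (J f 0 (b - a) \<omega>))) \<partial>M)"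
proof -
  define e where "e x = ennreal (exp (- f x))" for x
  define q where "q n = (\<integral>\<^sup>+\<omega>. e (L ((b - a) / real n) \<omega>) \<partial>M) ^ n" for n
  have f[measurable]: "f \<in> borel_measurable borel" using cont by (rule borel_measurable_continuous_onI)
  have e[measurable]: "e \<in> borel_measurable borel" unfolding e_def[abs_def] by measurable
  have e1: "e x \<le> 1" for x using nonneg by (simp add: e_def)
  \<comment> \<open>Stated for arbitrary interval and \<open>Z\<close>, because it is applied twice
    with the same sequence \<open>q\<close>: to the given data, and to \<open>Z = 1\<close> on
    \<open>(0, b - a]\<close>.\<close>
  have *: "(\<lambda>n. (\<integral>\<^sup>+\<omega>. Z \<omega> \<partial>M) * q n) \<longlonglongrightarrow> (\<integral>\<^sup>+\<omega>. Z \<omega> * ennreal (exp (- enn2real (J f a b \<omega>))) \<partial>M)"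
    if ab: "0 \<le> a" "a < b" and Z: "Z \<in> borel_measurable (F a)" "(\<integral>\<^sup>+\<omega>. Z \<omega> \<partial>M) < \<infinity>"
      and q: "\<And>n. q n = (\<integral>\<^sup>+\<omega>. e (L ((b - a) / real n) \<omega>) \<partial>M) ^ n" for a b Z q
  proof -
    let ?u = "\<lambda>n \<omega>. Z \<omega> * (\<Prod>i<n. e (L (grid a b n (Suc i)) \<omega> - L (grid a b n i) \<omega>))"
    have [measurable]: "Z \<in> borel_measurable M" using measurable_F_imp_M[OF ab(1) Z(1)] .
    have [measurable]: "L (grid a b n i) \<in> borel_measurable M" for n i
      using ab grid_mono[of a b 0 i n] by (intro L_measurable) (simp add: grid_0)
    have [measurable]: "J f a b \<in> borel_measurable M" by (rule J_measurable'[OF ab])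
    have "(\<lambda>n. \<integral>\<^sup>+\<omega>. ?u n \<omega> \<partial>M) \<longlonglongrightarrow> (\<integral>\<^sup>+\<omega>. Z \<omega> * ennreal (exp (- enn2real (J f a b \<omega>))) \<partial>M)"
    proof (rule nn_integral_dominated_convergence)
      show "?u n \<in> borel_measurable M" for n
        by (intro borel_measurable_times_ennreal borel_measurable_prod_ennreal) measurable
      show "AE \<omega> in M. ?u n \<omega> \<le> Z \<omega>" for n
      proof (intro AE_I2)
        fix \<omega>
        have "(\<Prod>i<n. e (L (grid a b n (Suc i)) \<omega> - L (grid a b n i) \<omega>)) \<le> 1"
          using e1 by (intro prod_le_1) auto
        from mult_left_mono[OF this, of "Z \<omega>"] show "?u n \<omega> \<le> Z \<omega>" by simp
      qed
      \<comment> \<open>Multiplication by infinity is not continuous on \<open>ennreal\<close>, so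
        pointwise convergence needs a finite value of \<open>Z\<close>.\<close>
      have "AE \<omega> in M. Z \<omega> \<noteq> \<infinity>" by (rule nn_integral_PInf_AE) (use Z(2) in auto)
      thus "AE \<omega> in M. (\<lambda>n. ?u n \<omega>) \<longlonglongrightarrow> Z \<omega> * ennreal (exp (- enn2real (J f a b \<omega>)))"
      proof (rule AE_mp, intro AE_I2 impI)
        fix \<omega> assume fin: "Z \<omega> \<noteq> \<infinity>"
        have "(\<Prod>i<n. e (L (grid a b n (Suc i)) \<omega> - L (grid a b n i) \<omega>)) =
          ennreal (exp (- (\<Sum>i<n. f (L (grid a b n (Suc i)) \<omega> - L (grid a b n i) \<omega>))))" for n
          by (simp add: e_def prod_ennreal exp_sum[symmetric] sum_negf)
        moreover have "(\<lambda>n. ennreal (exp (- (\<Sum>i<n. f (L (grid a b n (Suc i)) \<omega> - L (grid a b n i) \<omega>)))))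
          \<longlonglongrightarrow> ennreal (exp (- enn2real (J f a b \<omega>)))"
          by (intro tendsto_ennrealI tendsto_intros J_LIMSEQ ab)
        ultimately show "(\<lambda>n. ?u n \<omega>) \<longlonglongrightarrow> Z \<omega> * ennreal (exp (- enn2real (J f a b \<omega>)))"
          using fin by (intro ennreal_tendsto_cmult) (simp_all add: less_top)
      qed
    qed (use Z in simp_all)
    moreover have "\<forall>\<^sub>F n in sequentially. (\<integral>\<^sup>+\<omega>. ?u n \<omega> \<partial>M) = (\<integral>\<^sup>+\<omega>. Z \<omega> \<partial>M) * q n"
      using eventually_gt_at_top[of 0]
      by eventually_elim (use ab in \<open>simp add: nn_integral_increments[OF _ _ Z(1) e] q\<close>)
    ultimately show ?thesis by (rule Lim_transform_eventually)
  qed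
  \<comment> \<open>With \<open>Z = 1\<close> the limit of \<open>q\<close> is identified as the
    Laplace transform over an interval starting at 0.\<close>
  have 1: "(\<lambda>n. (\<integral>\<^sup>+\<omega>. 1 \<partial>M) * q n) \<longlonglongrightarrow> (\<integral>\<^sup>+\<omega>. 1 * ennreal (exp (- enn2real (J f 0 (b - a) \<omega>))) \<partial>M)"
    by (rule *) (use assms in \<open>simp_all add: q_def emeasure_space_1\<close>)
  hence "q \<longlonglongrightarrow> (\<integral>\<^sup>+\<omega>. ennreal (exp (- enn2real (J f 0 (b - a) \<omega>))) \<partial>M)"
    by (simp add: emeasure_space_1)
  hence "(\<lambda>n. (\<integral>\<^sup>+\<omega>. Z \<omega> \<partial>M) * q n) \<longlonglongrightarrow> (\<integral>\<^sup>+\<omega>. Z \<omega> \<partial>M) * (\<integral>\<^sup>+\<omega>. ennreal (exp (- enn2real (J f 0 (b - a) \<omega>))) \<partial>M)"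
    using Z(2) by (intro ennreal_tendsto_cmult) simp_all
  moreover have "(\<lambda>n. (\<integral>\<^sup>+\<omega>. Z \<omega> \<partial>M) * q n) \<longlonglongrightarrow> (\<integral>\<^sup>+\<omega>. Z \<omega> * ennreal (exp (- enn2real (J f a b \<omega>))) \<partial>M)"
    by (rule *[OF assms]) (simp add: q_def)
  ultimately show ?thesis using LIMSEQ_unique by blast
qed

end

end

text \<open>Difference quotients at 0 of the Laplace transform. Halving the parameter makes them
  increase, since \<open>1 - u * u = (1 - u) * (1 + u)\<close> is at most \<open>2 * (1 - u)\<close>
  when \<open>u \<le> 1\<close>; so monotone convergence applies and no moment has to be finite
  beforehand.\<close>

lemma exp_difference_quotient:
  fixes y :: real assumes "0 \<le> y"
  defines "h \<equiv> \<lambda>k. 2 ^ k * (1 - exp (- (y / 2 ^ k)))"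
  shows "incseq h" "h \<longlonglongrightarrow> y" "0 \<le> h k"
proof -
  show "incseq h"
  proof (rule incseq_SucI)
    fix k
    define u where "u = exp (- (y / 2 ^ Suc k))"
    have "exp (- (y / 2 ^ k)) = u * u" unfolding u_def exp_add[symmetric] by (simp add: field_simps)
    moreover have "u \<le> 1" using assms(1) by (simp add: u_def)
    hence "(1 - u) * (1 + u) \<le> (1 - u) * 2" by (intro mult_left_mono) auto
    ultimately have "2 ^ k * (1 - exp (- (y / 2 ^ k))) \<le> 2 ^ k * ((1 - u) * 2)"
      by (intro mult_left_mono) (simp_all add: algebra_simps)
    thus "h k \<le> h (Suc k)" unfolding h_def u_def by simp
  qed
  have "((\<lambda>x. (1 - exp (- x * y)) / x) \<longlongrightarrow> y) (at_right 0)"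
    by real_asymp
  moreover have "filterlim (\<lambda>k. inverse (2 ^ k) :: real) (at_right 0) sequentially"
    by real_asymp
  ultimately have "(\<lambda>k. (1 - exp (- inverse (2 ^ k) * y)) / inverse (2 ^ k)) \<longlonglongrightarrow> y"
    by (rule filterlim_compose)
  thus "h \<longlonglongrightarrow> y" by (simp add: h_def field_simps)
  show "0 \<le> h k" using assms(1) by (simp add: h_def)
qed

text \<open>Monotonicity replaces finiteness of \<open>c\<close>: for infinite \<open>c\<close>
  multiplication is discontinuous at 0, but it commutes with suprema.\<close>

lemma incseq_tendsto_cmult_ennreal:
  fixes f :: "nat \<Rightarrow> ennreal"
  assumes "incseq f" "f \<longlonglongrightarrow> l" shows "(\<lambda>k. c * f k) \<longlonglongrightarrow> c * l"
proof -
  have "l = (SUP k. f k)" using LIMSEQ_unique[OF assms(2) LIMSEQ_SUP[OF assms(1)]] .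
  hence "c * l = (SUP k. c * f k)" by (simp add: SUP_mult_left_ennreal)
  moreover have "incseq (\<lambda>k. c * f k)" using assms(1) by (auto simp: incseq_def intro!: mult_left_mono)
  ultimately show ?thesis using LIMSEQ_SUP by simp
qed

text \<open>Cauchy's functional equation: nonnegativity gives monotonicity, and \<open>n * t\<close>
  is enclosed between consecutive integers, which pins down \<open>g t\<close> up to
  \<open>g 1 / n\<close>.\<close>

lemma additive_nonneg_imp_linear:
  fixes g :: "real \<Rightarrow> real"
  assumes nonneg: "\<And>t. 0 \<le> t \<Longrightarrow> 0 \<le> g t"
    and add: "\<And>s t. 0 \<le> s \<Longrightarrow> 0 \<le> t \<Longrightarrow> g (s + t) = g s + g t" and t: "0 \<le> t"
  shows "g t = t * g 1"
proof -
  have mult: "g (real n * x) = real n * g x" if "0 \<le> x" for n x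
  proof (induction n)
    case 0 thus ?case using add[of 0 0] by simp
  next
    case (Suc n)
    have "g (real (Suc n) * x) = g (real n * x + x)" by (simp add: algebra_simps)
    also have "\<dots> = real (Suc n) * g x" using Suc that by (simp add: add algebra_simps)
    finally show ?case .
  qed
  have mono: "g s \<le> g u" if "0 \<le> s" "s \<le> u" for s u
    using add[of s "u - s"] nonneg[of "u - s"] that by simp
  have bound: "\<bar>g t - t * g 1\<bar> \<le> g 1 / real n" if n: "n > 0" for n
  proof -
    define k where "k = nat \<lfloor>real n * t\<rfloor>"
    have k: "real k \<le> real n * t" "real n * t \<le> real (Suc k)" using t by (simp_all add: k_def) linarith
    have "real k * g 1 \<le> g (real n * t)" using mult[of 1 k] mono[of "real k" "real n * t"] k by simp
    moreover have "g (real n * t) \<le> real (Suc k) * g 1"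
      using mult[of 1 "Suc k"] mono[of "real n * t" "real (Suc k)"] k t by simp
    moreover have "real k * g 1 \<le> real n * t * g 1" "real n * t * g 1 \<le> real (Suc k) * g 1"
      using k nonneg[of 1] by (auto intro!: mult_right_mono)
    ultimately have "\<bar>real n * g t - real n * t * g 1\<bar> \<le> g 1"
      using mult[OF t, of n] by (simp add: algebra_simps)
    hence "real n * \<bar>g t - t * g 1\<bar> \<le> g 1"
      by (subst abs_of_nonneg[of "real n", symmetric], simp, subst abs_mult[symmetric]) (simp add: algebra_simps)
    thus ?thesis using n by (simp add: field_simps)
  qed
  have "\<forall>\<^sub>F n in sequentially. \<bar>g t - t * g 1\<bar> \<le> g 1 / real n"
    by (rule eventually_mono[OF eventually_gt_at_top[of 0] bound])
  hence "\<bar>g t - t * g 1\<bar> \<le> 0"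
    by (rule tendsto_lowerbound[OF lim_const_over_n]) simp
  thus ?thesis by simp
qed

lemma jsum_refl [simp]: "jsum f l a a = 0"
  by (simp add: jsum_def)

text \<open>Subtracting a constant and taking the positive part keeps continuity, gives 0 wherever
  \<open>f\<close> is below that constant, hence near 0 if \<open>f\<close> is continuous with
  \<open>f 0 = 0\<close>, and increases to a nonnegative \<open>f\<close> as \<open>k\<close>
  grows.\<close>

definition trunc :: "('b \<Rightarrow> real) \<Rightarrow> nat \<Rightarrow> 'b \<Rightarrow> real" where
  "trunc f k x = max 0 (f x - 1 / real (Suc k))"

lemma trunc_continuous: "continuous_on UNIV f \<Longrightarrow> continuous_on UNIV (trunc f k)"
  unfolding trunc_def[abs_def] by (intro continuous_intros)

lemma trunc_nonneg: "0 \<le> trunc f k x"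
  and trunc_le: "0 \<le> f x \<Longrightarrow> trunc f k x \<le> f x"
  by (simp_all add: trunc_def)

lemma trunc_vanish:
  fixes f :: "'b::real_normed_vector \<Rightarrow> real"
  assumes "continuous_on UNIV f" "f 0 = 0"
  shows "\<exists>d>0. \<forall>x. norm x < d \<longrightarrow> trunc f k x = 0"
proof -
  have "(f \<longlongrightarrow> f 0) (at 0)" using assms(1) by (simp add: continuous_on_def)
  hence "\<forall>\<^sub>F x in at 0. f x < 1 / real (Suc k)" using assms(2) by (intro order_tendstoD) auto
  then obtain d where "d > 0" and d: "\<And>x. x \<noteq> 0 \<Longrightarrow> norm x < d \<Longrightarrow> f x < 1 / real (Suc k)"
    unfolding eventually_at by (auto simp: dist_norm)
  have "f x \<le> 1 / real (Suc k)" if "norm x < d" for x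
    using d[of x] that assms(2) by (cases "x = 0") auto
  thus ?thesis using \<open>d > 0\<close> by (auto simp: trunc_def)
qed

lemma trunc_LIMSEQ:
  assumes "0 \<le> f x"
  shows "(\<lambda>k. ennreal (trunc f k x)) \<longlonglongrightarrow> ennreal (f x)" "incseq (\<lambda>k. ennreal (trunc f k x))"
proof -
  have "(\<lambda>k. trunc f k x) \<longlonglongrightarrow> max 0 (f x - 0)"
    unfolding trunc_def by (intro tendsto_intros LIMSEQ_Suc[OF lim_const_over_n])
  thus "(\<lambda>k. ennreal (trunc f k x)) \<longlonglongrightarrow> ennreal (f x)" using assms by (intro tendsto_ennrealI) simp
  show "incseq (\<lambda>k. ennreal (trunc f k x))"
  proof (rule incseq_SucI)
    fix k
    have "1 / real (Suc (Suc k)) \<le> 1 / real (Suc k)" by (simp add: field_simps)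
    thus "ennreal (trunc f k x) \<le> ennreal (trunc f (Suc k) x)"
      unfolding trunc_def by (intro ennreal_leI) linarith
  qed
qed

text \<open>Carries a factorization from \<open>exp (- y)\<close> over to
  \<open>1 - exp (- y)\<close>. Finiteness of \<open>q\<close> is needed to cancel it in
  \<open>ennreal\<close>.\<close>

lemma ennreal_complement_product:
  fixes p q r s z :: ennreal
  assumes "q = z * s" "p + q = z" "r + s = 1" "q \<noteq> \<infinity>" shows "p = z * r"
proof -
  have "q + p = z * (r + s)" using assms(2,3) by (simp add: add.commute)
  also have "\<dots> = q + z * r" using assms(1) by (simp add: distrib_left add.commute)
  finally show ?thesis using assms(4) by (simp add: ennreal_add_left_cancel)
qed

context levy_jumps
begin

text \<open>Differentiates the factorized Laplace transform at 0: the transform of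
  \<open>f / 2 ^ k\<close> is complemented and multiplied by \<open>2 ^ k\<close>, and both sides
  increase to first moments.\<close>

lemma nn_integral_mult_J':
  assumes cont: "continuous_on UNIV f" and nonneg: "\<And>x. 0 \<le> f x"
    and d: "0 < d" "\<And>x. norm x < d \<Longrightarrow> f x = 0"
    and ab: "0 \<le> a" "a < b" and Z: "Z \<in> borel_measurable (F a)" "(\<integral>\<^sup>+\<omega>. Z \<omega> \<partial>M) < \<infinity>"
  shows "(\<integral>\<^sup>+\<omega>. Z \<omega> * J f a b \<omega> \<partial>M) = (\<integral>\<^sup>+\<omega>. Z \<omega> \<partial>M) * (\<integral>\<^sup>+\<omega>. J f 0 (b - a) \<omega> \<partial>M)"
proof -
  define X where "X \<omega> = enn2real (J f a b \<omega>)" for \<omega>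
  define X0 where "X0 \<omega> = enn2real (J f 0 (b - a) \<omega>)" for \<omega>
  define h :: "nat \<Rightarrow> real \<Rightarrow> real" where "h k y = 2 ^ k * (1 - exp (- (y / 2 ^ k)))" for k y
  have ba: "0 \<le> (0::real)" "0 < b - a" using ab by simp_all
  have [measurable]: "J f a b \<in> borel_measurable M" "J f 0 (b - a) \<in> borel_measurable M"
    using J_measurable'[OF cont nonneg d] ab ba by auto
  have [measurable]: "X \<in> borel_measurable M" "X0 \<in> borel_measurable M"
    unfolding X_def X0_def by measurable
  have ZM[measurable]: "Z \<in> borel_measurable M" using measurable_F_imp_M[OF ab(1) Z(1)] .
  have JX: "J f a b \<omega> = ennreal (X \<omega>)" "J f 0 (b - a) \<omega> = ennreal (X0 \<omega>)" for \<omega>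
    using J_finite'[OF cont nonneg d ab, of \<omega>] J_finite'[OF cont nonneg d ba, of \<omega>] by (simp_all add: X_def X0_def)
  have X: "0 \<le> X \<omega>" "0 \<le> X0 \<omega>" for \<omega> by (simp_all add: X_def X0_def)
  have eq: "(\<integral>\<^sup>+\<omega>. Z \<omega> * ennreal (h k (X \<omega>)) \<partial>M) = (\<integral>\<^sup>+\<omega>. Z \<omega> \<partial>M) * (\<integral>\<^sup>+\<omega>. ennreal (h k (X0 \<omega>)) \<partial>M)" for k
  proof -
    define e where "e y = exp (- (y / 2 ^ k))" for y :: real
    have [measurable]: "e \<in> borel_measurable borel" unfolding e_def[abs_def] by measurable
    have e: "0 \<le> e y" "0 \<le> y \<Longrightarrow> e y \<le> 1" for y by (simp_all add: e_def)
    \<comment> \<open>Scaling \<open>f\<close> by a constant scales the jump sum, so the Laplace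
      transform at parameter \<open>1 / 2 ^ k\<close> is the one already computed, taken for
      \<open>g\<close>.\<close>
    define g where "g x = f x / 2 ^ k" for x
    have Jg: "J g a' b' \<omega> = ennreal (1 / 2 ^ k) * J f a' b' \<omega>" for a' b' \<omega>
      unfolding jsum_cmult[symmetric] g_def using nonneg by (simp add: ennreal_mult[symmetric])
    have gg: "continuous_on UNIV g" "\<And>x. 0 \<le> g x" "\<And>x. norm x < d \<Longrightarrow> g x = 0"
      unfolding g_def[abs_def] using nonneg d by (auto intro!: continuous_intros cont)
    have "(\<integral>\<^sup>+\<omega>. Z \<omega> * ennreal (e (X \<omega>)) \<partial>M) = (\<integral>\<^sup>+\<omega>. Z \<omega> \<partial>M) * (\<integral>\<^sup>+\<omega>. ennreal (e (X0 \<omega>)) \<partial>M)"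
      using nn_integral_exp_J[OF gg(1,2) d(1) gg(3) ab Z] by (simp add: Jg enn2real_mult X_def X0_def e_def)
    moreover have "(\<integral>\<^sup>+\<omega>. Z \<omega> * ennreal (1 - e (X \<omega>)) \<partial>M) + (\<integral>\<^sup>+\<omega>. Z \<omega> * ennreal (e (X \<omega>)) \<partial>M) = (\<integral>\<^sup>+\<omega>. Z \<omega> \<partial>M)"
    proof (subst nn_integral_add[symmetric])
      have "ennreal (1 - e (X \<omega>)) + ennreal (e (X \<omega>)) = 1" for \<omega>
        using e X by (simp add: ennreal_plus[symmetric] del: ennreal_plus)
      thus "(\<integral>\<^sup>+\<omega>. Z \<omega> * ennreal (1 - e (X \<omega>)) + Z \<omega> * ennreal (e (X \<omega>)) \<partial>M) = (\<integral>\<^sup>+\<omega>. Z \<omega> \<partial>M)"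
        by (simp add: distrib_left[symmetric])
    qed measurable
    moreover have "(\<integral>\<^sup>+\<omega>. ennreal (1 - e (X0 \<omega>)) \<partial>M) + (\<integral>\<^sup>+\<omega>. ennreal (e (X0 \<omega>)) \<partial>M) = 1"
    proof (subst nn_integral_add[symmetric])
      have "ennreal (1 - e (X0 \<omega>)) + ennreal (e (X0 \<omega>)) = 1" for \<omega>
        using e X by (simp add: ennreal_plus[symmetric] del: ennreal_plus)
      thus "(\<integral>\<^sup>+\<omega>. ennreal (1 - e (X0 \<omega>)) + ennreal (e (X0 \<omega>)) \<partial>M) = 1"
        by (simp add: emeasure_space_1)
    qed measurable
    moreover have "(\<integral>\<^sup>+\<omega>. Z \<omega> * ennreal (e (X \<omega>)) \<partial>M) \<le> (\<integral>\<^sup>+\<omega>. Z \<omega> \<partial>M)"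
    proof (rule nn_integral_mono)
      fix \<omega>
      have "ennreal (e (X \<omega>)) \<le> 1" using e(2)[OF X(1)] by simp
      from mult_left_mono[OF this, of "Z \<omega>"] show "Z \<omega> * ennreal (e (X \<omega>)) \<le> Z \<omega>" by simp
    qed
    hence "(\<integral>\<^sup>+\<omega>. Z \<omega> * ennreal (e (X \<omega>)) \<partial>M) \<noteq> \<infinity>" using Z(2) by auto
    ultimately have 1: "(\<integral>\<^sup>+\<omega>. Z \<omega> * ennreal (1 - e (X \<omega>)) \<partial>M) = (\<integral>\<^sup>+\<omega>. Z \<omega> \<partial>M) * (\<integral>\<^sup>+\<omega>. ennreal (1 - e (X0 \<omega>)) \<partial>M)"
      by (rule ennreal_complement_product)
    have h: "ennreal (h k y) = ennreal (2 ^ k) * ennreal (1 - e y)" if "0 \<le> y" for y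
      using e(2)[OF that] by (simp add: h_def e_def ennreal_mult[symmetric])
    have "(\<integral>\<^sup>+\<omega>. Z \<omega> * ennreal (h k (X \<omega>)) \<partial>M) = (\<integral>\<^sup>+\<omega>. ennreal (2 ^ k) * (Z \<omega> * ennreal (1 - e (X \<omega>))) \<partial>M)"
      by (simp only: h X mult_ac)
    also have "\<dots> = ennreal (2 ^ k) * (\<integral>\<^sup>+\<omega>. Z \<omega> * ennreal (1 - e (X \<omega>)) \<partial>M)"
      by (rule nn_integral_cmult) measurable
    also have "\<dots> = (\<integral>\<^sup>+\<omega>. Z \<omega> \<partial>M) * (ennreal (2 ^ k) * (\<integral>\<^sup>+\<omega>. ennreal (1 - e (X0 \<omega>)) \<partial>M))"
      by (simp only: 1 mult_ac)
    also have "ennreal (2 ^ k) * (\<integral>\<^sup>+\<omega>. ennreal (1 - e (X0 \<omega>)) \<partial>M) = (\<integral>\<^sup>+\<omega>. ennreal (h k (X0 \<omega>)) \<partial>M)"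
      by (subst nn_integral_cmult[symmetric]) (measurable, simp only: h X)
    finally show ?thesis .
  qed
  have h_meas[measurable]: "h k \<in> borel_measurable borel" for k unfolding h_def[abs_def] by measurable
  have inc: "incseq (\<lambda>k. h k y)" and lim: "(\<lambda>k. h k y) \<longlonglongrightarrow> y" if "0 \<le> y" for y
    using exp_difference_quotient[OF that] by (simp_all add: h_def)
  have "(\<lambda>k. \<integral>\<^sup>+\<omega>. Z \<omega> * ennreal (h k (X \<omega>)) \<partial>M) \<longlonglongrightarrow> (\<integral>\<^sup>+\<omega>. Z \<omega> * ennreal (X \<omega>) \<partial>M)"
  proof (rule nn_integral_LIMSEQ)
    show "incseq (\<lambda>k \<omega>. Z \<omega> * ennreal (h k (X \<omega>)))"
      using inc[OF X(1)] by (auto simp: incseq_def le_fun_def intro!: mult_left_mono ennreal_leI)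
    show "(\<lambda>k. Z \<omega> * ennreal (h k (X \<omega>))) \<longlonglongrightarrow> Z \<omega> * ennreal (X \<omega>)" for \<omega>
    proof (rule incseq_tendsto_cmult_ennreal)
      show "incseq (\<lambda>k. ennreal (h k (X \<omega>)))" using inc[OF X(1)] by (auto simp: incseq_def intro!: ennreal_leI)
      show "(\<lambda>k. ennreal (h k (X \<omega>))) \<longlonglongrightarrow> ennreal (X \<omega>)" by (intro tendsto_ennrealI lim X)
    qed
  qed measurable
  moreover have "(\<lambda>k. \<integral>\<^sup>+\<omega>. ennreal (h k (X0 \<omega>)) \<partial>M) \<longlonglongrightarrow> (\<integral>\<^sup>+\<omega>. ennreal (X0 \<omega>) \<partial>M)"
  proof (rule nn_integral_LIMSEQ)
    show "incseq (\<lambda>k \<omega>. ennreal (h k (X0 \<omega>)))"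
      using inc[OF X(2)] by (auto simp: incseq_def le_fun_def intro!: ennreal_leI)
    show "(\<lambda>k. ennreal (h k (X0 \<omega>))) \<longlonglongrightarrow> ennreal (X0 \<omega>)" for \<omega>
      by (intro tendsto_ennrealI lim X)
  qed measurable
  hence "(\<lambda>k. (\<integral>\<^sup>+\<omega>. Z \<omega> \<partial>M) * (\<integral>\<^sup>+\<omega>. ennreal (h k (X0 \<omega>)) \<partial>M)) \<longlonglongrightarrow> (\<integral>\<^sup>+\<omega>. Z \<omega> \<partial>M) * (\<integral>\<^sup>+\<omega>. ennreal (X0 \<omega>) \<partial>M)"
    using Z(2) by (intro ennreal_tendsto_cmult) simp_all
  ultimately show ?thesis unfolding eq JX using LIMSEQ_unique by blast
qed

end

text \<open>Lower approximation of a nonnegative function by a countable combination of indicators of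
  superlevel sets, so that only the jump counts entering the definition of the Levy measure occur.\<close>

definition layers :: "('b \<Rightarrow> real) \<Rightarrow> real \<Rightarrow> 'b \<Rightarrow> ennreal" where
  "layers f c x = (\<Sum>k. ennreal c * indicator {x. real (Suc k) * c < f x} x)"

text \<open>At \<open>x\<close> the sum is \<open>c\<close> times the number of positive multiples
  of \<open>c\<close> strictly below \<open>f x\<close>, hence at most \<open>f x\<close> and off by
  no more than \<open>c\<close>.\<close>

lemma layers_bounds:
  assumes "0 < c" "0 \<le> f x"
  shows "ennreal (max 0 (f x - c)) \<le> layers f c x" "layers f c x \<le> ennreal (f x)"
proof -
  \<comment> \<open>Counts the positive integers strictly below \<open>f x / c\<close>; strictness
    leads to a ceiling minus one.\<close>
  define n where "n = nat (\<lceil>f x / c\<rceil> - 1)"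
  have lt: "real (Suc k) * c < f x \<longleftrightarrow> k < n" for k
  proof -
    have "real (Suc k) * c < f x \<longleftrightarrow> real_of_int (int (Suc k)) < f x / c" using assms(1) by (simp add: field_simps)
    also have "\<dots> \<longleftrightarrow> int (Suc k) < \<lceil>f x / c\<rceil>" by (simp only: less_ceiling_iff)
    also have "\<dots> \<longleftrightarrow> k < n" unfolding n_def by linarith
    finally show ?thesis .
  qed
  have "layers f c x = (\<Sum>k<n. ennreal c * indicator {x. real (Suc k) * c < f x} x)"
    unfolding layers_def by (rule suminf_finite) (simp_all del: of_nat_Suc add: lt)
  also have "\<dots> = (\<Sum>k<n. ennreal c)" by (intro sum.cong) (simp_all del: of_nat_Suc add: lt)
  also have "\<dots> = ennreal (real n * c)" using assms(1) by (simp add: ennreal_mult ennreal_of_nat_eq_real_of_nat)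
  finally have eq: "layers f c x = ennreal (real n * c)" .
  have "f x \<le> real (Suc n) * c" using lt[of n] by simp
  thus "ennreal (max 0 (f x - c)) \<le> layers f c x"
    unfolding eq using assms by (intro ennreal_leI) (simp add: algebra_simps)
  have "real n * c \<le> f x"
  proof (cases n)
    case (Suc m)
    thus ?thesis using lt[of m] by (simp del: of_nat_Suc)
  qed (use assms in simp)
  thus "layers f c x \<le> ennreal (f x)" unfolding eq by (rule ennreal_leI)
qed

section \<open>Jump sums and the Levy measure\<close>

context levy_jumps
begin

context
  fixes f :: "real^'d \<Rightarrow> real"
  assumes cont: "continuous_on UNIV f" and nonneg: "\<And>x. 0 \<le> f x" and f0: "f 0 = 0"
begin

lemma J_trunc_LIMSEQ:
  "(\<lambda>k. J (trunc f k) a b \<omega>) \<longlonglongrightarrow> J f a b \<omega>" "incseq (\<lambda>k. J (trunc f k) a b \<omega>)"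
  by (intro jsum_LIMSEQ[where f = "\<lambda>k x. ennreal (trunc f k x)" and g = "\<lambda>x. ennreal (f x)"] trunc_LIMSEQ nonneg)+

lemma J_trunc_measurable:
  assumes "0 \<le> a" "a \<le> b" shows "J (trunc f k) a b \<in> borel_measurable M"
proof (cases "a = b")
  case False
  obtain d where "0 < d" "\<And>x. norm x < d \<Longrightarrow> trunc f k x = 0" using trunc_vanish[OF cont f0] by blast
  from J_measurable'[OF trunc_continuous[OF cont] trunc_nonneg this assms(1)] show ?thesis using False assms by simp
qed simp

lemma J_measurable:
  assumes "0 \<le> a" "a \<le> b" shows "J f a b \<in> borel_measurable M"
  by (rule borel_measurable_LIMSEQ_order[OF J_trunc_LIMSEQ(1) J_trunc_measurable[OF assms]])

lemma nn_integral_mult_J: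
  assumes "0 \<le> a" "a \<le> b" and Z: "Z \<in> borel_measurable (F a)" "(\<integral>\<^sup>+\<omega>. Z \<omega> \<partial>M) < \<infinity>"
  shows "(\<integral>\<^sup>+\<omega>. Z \<omega> * J f a b \<omega> \<partial>M) = (\<integral>\<^sup>+\<omega>. Z \<omega> \<partial>M) * (\<integral>\<^sup>+\<omega>. J f 0 (b - a) \<omega> \<partial>M)"
proof (cases "a = b")
  case False
  hence ab: "a < b" using assms by simp
  have eq: "(\<integral>\<^sup>+\<omega>. Z \<omega> * J (trunc f k) a b \<omega> \<partial>M) = (\<integral>\<^sup>+\<omega>. Z \<omega> \<partial>M) * (\<integral>\<^sup>+\<omega>. J (trunc f k) 0 (b - a) \<omega> \<partial>M)" for k
  proof -
    obtain d where d: "0 < d" "\<And>x. norm x < d \<Longrightarrow> trunc f k x = 0" using trunc_vanish[OF cont f0] by blast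
    show ?thesis by (rule nn_integral_mult_J'[OF trunc_continuous[OF cont] trunc_nonneg d assms(1) ab Z])
  qed
  have [measurable]: "Z \<in> borel_measurable M" using measurable_F_imp_M[OF assms(1) Z(1)] .
  have [measurable]: "J (trunc f k) a b \<in> borel_measurable M" "J (trunc f k) 0 (b - a) \<in> borel_measurable M" for k
    using J_trunc_measurable assms by auto
  have "(\<lambda>k. \<integral>\<^sup>+\<omega>. Z \<omega> * J (trunc f k) a b \<omega> \<partial>M) \<longlonglongrightarrow> (\<integral>\<^sup>+\<omega>. Z \<omega> * J f a b \<omega> \<partial>M)"
  proof (rule nn_integral_LIMSEQ)
    show "incseq (\<lambda>k \<omega>. Z \<omega> * J (trunc f k) a b \<omega>)"
      using J_trunc_LIMSEQ(2) by (auto simp: incseq_def le_fun_def intro!: mult_left_mono)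
    show "(\<lambda>k. Z \<omega> * J (trunc f k) a b \<omega>) \<longlonglongrightarrow> Z \<omega> * J f a b \<omega>" for \<omega>
      by (intro incseq_tendsto_cmult_ennreal J_trunc_LIMSEQ)
  qed measurable
  moreover have "(\<lambda>k. \<integral>\<^sup>+\<omega>. J (trunc f k) 0 (b - a) \<omega> \<partial>M) \<longlonglongrightarrow> (\<integral>\<^sup>+\<omega>. J f 0 (b - a) \<omega> \<partial>M)"
  proof (rule nn_integral_LIMSEQ)
    show "incseq (\<lambda>k \<omega>. J (trunc f k) 0 (b - a) \<omega>)"
      using J_trunc_LIMSEQ(2) by (auto simp: incseq_def le_fun_def)
    show "(\<lambda>k. J (trunc f k) 0 (b - a) \<omega>) \<longlonglongrightarrow> J f 0 (b - a) \<omega>" for \<omega>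
      by (rule J_trunc_LIMSEQ)
  qed measurable
  hence "(\<lambda>k. (\<integral>\<^sup>+\<omega>. Z \<omega> \<partial>M) * (\<integral>\<^sup>+\<omega>. J (trunc f k) 0 (b - a) \<omega> \<partial>M)) \<longlonglongrightarrow> (\<integral>\<^sup>+\<omega>. Z \<omega> \<partial>M) * (\<integral>\<^sup>+\<omega>. J f 0 (b - a) \<omega> \<partial>M)"
    using Z(2) by (intro ennreal_tendsto_cmult) simp_all
  ultimately show ?thesis unfolding eq using LIMSEQ_unique by blast
qed simp

end

context
  fixes f :: "real^'d \<Rightarrow> real"
  assumes cont: "continuous_on UNIV f" and nonneg: "\<And>x. 0 \<le> f x" and f0: "f 0 = 0"
begin

text \<open>The mean is the definition of \<nu>: a superlevel set for \<open>r > 0\<close> does not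
  contain 0, so excluding zero jumps there changes nothing. Measurability of the count holds because
  the indicator of the open set is an increasing limit of continuous functions vanishing at
  0.\<close>

lemma superlevel_jump_count:
  assumes r: "0 < r"
  shows "(\<lambda>\<omega>. jsum (indicator {x. r < f x}) (\<lambda>t. L t \<omega>) 0 1) \<in> borel_measurable M"
    and "(\<integral>\<^sup>+\<omega>. jsum (indicator {x. r < f x}) (\<lambda>t. L t \<omega>) 0 1 \<partial>M) = emeasure \<nu> {x. r < f x}"
proof -
  \<comment> \<open>A continuous ramp of slope \<open>j\<close> in \<open>f x - r\<close>, capped at
    1; it increases to the indicator of \<open>r < f x\<close>.\<close>
  define h where "h j x = min 1 (real j * max 0 (f x - r))" for j x
  have h: "continuous_on UNIV (h j)" "0 \<le> h j x" "h j 0 = 0" for j x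
    unfolding h_def[abs_def] using f0 r by (auto intro!: continuous_intros cont)
  have inc: "incseq (\<lambda>j. ennreal (h j x))" for x
    unfolding incseq_def h_def by (intro allI impI ennreal_leI min.mono mult_right_mono) auto
  have lim: "(\<lambda>j. ennreal (h j x)) \<longlonglongrightarrow> indicator {x. r < f x} x" for x
  proof (cases "r < f x")
    case True
    have "\<forall>\<^sub>F j in sequentially. ennreal (h j x) = 1"
      using eventually_ge_at_top[of "nat \<lceil>1 / (f x - r)\<rceil>"]
    proof eventually_elim
      case (elim j)
      hence "1 / (f x - r) \<le> real j" by linarith
      hence "1 \<le> real j * (f x - r)" using True by (simp add: field_simps)
      thus ?case using True by (simp add: h_def)
    qed
    hence "(\<lambda>j. ennreal (h j x)) \<longlonglongrightarrow> 1" by (rule tendsto_eventually)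
    thus ?thesis using True by simp
  qed (simp add: h_def)
  show "(\<lambda>\<omega>. jsum (indicator {x. r < f x}) (\<lambda>t. L t \<omega>) 0 1) \<in> borel_measurable M"
  proof (rule borel_measurable_LIMSEQ_order)
    show "(\<lambda>j. J (h j) 0 1 \<omega>) \<longlonglongrightarrow> jsum (indicator {x. r < f x}) (\<lambda>t. L t \<omega>) 0 1" for \<omega>
      by (rule jsum_LIMSEQ(1)[OF inc lim])
    show "J (h j) 0 1 \<in> borel_measurable M" for j
      by (rule J_measurable[OF h]) auto
  qed
  have "open {x. r < f x}" using cont by (intro open_Collect_less continuous_intros) auto
  hence "{x. r < f x} \<in> sets borel" by simp
  hence "emeasure \<nu> {x. r < f x} =
      (\<integral>\<^sup>+\<omega>. emeasure (count_space UNIV) {s\<in>{0<..1}. jump (\<lambda>t. L t \<omega>) s \<in> {x. r < f x} - {0}} \<partial>M)"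
    using levy_measure[unfolded has_levy_measure_def, THEN conjunct2] by (rule bspec[rotated])
  also have "\<dots> = (\<integral>\<^sup>+\<omega>. jsum (indicator {x. r < f x}) (\<lambda>t. L t \<omega>) 0 1 \<partial>M)"
  proof (intro nn_integral_cong)
    fix \<omega>
    have "jsum (indicator {x. r < f x}) (\<lambda>t. L t \<omega>) 0 1 =
        (\<integral>\<^sup>+u. indicator {s\<in>{0<..1}. jump (\<lambda>t. L t \<omega>) s \<in> {x. r < f x} - {0}} u \<partial>count_space UNIV)"
      unfolding jsum_def using f0 r by (intro nn_integral_cong) (auto split: split_indicator)
    thus "emeasure (count_space UNIV) {s\<in>{0<..1}. jump (\<lambda>t. L t \<omega>) s \<in> {x. r < f x} - {0}} =
        jsum (indicator {x. r < f x}) (\<lambda>t. L t \<omega>) 0 1"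
      by (subst nn_integral_indicator[symmetric]) auto
  qed
  finally show "(\<integral>\<^sup>+\<omega>. jsum (indicator {x. r < f x}) (\<lambda>t. L t \<omega>) 0 1 \<partial>M) = emeasure \<nu> {x. r < f x}" ..
qed

lemma nn_integral_jsum_layers:
  assumes c: "0 < c"
  shows "(\<integral>\<^sup>+\<omega>. jsum (layers f c) (\<lambda>t. L t \<omega>) 0 1 \<partial>M) = (\<integral>\<^sup>+x. layers f c x \<partial>\<nu>)"
proof -
  define S where "S k = {x. real (Suc k) * c < f x}" for k
  have pos: "0 < real (Suc k) * c" for k using c by simp
  have sets: "sets \<nu> = sets borel" using levy_measure by (simp add: has_levy_measure_def)
  have S: "S k \<in> sets \<nu>" for k
    unfolding S_def sets using cont by (intro borel_open open_Collect_less continuous_intros) auto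
  have meas: "(\<lambda>\<omega>. jsum (indicator (S k)) (\<lambda>t. L t \<omega>) 0 1) \<in> borel_measurable M"
    and int: "(\<integral>\<^sup>+\<omega>. jsum (indicator (S k)) (\<lambda>t. L t \<omega>) 0 1 \<partial>M) = emeasure \<nu> (S k)" for k
    unfolding S_def by (rule superlevel_jump_count[OF pos])+
  have l: "layers f c x = (\<Sum>k. ennreal c * indicator (S k) x)" for x
    by (simp add: layers_def S_def del: of_nat_Suc)
  have j: "jsum (layers f c) l 0 1 = (\<Sum>k. ennreal c * jsum (indicator (S k)) l 0 1)" for l :: "real \<Rightarrow> real^'d"
    unfolding jsum_cmult[symmetric] unfolding jsum_def l
    by (subst nn_integral_suminf[symmetric]) simp_all
  have "(\<integral>\<^sup>+\<omega>. jsum (layers f c) (\<lambda>t. L t \<omega>) 0 1 \<partial>M) = (\<Sum>k. ennreal c * emeasure \<nu> (S k))"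
    unfolding j using meas by (subst nn_integral_suminf) (simp_all add: nn_integral_cmult int)
  also have "\<dots> = (\<integral>\<^sup>+x. layers f c x \<partial>\<nu>)"
    unfolding l using S by (subst nn_integral_suminf) (simp_all add: nn_integral_cmult_indicator)
  finally show ?thesis .
qed

text \<open>For layers the identity is exact by \<open>nn_integral_jsum_layers\<close>. Since they
  lie between \<open>trunc f k\<close> and \<open>f\<close>, each side for \<open>trunc f k\<close>
  is at most the other side for \<open>f\<close>; monotone convergence in \<open>k\<close> gives
  both inequalities.\<close>

lemma nn_integral_J_unit: "(\<integral>\<^sup>+\<omega>. J f 0 1 \<omega> \<partial>M) = (\<integral>\<^sup>+x. ennreal (f x) \<partial>\<nu>)"
proof (rule antisym)
  have trunc: "ennreal (trunc f k x) \<le> layers f (1 / real (Suc k)) x" "layers f (1 / real (Suc k)) x \<le> ennreal (f x)" for k x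
    using layers_bounds[of "1 / real (Suc k)" f x] nonneg by (simp_all add: trunc_def)
  have 1: "(\<integral>\<^sup>+\<omega>. J (trunc f k) 0 1 \<omega> \<partial>M) \<le> (\<integral>\<^sup>+x. ennreal (f x) \<partial>\<nu>)" for k
  proof -
    have "(\<integral>\<^sup>+\<omega>. J (trunc f k) 0 1 \<omega> \<partial>M) \<le> (\<integral>\<^sup>+\<omega>. jsum (layers f (1 / real (Suc k))) (\<lambda>t. L t \<omega>) 0 1 \<partial>M)"
      by (intro nn_integral_mono jsum_mono trunc)
    also have "\<dots> = (\<integral>\<^sup>+x. layers f (1 / real (Suc k)) x \<partial>\<nu>)" by (rule nn_integral_jsum_layers) simp
    also have "\<dots> \<le> (\<integral>\<^sup>+x. ennreal (f x) \<partial>\<nu>)" by (intro nn_integral_mono trunc)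
    finally show ?thesis .
  qed
  have "(\<lambda>k. \<integral>\<^sup>+\<omega>. J (trunc f k) 0 1 \<omega> \<partial>M) \<longlonglongrightarrow> (\<integral>\<^sup>+\<omega>. J f 0 1 \<omega> \<partial>M)"
    by (intro nn_integral_LIMSEQ J_trunc_measurable[OF cont nonneg f0] J_trunc_LIMSEQ[OF cont nonneg f0])
      (use J_trunc_LIMSEQ(2)[OF cont nonneg f0] in \<open>auto simp: incseq_def le_fun_def\<close>)
  thus "(\<integral>\<^sup>+\<omega>. J f 0 1 \<omega> \<partial>M) \<le> (\<integral>\<^sup>+x. ennreal (f x) \<partial>\<nu>)"
    using 1 by (intro LIMSEQ_le_const2) auto
  have 2: "(\<integral>\<^sup>+x. ennreal (trunc f k x) \<partial>\<nu>) \<le> (\<integral>\<^sup>+\<omega>. J f 0 1 \<omega> \<partial>M)" for k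
  proof -
    have "(\<integral>\<^sup>+x. ennreal (trunc f k x) \<partial>\<nu>) \<le> (\<integral>\<^sup>+x. layers f (1 / real (Suc k)) x \<partial>\<nu>)"
      by (intro nn_integral_mono trunc)
    also have "\<dots> = (\<integral>\<^sup>+\<omega>. jsum (layers f (1 / real (Suc k))) (\<lambda>t. L t \<omega>) 0 1 \<partial>M)"
      by (rule nn_integral_jsum_layers[symmetric]) simp
    also have "\<dots> \<le> (\<integral>\<^sup>+\<omega>. J f 0 1 \<omega> \<partial>M)" by (intro nn_integral_mono jsum_mono trunc)
    finally show ?thesis .
  qed
  have "trunc f k \<in> borel_measurable borel" for k
    using trunc_continuous[OF cont] by (rule borel_measurable_continuous_onI)
  hence [measurable]: "trunc f k \<in> borel_measurable \<nu>" for k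
    using levy_measure by (simp add: has_levy_measure_def cong: measurable_cong_sets)
  have "(\<lambda>k. \<integral>\<^sup>+x. ennreal (trunc f k x) \<partial>\<nu>) \<longlonglongrightarrow> (\<integral>\<^sup>+x. ennreal (f x) \<partial>\<nu>)"
    by (intro nn_integral_LIMSEQ trunc_LIMSEQ nonneg)
      (use trunc_LIMSEQ(2)[of f] nonneg in \<open>auto simp: incseq_def le_fun_def\<close>)
  thus "(\<integral>\<^sup>+x. ennreal (f x) \<partial>\<nu>) \<le> (\<integral>\<^sup>+\<omega>. J f 0 1 \<omega> \<partial>M)"
    using 2 by (intro LIMSEQ_le_const2) auto
qed

text \<open>The mean over \<open>(0, t]\<close> is additive in \<open>t\<close>, as the mean over an
  interval depends on its length only; with finiteness, nonnegativity makes it linear.\<close>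

lemma nn_integral_J:
  assumes fin: "(\<integral>\<^sup>+x. ennreal (f x) \<partial>\<nu>) < \<infinity>" and t: "0 \<le> t"
  shows "(\<integral>\<^sup>+\<omega>. J f 0 t \<omega> \<partial>M) = ennreal t * (\<integral>\<^sup>+x. ennreal (f x) \<partial>\<nu>)"
proof -
  define \<phi> where "\<phi> t = (\<integral>\<^sup>+\<omega>. J f 0 t \<omega> \<partial>M)" for t
  have add: "\<phi> (s + t) = \<phi> s + \<phi> t" if "0 \<le> s" "0 \<le> t" for s t
  proof -
    have "\<phi> (s + t) = (\<integral>\<^sup>+\<omega>. J f 0 s \<omega> + J f s (s + t) \<omega> \<partial>M)"
      unfolding \<phi>_def using that by (intro nn_integral_cong jsum_add) auto
    also have "\<dots> = \<phi> s + (\<integral>\<^sup>+\<omega>. 1 * J f s (s + t) \<omega> \<partial>M)"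
      unfolding \<phi>_def using that by (subst nn_integral_add) (auto intro!: J_measurable cont nonneg f0)
    also have "(\<integral>\<^sup>+\<omega>. 1 * J f s (s + t) \<omega> \<partial>M) = \<phi> t"
      using that by (subst nn_integral_mult_J[OF cont nonneg f0]) (auto simp: \<phi>_def emeasure_space_1)
    finally show ?thesis .
  qed
  have mono: "\<phi> s \<le> \<phi> u" if "0 \<le> s" "s \<le> u" for s u
    using add[of s "u - s"] that by simp
  have 1: "\<phi> 1 = (\<integral>\<^sup>+x. ennreal (f x) \<partial>\<nu>)" unfolding \<phi>_def by (rule nn_integral_J_unit)
  \<comment> \<open>Finite at integers by additivity from the unit interval, hence finite everywhere
    by monotonicity; this permits the passage to real values.\<close>
  have "\<phi> (real n) < \<infinity>" for n
  proof (induction n)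
    case 0
    thus ?case by (simp add: \<phi>_def)
  next
    case (Suc n)
    thus ?case using add[of "real n" 1] 1 fin by (simp add: add.commute)
  qed
  hence finite: "\<phi> s < \<infinity>" if "0 \<le> s" for s
    using mono[of s "real (nat \<lceil>s\<rceil>)"] that by (meson le_less_trans real_nat_ceiling_ge)
  have "enn2real (\<phi> t) = t * enn2real (\<phi> 1)"
  proof (rule additive_nonneg_imp_linear[of "\<lambda>t. enn2real (\<phi> t)", OF _ _ t])
    show "enn2real (\<phi> (s + t)) = enn2real (\<phi> s) + enn2real (\<phi> t)" if "0 \<le> s" "0 \<le> t" for s t
      using add[OF that] finite that by (simp add: enn2real_plus)
  qed simp
  hence "ennreal (enn2real (\<phi> t)) = ennreal t * ennreal (enn2real (\<phi> 1))"
    using t by (simp add: ennreal_mult)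
  thus ?thesis using finite[OF t] finite[of 1] unfolding 1[symmetric] by (simp add: \<phi>_def)
qed

lemma nn_integral_mult_jump_sum:
  assumes "(\<integral>\<^sup>+x. ennreal (f x) \<partial>\<nu>) < \<infinity>" and "0 \<le> a" "a \<le> b"
    and "Z \<in> borel_measurable (F a)" "(\<integral>\<^sup>+\<omega>. Z \<omega> \<partial>M) < \<infinity>"
  shows "(\<integral>\<^sup>+\<omega>. Z \<omega> * J f a b \<omega> \<partial>M) = (\<integral>\<^sup>+\<omega>. Z \<omega> \<partial>M) * ennreal (b - a) * (\<integral>\<^sup>+x. ennreal (f x) \<partial>\<nu>)"
  using nn_integral_mult_J[OF cont nonneg f0 assms(2-5)] nn_integral_J[OF assms(1), of "b - a"] assms(3)
  by (simp add: mult.assoc)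

end

end

section \<open>The compensation formula\<close>

text \<open>Counterpart of \<open>riemann_sums_tendsto\<close> in \<open>ennreal\<close>. Finite
  values of \<open>w\<close> keep multiplication by \<open>w s\<close> continuous; the finite bound
  \<open>K\<close> keeps the majorant integrable.\<close>

lemma nn_riemann_sums_tendsto:
  fixes H Hm w :: "real \<Rightarrow> ennreal"
  assumes ab: "a < b" and w[measurable]: "w \<in> borel_measurable \<mu>" and w_fin: "\<And>s. w s < \<infinity>"
    and sets[measurable]: "\<And>c d. {c<..d} \<in> sets \<mu>"
    and int: "(\<integral>\<^sup>+s. indicator {a<..b} s * w s \<partial>\<mu>) < \<infinity>" and K: "K < \<infinity>"
    and bd: "\<And>s. a \<le> s \<Longrightarrow> s < b \<Longrightarrow> H s \<le> K"
    and lim: "\<And>s. a < s \<Longrightarrow> s \<le> b \<Longrightarrow> (H \<longlongrightarrow> Hm s) (at_left s)"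
  shows
    "(\<lambda>n. \<Sum>i<n. H (grid a b n i) * (\<integral>\<^sup>+s. indicator {grid a b n i<..grid a b n (Suc i)} s * w s \<partial>\<mu>))
        \<longlonglongrightarrow> (\<integral>\<^sup>+s. indicator {a<..b} s * (Hm s * w s) \<partial>\<mu>)"
proof -
  define I where "I n i = {grid a b n i<..grid a b n (Suc i)}" for n i
  have Isub: "I n i \<subseteq> {a<..b}" if "i < n" for n i
    using grid_bounds(1)[of a b n i] grid_bounds(2)[of a b n "Suc i"] ab that by (auto simp: I_def)
  have [measurable]: "I n i \<in> sets \<mu>" for n i by (simp add: I_def)
  define h where "h n s = (\<Sum>i<n. if s \<in> I n i then H (grid a b n i) * w s else 0)" for n s
  have h_cell: "h n s = H (grid a b n (cell a b n s)) * w s" if "a < s" "s \<le> b" "n > 0" for n s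
    unfolding h_def I_def by (rule sum_cells[OF that])
  have h_0: "h n s = 0" if "s \<notin> {a<..b}" for n s
    unfolding h_def using Isub that by (intro sum.neutral ballI) (metis lessThan_iff subsetD)
  have h_ind: "h n s = (\<Sum>i<n. H (grid a b n i) * (indicator (I n i) s * w s))" for n s
    unfolding h_def by (intro sum.cong) (simp_all add: indicator_def)
  have h_meas: "h n \<in> borel_measurable \<mu>" for n
    unfolding h_ind[abs_def] by measurable
  have h_integral: "integral\<^sup>N \<mu> (h n) = (\<Sum>i<n. H (grid a b n i) * (\<integral>\<^sup>+s. indicator (I n i) s * w s \<partial>\<mu>))" for n
    unfolding h_ind[abs_def] by (subst nn_integral_sum) (auto simp: nn_integral_cmult)
  define f where "f s = indicator {a<..b} s * (Hm s * w s)" for s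
  have h_lim: "(\<lambda>n. h n s) \<longlonglongrightarrow> f s" for s
  proof (cases "s \<in> {a<..b}")
    case True
    hence "(\<lambda>n. w s * H (grid a b n (cell a b n s))) \<longlonglongrightarrow> w s * Hm s"
      using w_fin[of s] by (intro ennreal_tendsto_cmult grid_tendsto_left_lim lim) auto
    moreover have "\<forall>\<^sub>F n in sequentially. w s * H (grid a b n (cell a b n s)) = h n s"
      using eventually_gt_at_top[of 0] by eventually_elim (use h_cell True in \<open>simp add: mult.commute\<close>)
    ultimately have "(\<lambda>n. h n s) \<longlonglongrightarrow> w s * Hm s" by (rule Lim_transform_eventually)
    thus ?thesis using True by (simp add: f_def mult.commute)
  qed (simp add: h_0 f_def)
  have h_bd: "h n s \<le> K * (indicator {a<..b} s * w s)" for n s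
  proof (cases "s \<in> {a<..b} \<and> n > 0")
    case True
    hence s: "a < s" "s \<le> b" "n > 0" by auto
    have "H (grid a b n (cell a b n s)) \<le> K"
      using cell_bounds[OF s] grid_bounds(1)[of a b n "cell a b n s"] ab s by (intro bd) auto
    thus ?thesis using h_cell[OF s] True by (simp add: mult_right_mono)
  next
    case False
    hence "h n s = 0" using h_0 by (cases "n = 0") (auto simp: h_def)
    thus ?thesis by simp
  qed
  have "(\<lambda>n. integral\<^sup>N \<mu> (h n)) \<longlonglongrightarrow> integral\<^sup>N \<mu> f"
  proof (rule nn_integral_dominated_convergence[OF h_meas])
    show "f \<in> borel_measurable \<mu>" by (rule borel_measurable_LIMSEQ_order[OF h_lim h_meas])
    show "(\<integral>\<^sup>+s. K * (indicator {a<..b} s * w s) \<partial>\<mu>) < \<infinity>"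
      using int K by (simp add: nn_integral_cmult ennreal_mult_less_top)
  qed (use h_bd h_lim in auto)
  thus ?thesis by (simp add: h_integral I_def f_def[abs_def])
qed

text \<open>Measurability at each fixed time suffices: left-endpoint step functions are jointly
  measurable and converge pointwise to the left limits. This is what Fubini arguments rest
  on.\<close>

lemma left_limits_jointly_measurable:
  fixes U Um :: "real \<Rightarrow> 'a \<Rightarrow> 'b::euclidean_space"
  assumes t: "0 < t" and U: "\<And>s. 0 \<le> s \<Longrightarrow> U s \<in> borel_measurable M"
    and lim: "\<And>s \<omega>. 0 < s \<Longrightarrow> ((\<lambda>u. U u \<omega>) \<longlongrightarrow> Um s \<omega>) (at_left s)"
  shows "(\<lambda>(s, \<omega>). indicator {0<..t} s *\<^sub>R Um s \<omega>) \<in> borel_measurable (lborel \<Otimes>\<^sub>M M)"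
proof (rule borel_measurable_LIMSEQ_metric)
  let ?h = "\<lambda>n (s, \<omega>). \<Sum>i<n. if s \<in> {grid 0 t n i<..grid 0 t n (Suc i)} then U (grid 0 t n i) \<omega> else 0"
  fix n
  have [measurable]: "U (grid 0 t n i) \<in> borel_measurable M" for i
    using grid_mono[of 0 t 0 i n] t by (intro U) (simp add: grid_0)
  show "?h n \<in> borel_measurable (lborel \<Otimes>\<^sub>M M)" by measurable
next
  let ?h = "\<lambda>n (s, \<omega>). \<Sum>i<n. if s \<in> {grid 0 t n i<..grid 0 t n (Suc i)} then U (grid 0 t n i) \<omega> else 0"
  fix p :: "real \<times> 'a"
  obtain s \<omega> where p: "p = (s, \<omega>)" by force
  have "(\<lambda>n. ?h n (s, \<omega>)) \<longlonglongrightarrow> indicator {0<..t} s *\<^sub>R Um s \<omega>"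
  proof (cases "s \<in> {0<..t}")
    case True
    hence s: "0 < s" "s \<le> t" by auto
    have "\<forall>\<^sub>F n in sequentially. U (grid 0 t n (cell 0 t n s)) \<omega> = ?h n (s, \<omega>)"
      using eventually_gt_at_top[of 0]
    proof eventually_elim
      case (elim n)
      show ?case unfolding prod.case by (rule sum_cells[OF s elim, symmetric])
    qed
    moreover have "(\<lambda>n. U (grid 0 t n (cell 0 t n s)) \<omega>) \<longlonglongrightarrow> Um s \<omega>"
      by (rule grid_tendsto_left_lim[OF lim[OF s(1)] s])
    ultimately show ?thesis using True by (simp add: Lim_transform_eventually)
  next
    case False
    have "?h n (s, \<omega>) = 0" for n
      unfolding prod.case
    proof (intro sum.neutral ballI)
      fix i assume "i \<in> {..<n}"
      hence "0 \<le> grid 0 t n i" "grid 0 t n (Suc i) \<le> t"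
        using grid_bounds(1)[of 0 t n i] grid_bounds(2)[of 0 t n "Suc i"] t by auto
      thus "(if s \<in> {grid 0 t n i<..grid 0 t n (Suc i)} then U (grid 0 t n i) \<omega> else 0) = 0"
        using False by auto
    qed
    thus ?thesis using False by simp
  qed
  thus "(\<lambda>n. ?h n p) \<longlonglongrightarrow> (case p of (s, \<omega>) \<Rightarrow> indicator {0<..t} s *\<^sub>R Um s \<omega>)" by (simp add: p)
qed

lemma left_limits_path_measurable:
  fixes u um :: "real \<Rightarrow> 'b::euclidean_space"
  assumes "0 < t" "\<And>s. 0 < s \<Longrightarrow> (u \<longlongrightarrow> um s) (at_left s)"
  shows "(\<lambda>s. indicator {0<..t} s *\<^sub>R um s) \<in> borel_measurable lborel"
proof -
  \<comment> \<open>A single path is a process over a one-point space.\<close>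
  have "(\<lambda>(s, \<omega>). indicator {0<..t} s *\<^sub>R um s) \<in> borel_measurable (lborel \<Otimes>\<^sub>M count_space (UNIV :: unit set))"
    using left_limits_jointly_measurable[OF assms(1), of "\<lambda>s _. u s" "count_space UNIV" "\<lambda>s _. um s"] assms(2) by simp
  from measurable_compose[OF measurable_Pair2'[of "()"] this] show ?thesis by simp
qed

text \<open>As \<open>ennreal\<close> sends negative reals to 0, only the positive parts of
  \<open>h\<close> and \<open>f\<close> count, here and in \<open>nn_time_integral\<close>.\<close>

definition nn_jump_integral :: "(real \<Rightarrow> real) \<Rightarrow> ('b \<Rightarrow> real) \<Rightarrow> (real \<Rightarrow> 'b::real_normed_vector) \<Rightarrow> real \<Rightarrow> ennreal" where
  "nn_jump_integral h f l t = (\<integral>\<^sup>+u. indicator {0<..t} u * (ennreal (h u) * ennreal (f (jump l u))) \<partial>count_space UNIV)"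

definition nn_time_integral :: "(real \<Rightarrow> real) \<Rightarrow> real \<Rightarrow> ennreal" where
  "nn_time_integral h t = (\<integral>\<^sup>+s. indicator {0<..t} s * ennreal (h s) \<partial>lborel)"

context levy_jumps
begin

abbreviation CS :: "(real \<Rightarrow> 'a \<Rightarrow> real) \<Rightarrow> (real^'d \<Rightarrow> real) \<Rightarrow> real \<Rightarrow> 'a \<Rightarrow> ennreal" where
  "CS Um f t \<omega> \<equiv> nn_jump_integral (\<lambda>s. Um s \<omega>) f (\<lambda>t. L t \<omega>) t"

abbreviation CI :: "(real \<Rightarrow> 'a \<Rightarrow> real) \<Rightarrow> real \<Rightarrow> 'a \<Rightarrow> ennreal" where
  "CI Um t \<omega> \<equiv> nn_time_integral (\<lambda>s. Um s \<omega>) t"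

text \<open>The weight of a cell is taken at its left end and so belongs to the past of that cell;
  the mean jump sum over the cell can then be replaced by its length times the \<nu>-integral of
  \<open>f\<close>. Both Riemann sums converge dominatedly. Since \<open>f\<close> vanishes near 0,
  the jump sum is finite on every path, as the pathwise limit requires. A one-sided bound on
  \<open>U\<close> suffices because negative weights count as 0.\<close>

lemma compensation_bounded:
  assumes cont: "continuous_on UNIV f" and nonneg: "\<And>x. 0 \<le> f x"
    and d: "0 < d" "\<And>x. norm x < d \<Longrightarrow> f x = 0" and fin: "(\<integral>\<^sup>+x. ennreal (f x) \<partial>\<nu>) < \<infinity>"
    and t: "0 < t" and U: "\<And>s. 0 \<le> s \<Longrightarrow> U s \<in> borel_measurable (F s)"
    and U_bd: "\<And>s \<omega>. 0 \<le> s \<Longrightarrow> U s \<omega> \<le> K"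
    and lim: "\<And>s \<omega>. 0 < s \<Longrightarrow> ((\<lambda>u. U u \<omega>) \<longlongrightarrow> Um s \<omega>) (at_left s)"
  shows "CS Um f t \<in> borel_measurable M" "CI Um t \<in> borel_measurable M"
    "(\<integral>\<^sup>+\<omega>. CS Um f t \<omega> \<partial>M) = (\<integral>\<^sup>+x. ennreal (f x) \<partial>\<nu>) * (\<integral>\<^sup>+\<omega>. CI Um t \<omega> \<partial>M)"
proof -
  define g where "g n i = grid 0 t n i" for n i
  define S where "S n \<omega> = (\<Sum>i<n. ennreal (U (g n i) \<omega>) * J f (g n i) (g n (Suc i)) \<omega>)" for n \<omega>
  define T where "T n \<omega> = (\<Sum>i<n. ennreal (U (g n i) \<omega>) * ennreal (g n (Suc i) - g n i))" for n \<omega>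
  have f0: "f 0 = 0" using d by simp
  have g0: "0 \<le> g n i" and g_mono: "g n i \<le> g n (Suc i)" for n i
    using grid_mono[of 0 t 0 i n] grid_mono[of 0 t i "Suc i" n] t by (simp_all add: g_def grid_0)
  have UM[measurable]: "U (g n i) \<in> borel_measurable M" for n i
    using measurable_F_imp_M[OF g0 U[OF g0]] .
  have JM[measurable]: "J f (g n i) (g n (Suc i)) \<in> borel_measurable M" for n i
    by (rule J_measurable[OF cont nonneg f0 g0 g_mono])
  have SM: "S n \<in> borel_measurable M" and TM: "T n \<in> borel_measurable M" for n
    unfolding S_def[abs_def] T_def[abs_def] by measurable
  have S_lim: "(\<lambda>n. S n \<omega>) \<longlonglongrightarrow> CS Um f t \<omega>" for \<omega>
    unfolding S_def g_def jsum_def nn_jump_integral_def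
  proof (rule nn_riemann_sums_tendsto[OF t])
    show "(\<integral>\<^sup>+u. indicator {0<..t} u * ennreal (f (jump (\<lambda>t. L t \<omega>) u)) \<partial>count_space UNIV) < \<infinity>"
      using J_finite'[OF cont nonneg d order_refl t, of \<omega>] unfolding jsum_def .
    show "ennreal (U s \<omega>) \<le> ennreal K" if "0 \<le> s" "s < t" for s
      using U_bd[OF that(1)] by (rule ennreal_leI)
    show "((\<lambda>u. ennreal (U u \<omega>)) \<longlongrightarrow> ennreal (Um s \<omega>)) (at_left s)" if "0 < s" "s \<le> t" for s
      by (intro tendsto_ennrealI lim that)
  qed simp_all
  have T_lim: "(\<lambda>n. T n \<omega>) \<longlonglongrightarrow> CI Um t \<omega>" for \<omega>
  proof -
    have "(\<lambda>n. \<Sum>i<n. ennreal (U (grid 0 t n i) \<omega>) * (\<integral>\<^sup>+s. indicator {grid 0 t n i<..grid 0 t n (Suc i)} s * 1 \<partial>lborel))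
        \<longlonglongrightarrow> (\<integral>\<^sup>+s. indicator {0<..t} s * (ennreal (Um s \<omega>) * 1) \<partial>lborel)"
    proof (rule nn_riemann_sums_tendsto[OF t])
      show "ennreal (U s \<omega>) \<le> ennreal K" if "0 \<le> s" "s < t" for s
        using U_bd[OF that(1)] by (rule ennreal_leI)
      show "((\<lambda>u. ennreal (U u \<omega>)) \<longlongrightarrow> ennreal (Um s \<omega>)) (at_left s)" if "0 < s" "s \<le> t" for s
        by (intro tendsto_ennrealI lim that)
    qed (use t in simp_all)
    thus ?thesis using g_mono by (simp add: T_def g_def nn_time_integral_def)
  qed
  show CSM: "CS Um f t \<in> borel_measurable M"
    by (rule borel_measurable_LIMSEQ_order[OF S_lim SM])
  show CIM: "CI Um t \<in> borel_measurable M"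
    by (rule borel_measurable_LIMSEQ_order[OF T_lim TM])
  \<comment> \<open>The jump sums over the cells add up to the one over the whole interval, whose
    mean is finite; this provides the majorant.\<close>
  have tele: "(\<Sum>i<m. J f (g n i) (g n (Suc i)) \<omega>) = J f (g n 0) (g n m) \<omega>" for n m \<omega>
  proof (induction m)
    case (Suc m)
    have "g n 0 \<le> g n m" using grid_mono[of 0 t 0 m n] t by (simp add: g_def)
    from jsum_add[OF this g_mono, where f = "\<lambda>x. ennreal (f x)" and l = "\<lambda>t. L t \<omega>"] show ?case using Suc by simp
  qed simp
  have tele': "(\<Sum>i<n. ennreal (g n (Suc i) - g n i)) \<le> ennreal t" for n
    using g_mono t by (cases "n = 0") (simp_all add: sum_lessThan_telescope g_def grid_0 grid_n)
  have "(\<lambda>n. \<integral>\<^sup>+\<omega>. S n \<omega> \<partial>M) \<longlonglongrightarrow> (\<integral>\<^sup>+\<omega>. CS Um f t \<omega> \<partial>M)"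
  proof (rule nn_integral_dominated_convergence[OF SM CSM])
    show "(\<lambda>\<omega>. ennreal K * J f 0 t \<omega>) \<in> borel_measurable M"
      using J_measurable[OF cont nonneg f0 order_refl less_imp_le[OF t]] by measurable
    show "AE \<omega> in M. S n \<omega> \<le> ennreal K * J f 0 t \<omega>" for n
    proof (intro AE_I2)
      fix \<omega>
      have "S n \<omega> \<le> (\<Sum>i<n. ennreal K * J f (g n i) (g n (Suc i)) \<omega>)"
        unfolding S_def using U_bd g0 by (intro sum_mono mult_right_mono ennreal_leI) auto
      also have "\<dots> = ennreal K * J f (g n 0) (g n n) \<omega>"
        by (simp add: sum_distrib_left[symmetric] tele)
      also have "\<dots> \<le> ennreal K * J f 0 t \<omega>"
        by (cases "n = 0") (simp_all add: g_def grid_0 grid_n)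
      finally show "S n \<omega> \<le> ennreal K * J f 0 t \<omega>" .
    qed
    show "(\<integral>\<^sup>+\<omega>. ennreal K * J f 0 t \<omega> \<partial>M) < \<infinity>"
      using nn_integral_J[OF cont nonneg f0 fin, of t] J_measurable[OF cont nonneg f0, of 0 t] t fin
      by (simp add: nn_integral_cmult ennreal_mult_less_top)
  qed (use S_lim in simp)
  moreover have "(\<lambda>n. \<integral>\<^sup>+\<omega>. T n \<omega> \<partial>M) \<longlonglongrightarrow> (\<integral>\<^sup>+\<omega>. CI Um t \<omega> \<partial>M)"
  proof (rule nn_integral_dominated_convergence[OF TM CIM])
    show "AE \<omega> in M. T n \<omega> \<le> ennreal K * ennreal t" for n
    proof (intro AE_I2)
      fix \<omega>
      have "T n \<omega> \<le> (\<Sum>i<n. ennreal K * ennreal (g n (Suc i) - g n i))"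
        unfolding T_def using U_bd g0 by (intro sum_mono mult_right_mono ennreal_leI) auto
      also have "\<dots> \<le> ennreal K * ennreal t"
        unfolding sum_distrib_left[symmetric] by (intro mult_left_mono tele') simp
      finally show "T n \<omega> \<le> ennreal K * ennreal t" .
    qed
  qed (use T_lim in \<open>simp_all add: emeasure_space_1 ennreal_mult_less_top\<close>)
  hence "(\<lambda>n. (\<integral>\<^sup>+x. ennreal (f x) \<partial>\<nu>) * (\<integral>\<^sup>+\<omega>. T n \<omega> \<partial>M)) \<longlonglongrightarrow> (\<integral>\<^sup>+x. ennreal (f x) \<partial>\<nu>) * (\<integral>\<^sup>+\<omega>. CI Um t \<omega> \<partial>M)"
    using fin by (intro ennreal_tendsto_cmult) simp_all
  moreover have "(\<integral>\<^sup>+\<omega>. S n \<omega> \<partial>M) = (\<integral>\<^sup>+x. ennreal (f x) \<partial>\<nu>) * (\<integral>\<^sup>+\<omega>. T n \<omega> \<partial>M)" for n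
  proof -
    have "(\<integral>\<^sup>+\<omega>. S n \<omega> \<partial>M) = (\<Sum>i<n. \<integral>\<^sup>+\<omega>. ennreal (U (g n i) \<omega>) * J f (g n i) (g n (Suc i)) \<omega> \<partial>M)"
      unfolding S_def by (rule nn_integral_sum) measurable
    also have "\<dots> = (\<Sum>i<n. (\<integral>\<^sup>+\<omega>. ennreal (U (g n i) \<omega>) \<partial>M) * ennreal (g n (Suc i) - g n i) * (\<integral>\<^sup>+x. ennreal (f x) \<partial>\<nu>))"
    proof (intro sum.cong refl)
      fix i
      have "(\<integral>\<^sup>+\<omega>. ennreal (U (g n i) \<omega>) \<partial>M) \<le> (\<integral>\<^sup>+\<omega>. ennreal K \<partial>M)"
        by (intro nn_integral_mono ennreal_leI U_bd g0)
      hence "(\<integral>\<^sup>+\<omega>. ennreal (U (g n i) \<omega>) \<partial>M) < \<infinity>" by (auto simp: emeasure_space_1 intro: le_less_trans)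
      thus "(\<integral>\<^sup>+\<omega>. ennreal (U (g n i) \<omega>) * J f (g n i) (g n (Suc i)) \<omega> \<partial>M) =
          (\<integral>\<^sup>+\<omega>. ennreal (U (g n i) \<omega>) \<partial>M) * ennreal (g n (Suc i) - g n i) * (\<integral>\<^sup>+x. ennreal (f x) \<partial>\<nu>)"
        using U[OF g0, of n i] by (intro nn_integral_mult_jump_sum[OF cont nonneg f0 fin g0 g_mono]) auto
    qed
    also have "\<dots> = (\<integral>\<^sup>+x. ennreal (f x) \<partial>\<nu>) * (\<Sum>i<n. (\<integral>\<^sup>+\<omega>. ennreal (U (g n i) \<omega>) \<partial>M) * ennreal (g n (Suc i) - g n i))"
      by (simp add: sum_distrib_left mult_ac)
    also have "(\<Sum>i<n. (\<integral>\<^sup>+\<omega>. ennreal (U (g n i) \<omega>) \<partial>M) * ennreal (g n (Suc i) - g n i)) = (\<integral>\<^sup>+\<omega>. T n \<omega> \<partial>M)"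
      unfolding T_def by (subst nn_integral_sum) (auto simp: nn_integral_multc)
    finally show ?thesis .
  qed
  ultimately show "(\<integral>\<^sup>+\<omega>. CS Um f t \<omega> \<partial>M) = (\<integral>\<^sup>+x. ennreal (f x) \<partial>\<nu>) * (\<integral>\<^sup>+\<omega>. CI Um t \<omega> \<partial>M)"
    using LIMSEQ_unique by simp
qed

end

section \<open>Compensation for unbounded integrands and for signs\<close>

lemma incseq_mult_ennreal: "incseq f \<Longrightarrow> incseq (\<lambda>k. c * f k :: ennreal)"
  by (auto simp: incseq_def intro!: mult_left_mono)

lemma nn_jump_integral_LIMSEQ_left:
  assumes "\<And>s. 0 < s \<Longrightarrow> s \<le> t \<Longrightarrow> incseq (\<lambda>k. ennreal (h k s))"
    and "\<And>s. 0 < s \<Longrightarrow> s \<le> t \<Longrightarrow> (\<lambda>k. ennreal (h k s)) \<longlonglongrightarrow> ennreal (g s)"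
  shows "(\<lambda>k. nn_jump_integral (h k) f l t) \<longlonglongrightarrow> nn_jump_integral g f l t"
    "incseq (\<lambda>k. nn_jump_integral (h k) f l t)"
proof -
  have inc: "incseq (\<lambda>k. indicator {0<..t} u * (ennreal (h k u) * ennreal (f (jump l u))))" for u
    using incseq_mult_ennreal[OF assms(1), of u "ennreal (f (jump l u))"]
    by (cases "u \<in> {0<..t}") (auto simp: mult.commute incseq_def)
  show "(\<lambda>k. nn_jump_integral (h k) f l t) \<longlonglongrightarrow> nn_jump_integral g f l t"
    unfolding nn_jump_integral_def
  proof (rule nn_integral_LIMSEQ)
    show "incseq (\<lambda>k u. indicator {0<..t} u * (ennreal (h k u) * ennreal (f (jump l u))))"
      using inc by (auto simp: incseq_def le_fun_def)
    show "(\<lambda>k. indicator {0<..t} u * (ennreal (h k u) * ennreal (f (jump l u))))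
      \<longlonglongrightarrow> indicator {0<..t} u * (ennreal (g u) * ennreal (f (jump l u)))" for u
      using incseq_tendsto_cmult_ennreal[OF assms(1,2), of u "ennreal (f (jump l u))"]
      by (cases "u \<in> {0<..t}") (auto simp: mult.commute)
  qed simp
  show "incseq (\<lambda>k. nn_jump_integral (h k) f l t)"
    using inc by (auto simp: incseq_def nn_jump_integral_def intro!: nn_integral_mono)
qed

lemma nn_jump_integral_LIMSEQ_right:
  assumes "\<And>x. incseq (\<lambda>k. ennreal (f k x))" "\<And>x. (\<lambda>k. ennreal (f k x)) \<longlonglongrightarrow> ennreal (g x)"
  shows "(\<lambda>k. nn_jump_integral h (f k) l t) \<longlonglongrightarrow> nn_jump_integral h g l t"
    "incseq (\<lambda>k. nn_jump_integral h (f k) l t)"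
proof -
  have inc: "incseq (\<lambda>k. indicator {0<..t} u * (ennreal (h u) * ennreal (f k (jump l u))))" for u
    by (intro incseq_mult_ennreal assms)
  show "(\<lambda>k. nn_jump_integral h (f k) l t) \<longlonglongrightarrow> nn_jump_integral h g l t"
    unfolding nn_jump_integral_def
  proof (rule nn_integral_LIMSEQ)
    show "incseq (\<lambda>k u. indicator {0<..t} u * (ennreal (h u) * ennreal (f k (jump l u))))"
      using inc by (auto simp: incseq_def le_fun_def)
    show "(\<lambda>k. indicator {0<..t} u * (ennreal (h u) * ennreal (f k (jump l u))))
      \<longlonglongrightarrow> indicator {0<..t} u * (ennreal (h u) * ennreal (g (jump l u)))" for u
      by (intro incseq_tendsto_cmult_ennreal incseq_mult_ennreal assms)
  qed simp
  show "incseq (\<lambda>k. nn_jump_integral h (f k) l t)"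
    using inc by (auto simp: incseq_def nn_jump_integral_def intro!: nn_integral_mono)
qed

lemma min_nat_LIMSEQ: "(\<lambda>k. ennreal (min x (real k))) \<longlonglongrightarrow> ennreal x" "incseq (\<lambda>k. ennreal (min x (real k)))"
proof -
  have "\<forall>\<^sub>F k in sequentially. ennreal (min x (real k)) = ennreal x"
    using eventually_ge_at_top[of "nat \<lceil>x\<rceil>"]
  proof eventually_elim
    case (elim k)
    hence "x \<le> real k" by linarith
    thus ?case by simp
  qed
  thus "(\<lambda>k. ennreal (min x (real k))) \<longlonglongrightarrow> ennreal x" by (rule tendsto_eventually)
  show "incseq (\<lambda>k. ennreal (min x (real k)))" by (auto simp: incseq_def intro!: ennreal_leI)
qed

lemma integrable_enn2real:
  assumes "X \<in> borel_measurable M" "(\<integral>\<^sup>+\<omega>. X \<omega> \<partial>M) < \<infinity>"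
  shows "integrable M (\<lambda>\<omega>. enn2real (X \<omega>))" "(\<integral>\<omega>. enn2real (X \<omega>) \<partial>M) = enn2real (\<integral>\<^sup>+\<omega>. X \<omega> \<partial>M)"
    "AE \<omega> in M. X \<omega> < \<infinity>"
proof -
  have fin: "AE \<omega> in M. X \<omega> \<noteq> \<infinity>" by (rule nn_integral_PInf_AE) (use assms in auto)
  thus "AE \<omega> in M. X \<omega> < \<infinity>" by (simp add: less_top)
  have eq: "(\<integral>\<^sup>+\<omega>. ennreal (enn2real (X \<omega>)) \<partial>M) = (\<integral>\<^sup>+\<omega>. X \<omega> \<partial>M)"
    by (rule nn_integral_cong_AE) (use fin in \<open>auto simp: less_top\<close>)
  show "integrable M (\<lambda>\<omega>. enn2real (X \<omega>))"
    by (rule integrableI_nonneg) (use assms eq in auto)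
  show "(\<integral>\<omega>. enn2real (X \<omega>) \<partial>M) = enn2real (\<integral>\<^sup>+\<omega>. X \<omega> \<partial>M)"
    using assms(1) by (subst integral_eq_nn_integral) (auto simp: eq)
qed

text \<open>Integrability along almost every path and in mean is bundled with the identity, so that
  the notion is stable under differences in either argument.\<close>

definition compensated ::
  "'a measure \<Rightarrow> ('b::real_normed_vector) measure \<Rightarrow> (real \<Rightarrow> 'a \<Rightarrow> 'b) \<Rightarrow> (real \<Rightarrow> 'a \<Rightarrow> real) \<Rightarrow> ('b \<Rightarrow> real) \<Rightarrow> real \<Rightarrow> bool" where
  "compensated M \<nu> L Um f t \<longleftrightarrow>
    (AE \<omega> in M. set_integrable (count_space UNIV) {0<..t} (\<lambda>u. Um u \<omega> * f (jump (\<lambda>t. L t \<omega>) u))) \<and>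
    (AE \<omega> in M. set_integrable lborel {0<..t} (\<lambda>s. Um s \<omega>)) \<and>
    integrable M (\<lambda>\<omega>. LINT u:{0<..t}|count_space UNIV. Um u \<omega> * f (jump (\<lambda>t. L t \<omega>) u)) \<and>
    integrable M (\<lambda>\<omega>. LINT s:{0<..t}|lborel. Um s \<omega>) \<and>
    (\<integral>\<omega>. (LINT u:{0<..t}|count_space UNIV. Um u \<omega> * f (jump (\<lambda>t. L t \<omega>) u)) \<partial>M) =
      (\<integral>x. f x \<partial>\<nu>) * (\<integral>\<omega>. (LINT s:{0<..t}|lborel. Um s \<omega>) \<partial>M)"

context levy_jumps
begin

lemma CS_CI_limit:
  assumes "\<And>k. X k \<in> borel_measurable M" "\<And>\<omega>. (\<lambda>k. X k \<omega>) \<longlonglongrightarrow> Y \<omega>" "\<And>\<omega>. incseq (\<lambda>k. X k \<omega>)"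
  shows "Y \<in> borel_measurable M" "(\<lambda>k. \<integral>\<^sup>+\<omega>. X k \<omega> \<partial>M) \<longlonglongrightarrow> (\<integral>\<^sup>+\<omega>. Y \<omega> \<partial>M)" "incseq (\<lambda>k. \<integral>\<^sup>+\<omega>. X k \<omega> \<partial>M)"
proof -
  show "Y \<in> borel_measurable M" by (rule borel_measurable_LIMSEQ_order[OF assms(2,1)])
  show "(\<lambda>k. \<integral>\<^sup>+\<omega>. X k \<omega> \<partial>M) \<longlonglongrightarrow> (\<integral>\<^sup>+\<omega>. Y \<omega> \<partial>M)"
    by (rule nn_integral_LIMSEQ) (use assms in \<open>auto simp: incseq_def le_fun_def\<close>)
  show "incseq (\<lambda>k. \<integral>\<^sup>+\<omega>. X k \<omega> \<partial>M)"
    using assms(3) by (auto simp: incseq_def intro!: nn_integral_mono)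
qed

context
  fixes U Um :: "real \<Rightarrow> 'a \<Rightarrow> real" and t :: real
  assumes t: "0 < t" and U: "\<And>s. 0 \<le> s \<Longrightarrow> U s \<in> borel_measurable (F s)"
    and lim: "\<And>s \<omega>. 0 < s \<Longrightarrow> ((\<lambda>u. U u \<omega>) \<longlongrightarrow> Um s \<omega>) (at_left s)"
begin

text \<open>Removes the upper bound on \<open>U\<close> by cutting at height \<open>k\<close> and
  monotone convergence. Both sides may be infinite.\<close>

lemma compensation_vanish:
  assumes cont: "continuous_on UNIV f" and nonneg: "\<And>x. 0 \<le> f x"
    and d: "0 < d" "\<And>x. norm x < d \<Longrightarrow> f x = 0" and fin: "(\<integral>\<^sup>+x. ennreal (f x) \<partial>\<nu>) < \<infinity>"
  shows "CS Um f t \<in> borel_measurable M" "CI Um t \<in> borel_measurable M"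
    "(\<integral>\<^sup>+\<omega>. CS Um f t \<omega> \<partial>M) = (\<integral>\<^sup>+x. ennreal (f x) \<partial>\<nu>) * (\<integral>\<^sup>+\<omega>. CI Um t \<omega> \<partial>M)"
proof -
  define V where "V k s \<omega> = min (Um s \<omega>) (real k)" for k s \<omega>
  have *: "CS (V k) f t \<in> borel_measurable M" "CI (V k) t \<in> borel_measurable M"
    "(\<integral>\<^sup>+\<omega>. CS (V k) f t \<omega> \<partial>M) = (\<integral>\<^sup>+x. ennreal (f x) \<partial>\<nu>) * (\<integral>\<^sup>+\<omega>. CI (V k) t \<omega> \<partial>M)" for k
  proof -
    have a: "(\<lambda>\<omega>. min (U s \<omega>) (real k)) \<in> borel_measurable (F s)" if "0 \<le> s" for s
      using U[OF that] by measurable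
    have b: "min (U s \<omega>) (real k) \<le> real k" for s \<omega> by simp
    have c: "((\<lambda>u. min (U u \<omega>) (real k)) \<longlongrightarrow> V k s \<omega>) (at_left s)" if "0 < s" for s \<omega>
      unfolding V_def by (intro tendsto_min lim that tendsto_const)
    note * = compensation_bounded[OF cont nonneg d fin t a b c]
    show "CS (V k) f t \<in> borel_measurable M" "CI (V k) t \<in> borel_measurable M"
      "(\<integral>\<^sup>+\<omega>. CS (V k) f t \<omega> \<partial>M) = (\<integral>\<^sup>+x. ennreal (f x) \<partial>\<nu>) * (\<integral>\<^sup>+\<omega>. CI (V k) t \<omega> \<partial>M)"
      by (rule *; assumption)+
  qed
  have V: "(\<lambda>k. ennreal (V k s \<omega>)) \<longlonglongrightarrow> ennreal (Um s \<omega>)" "incseq (\<lambda>k. ennreal (V k s \<omega>))" for s \<omega>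
    unfolding V_def by (rule min_nat_LIMSEQ)+
  note S = CS_CI_limit[OF *(1) nn_jump_integral_LIMSEQ_left[OF V(2,1)]]
  have T': "(\<lambda>k. CI (V k) t \<omega>) \<longlonglongrightarrow> CI Um t \<omega>" "incseq (\<lambda>k. CI (V k) t \<omega>)" for \<omega>
  proof -
    have meas: "(\<lambda>s. indicator {0<..t} s * ennreal (V k s \<omega>)) \<in> borel_measurable lborel" for k
    proof -
      have [measurable]: "(\<lambda>s. indicator {0<..t} s *\<^sub>R Um s \<omega>) \<in> borel_measurable lborel"
        by (rule left_limits_path_measurable[OF t lim])
      have "(\<lambda>s. ennreal (min (indicator {0<..t} s *\<^sub>R Um s \<omega>) (real k))) \<in> borel_measurable lborel" by measurable
      moreover have "(\<lambda>s. ennreal (min (indicator {0<..t} s *\<^sub>R Um s \<omega>) (real k))) = (\<lambda>s. indicator {0<..t} s * ennreal (V k s \<omega>))"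
        by (auto simp: V_def split: split_indicator)
      ultimately show ?thesis by simp
    qed
    show "(\<lambda>k. CI (V k) t \<omega>) \<longlonglongrightarrow> CI Um t \<omega>"
      unfolding nn_time_integral_def
    proof (rule nn_integral_LIMSEQ[OF _ meas])
      show "incseq (\<lambda>k s. indicator {0<..t} s * ennreal (V k s \<omega>))"
        using V(2) by (auto simp: incseq_def le_fun_def intro!: mult_left_mono)
      show "(\<lambda>k. indicator {0<..t} s * ennreal (V k s \<omega>)) \<longlonglongrightarrow> indicator {0<..t} s * ennreal (Um s \<omega>)" for s
        by (intro incseq_tendsto_cmult_ennreal V)
    qed
    show "incseq (\<lambda>k. CI (V k) t \<omega>)"
      using V(2) by (auto simp: incseq_def nn_time_integral_def intro!: nn_integral_mono mult_left_mono)
  qed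
  note T = CS_CI_limit[OF *(2) T']
  show "CS Um f t \<in> borel_measurable M" "CI Um t \<in> borel_measurable M" by (rule S T)+
  have "(\<lambda>k. (\<integral>\<^sup>+x. ennreal (f x) \<partial>\<nu>) * (\<integral>\<^sup>+\<omega>. CI (V k) t \<omega> \<partial>M)) \<longlonglongrightarrow> (\<integral>\<^sup>+x. ennreal (f x) \<partial>\<nu>) * (\<integral>\<^sup>+\<omega>. CI Um t \<omega> \<partial>M)"
    by (intro incseq_tendsto_cmult_ennreal T)
  thus "(\<integral>\<^sup>+\<omega>. CS Um f t \<omega> \<partial>M) = (\<integral>\<^sup>+x. ennreal (f x) \<partial>\<nu>) * (\<integral>\<^sup>+\<omega>. CI Um t \<omega> \<partial>M)"
    using S(2) unfolding *(3) using LIMSEQ_unique by blast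
qed

text \<open>Removes the vanishing near 0: \<open>trunc f k\<close> increases to \<open>f\<close>, in
  the jump integral as well as under \<nu>.\<close>

lemma compensation_nonneg:
  assumes cont: "continuous_on UNIV f" and nonneg: "\<And>x. 0 \<le> f x" and f0: "f 0 = 0"
    and fin: "(\<integral>\<^sup>+x. ennreal (f x) \<partial>\<nu>) < \<infinity>"
  shows "CS Um f t \<in> borel_measurable M" "CI Um t \<in> borel_measurable M"
    "(\<integral>\<^sup>+\<omega>. CS Um f t \<omega> \<partial>M) = (\<integral>\<^sup>+x. ennreal (f x) \<partial>\<nu>) * (\<integral>\<^sup>+\<omega>. CI Um t \<omega> \<partial>M)"
proof -
  have *: "CS Um (trunc f k) t \<in> borel_measurable M" "CI Um t \<in> borel_measurable M"
    "(\<integral>\<^sup>+\<omega>. CS Um (trunc f k) t \<omega> \<partial>M) = (\<integral>\<^sup>+x. ennreal (trunc f k x) \<partial>\<nu>) * (\<integral>\<^sup>+\<omega>. CI Um t \<omega> \<partial>M)" for k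
  proof -
    obtain d where d: "0 < d" "\<And>x. norm x < d \<Longrightarrow> trunc f k x = 0" using trunc_vanish[OF cont f0] by blast
    have "(\<integral>\<^sup>+x. ennreal (trunc f k x) \<partial>\<nu>) \<le> (\<integral>\<^sup>+x. ennreal (f x) \<partial>\<nu>)"
      by (intro nn_integral_mono ennreal_leI trunc_le nonneg)
    hence "(\<integral>\<^sup>+x. ennreal (trunc f k x) \<partial>\<nu>) < \<infinity>" using fin by (rule le_less_trans)
    note * = compensation_vanish[OF trunc_continuous[OF cont] trunc_nonneg d this]
    show "CS Um (trunc f k) t \<in> borel_measurable M" "CI Um t \<in> borel_measurable M"
      "(\<integral>\<^sup>+\<omega>. CS Um (trunc f k) t \<omega> \<partial>M) = (\<integral>\<^sup>+x. ennreal (trunc f k x) \<partial>\<nu>) * (\<integral>\<^sup>+\<omega>. CI Um t \<omega> \<partial>M)"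
      by (rule *; assumption)+
  qed
  have tr: "(\<lambda>k. ennreal (trunc f k x)) \<longlonglongrightarrow> ennreal (f x)" "incseq (\<lambda>k. ennreal (trunc f k x))" for x
    by (intro trunc_LIMSEQ nonneg)+
  note S = CS_CI_limit[OF *(1) nn_jump_integral_LIMSEQ_right[OF tr(2,1)]]
  show "CS Um f t \<in> borel_measurable M" "CI Um t \<in> borel_measurable M" by (rule S *)+
  have "trunc f k \<in> borel_measurable borel" for k
    using trunc_continuous[OF cont] by (rule borel_measurable_continuous_onI)
  hence [measurable]: "trunc f k \<in> borel_measurable \<nu>" for k
    using levy_measure by (simp add: has_levy_measure_def cong: measurable_cong_sets)
  have "(\<lambda>k. \<integral>\<^sup>+x. ennreal (trunc f k x) \<partial>\<nu>) \<longlonglongrightarrow> (\<integral>\<^sup>+x. ennreal (f x) \<partial>\<nu>)"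
    by (intro nn_integral_LIMSEQ tr) (use tr(2) in \<open>auto simp: incseq_def le_fun_def\<close>)
  moreover have "incseq (\<lambda>k. \<integral>\<^sup>+x. ennreal (trunc f k x) \<partial>\<nu>)"
    using tr(2) by (auto simp: incseq_def intro!: nn_integral_mono)
  ultimately have "(\<lambda>k. (\<integral>\<^sup>+\<omega>. CI Um t \<omega> \<partial>M) * (\<integral>\<^sup>+x. ennreal (trunc f k x) \<partial>\<nu>)) \<longlonglongrightarrow> (\<integral>\<^sup>+\<omega>. CI Um t \<omega> \<partial>M) * (\<integral>\<^sup>+x. ennreal (f x) \<partial>\<nu>)"
    by (intro incseq_tendsto_cmult_ennreal)
  thus "(\<integral>\<^sup>+\<omega>. CS Um f t \<omega> \<partial>M) = (\<integral>\<^sup>+x. ennreal (f x) \<partial>\<nu>) * (\<integral>\<^sup>+\<omega>. CI Um t \<omega> \<partial>M)"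
    using S(2) unfolding *(3) using LIMSEQ_unique by (simp add: mult.commute) 
qed

end
end

section \<open>Almost sure equality and signed integrands\<close>

context usual_filtered_prob_space
begin

lemma null_subset_sets: "N \<in> null_sets M \<Longrightarrow> N' \<subseteq> N \<Longrightarrow> N' \<in> sets M"
  using F_complete[of N N'] subalgebra_F[of 0] by (auto simp: subalgebra_def)

text \<open>By completeness every subset of a null set is measurable, so altering a function on a
  null set does not affect measurability. Thus identities that hold only almost surely can be
  integrated without a separate measurability proof.\<close>

lemma measurable_AE_eq:
  assumes g: "g \<in> measurable M N" and eq: "AE \<omega> in M. f \<omega> = g \<omega>" and f: "\<And>\<omega>. \<omega> \<in> space M \<Longrightarrow> f \<omega> \<in> space N"
  shows "f \<in> measurable M N"
proof (rule measurableI)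
  fix A assume A: "A \<in> sets N"
  obtain Z where Z: "Z \<in> null_sets M" "{\<omega>\<in>space M. f \<omega> \<noteq> g \<omega>} \<subseteq> Z"
    using eq by (auto simp: eventually_ae_filter)
  have eq: "f -` A \<inter> space M = (g -` A \<inter> space M - Z) \<union> (f -` A \<inter> space M \<inter> Z)"
    using Z(2) by auto
  show "f -` A \<inter> space M \<in> sets M"
  proof (subst eq, rule sets.Un)
    show "f -` A \<inter> space M \<inter> Z \<in> sets M" using Z(1) by (rule null_subset_sets) auto
    show "g -` A \<inter> space M - Z \<in> sets M" using measurable_sets[OF g A] Z(1) by auto
  qed
qed (use f in auto)

lemma integrable_AE_eq:
  fixes f g :: "'a \<Rightarrow> 'b::{banach, second_countable_topology}"
  assumes "integrable M g" "AE \<omega> in M. f \<omega> = g \<omega>"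
  shows "integrable M f" "integral\<^sup>L M f = integral\<^sup>L M g"
proof -
  have [measurable]: "f \<in> borel_measurable M" "g \<in> borel_measurable M"
    using measurable_AE_eq[OF borel_measurable_integrable[OF assms(1)] assms(2)] assms(1) by auto
  show "integrable M f" using assms by (subst integrable_cong_AE[of f M g]) auto
  show "integral\<^sup>L M f = integral\<^sup>L M g" using assms by (intro integral_cong_AE) auto
qed

text \<open>The inner integrals are linear only on paths where both exist, that is, almost surely;
  \<open>integrable_AE_eq\<close> carries linearity over to the expectation.\<close>

lemma compensated_diff_right:
  assumes 1: "compensated M \<nu> L Um f t" and 2: "compensated M \<nu> L Um g t"
    and int: "integrable \<nu> f" "integrable \<nu> g"
  shows "compensated M \<nu> L Um (\<lambda>x. f x - g x) t"
proof -
  let ?I = "\<lambda>f \<omega>. LINT u:{0<..t}|count_space UNIV. Um u \<omega> * f (jump (\<lambda>t. L t \<omega>) u)"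
  let ?s = "\<lambda>f \<omega>. set_integrable (count_space UNIV) {0<..t} (\<lambda>u. Um u \<omega> * f (jump (\<lambda>t. L t \<omega>) u))"
  note 1 = 1[unfolded compensated_def] and 2 = 2[unfolded compensated_def]
  have ae: "AE \<omega> in M. ?s f \<omega> \<and> ?s g \<omega>" using 1 2 by (auto intro: AE_conjI)
  have s: "AE \<omega> in M. ?s (\<lambda>x. f x - g x) \<omega>"
    using ae by eventually_elim (simp add: right_diff_distrib set_integral_diff)
  have eq: "AE \<omega> in M. ?I (\<lambda>x. f x - g x) \<omega> = ?I f \<omega> - ?I g \<omega>"
    using ae by eventually_elim (simp add: right_diff_distrib set_integral_diff)
  have i: "integrable M (\<lambda>\<omega>. ?I f \<omega> - ?I g \<omega>)" using 1 2 by (intro Bochner_Integration.integrable_diff) auto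
  have "(\<integral>\<omega>. ?I (\<lambda>x. f x - g x) \<omega> \<partial>M) = (\<integral>\<omega>. ?I f \<omega> \<partial>M) - (\<integral>\<omega>. ?I g \<omega> \<partial>M)"
    unfolding integrable_AE_eq(2)[OF i eq] using 1 2 by (intro Bochner_Integration.integral_diff) auto
  also have "\<dots> = (\<integral>x. f x - g x \<partial>\<nu>) * (\<integral>\<omega>. (LINT s:{0<..t}|lborel. Um s \<omega>) \<partial>M)"
    using 1 2 int by (simp add: algebra_simps)
  finally show ?thesis using 1 s integrable_AE_eq(1)[OF i eq] unfolding compensated_def by simp
qed

lemma compensated_diff_left:
  assumes 1: "compensated M \<nu> L Um f t" and 2: "compensated M \<nu> L Vm f t"
  shows "compensated M \<nu> L (\<lambda>s \<omega>. Um s \<omega> - Vm s \<omega>) f t"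
proof -
  let ?I = "\<lambda>Um \<omega>. LINT u:{0<..t}|count_space UNIV. Um u \<omega> * f (jump (\<lambda>t. L t \<omega>) u)"
  let ?s = "\<lambda>Um \<omega>. set_integrable (count_space UNIV) {0<..t} (\<lambda>u. Um u \<omega> * f (jump (\<lambda>t. L t \<omega>) u))"
  let ?T = "\<lambda>Um \<omega>. LINT s:{0<..t}|lborel. Um s \<omega>"
  let ?r = "\<lambda>Um \<omega>. set_integrable lborel {0<..t} (\<lambda>s. Um s \<omega>)"
  let ?D = "\<lambda>s \<omega>. Um s \<omega> - Vm s \<omega>"
  note 1 = 1[unfolded compensated_def] and 2 = 2[unfolded compensated_def]
  have ae: "AE \<omega> in M. ?s Um \<omega> \<and> ?s Vm \<omega>" "AE \<omega> in M. ?r Um \<omega> \<and> ?r Vm \<omega>" using 1 2 by (auto intro: AE_conjI)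
  have s: "AE \<omega> in M. ?s ?D \<omega>" using ae(1) by eventually_elim (simp add: left_diff_distrib set_integral_diff)
  have r: "AE \<omega> in M. ?r ?D \<omega>" using ae(2) by eventually_elim (simp add: set_integral_diff)
  have eq: "AE \<omega> in M. ?I ?D \<omega> = ?I Um \<omega> - ?I Vm \<omega>"
    using ae(1) by eventually_elim (simp add: left_diff_distrib set_integral_diff)
  have eqT: "AE \<omega> in M. ?T ?D \<omega> = ?T Um \<omega> - ?T Vm \<omega>"
    using ae(2) by eventually_elim (simp add: set_integral_diff)
  have i: "integrable M (\<lambda>\<omega>. ?I Um \<omega> - ?I Vm \<omega>)" using 1 2 by (intro Bochner_Integration.integrable_diff) auto
  have iT: "integrable M (\<lambda>\<omega>. ?T Um \<omega> - ?T Vm \<omega>)" using 1 2 by (intro Bochner_Integration.integrable_diff) auto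
  have "(\<integral>\<omega>. ?I ?D \<omega> \<partial>M) = (\<integral>\<omega>. ?I Um \<omega> \<partial>M) - (\<integral>\<omega>. ?I Vm \<omega> \<partial>M)"
    unfolding integrable_AE_eq(2)[OF i eq] using 1 2 by (intro Bochner_Integration.integral_diff) auto
  also have "\<dots> = (\<integral>x. f x \<partial>\<nu>) * ((\<integral>\<omega>. ?T Um \<omega> \<partial>M) - (\<integral>\<omega>. ?T Vm \<omega> \<partial>M))"
    using 1 2 by (simp add: algebra_simps)
  also have "(\<integral>\<omega>. ?T Um \<omega> \<partial>M) - (\<integral>\<omega>. ?T Vm \<omega> \<partial>M) = (\<integral>\<omega>. ?T ?D \<omega> \<partial>M)"
    unfolding integrable_AE_eq(2)[OF iT eqT] using 1 2 by (intro Bochner_Integration.integral_diff[symmetric]) auto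
  finally show ?thesis using s r integrable_AE_eq(1)[OF i eq] integrable_AE_eq(1)[OF iT eqT]
    unfolding compensated_def by simp
qed

end

context levy_jumps
begin

text \<open>For nonnegative integrands the Lebesgue integrals are real versions of \<open>CS\<close>
  and \<open>CI\<close>. One finite mean forces the other, by \<open>compensation_nonneg\<close>,
  and finite means force finiteness on almost every path.\<close>

lemma compensated_nonneg:
  assumes t: "0 < t" and U: "\<And>s. 0 \<le> s \<Longrightarrow> U s \<in> borel_measurable (F s)"
    and lim: "\<And>s \<omega>. 0 < s \<Longrightarrow> ((\<lambda>u. U u \<omega>) \<longlongrightarrow> Um s \<omega>) (at_left s)"
    and Um: "\<And>s \<omega>. 0 < s \<Longrightarrow> 0 \<le> Um s \<omega>"
    and cont: "continuous_on UNIV f" and nonneg: "\<And>x. 0 \<le> f x" and f0: "f 0 = 0"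
    and fin: "integrable \<nu> f" and finU: "(\<integral>\<^sup>+\<omega>. CI Um t \<omega> \<partial>M) < \<infinity>"
  shows "compensated M \<nu> L Um f t"
proof -
  have fM: "f \<in> borel_measurable \<nu>" using fin by simp
  have nu: "(\<integral>\<^sup>+x. ennreal (f x) \<partial>\<nu>) = ennreal (\<integral>x. f x \<partial>\<nu>)"
    using fin nonneg by (intro nn_integral_eq_integral) auto
  hence fin': "(\<integral>\<^sup>+x. ennreal (f x) \<partial>\<nu>) < \<infinity>" by simp
  note * = compensation_nonneg[OF t U lim cont nonneg f0 fin']
  have S: "CS Um f t \<in> borel_measurable M" and T: "CI Um t \<in> borel_measurable M"
    and eq: "(\<integral>\<^sup>+\<omega>. CS Um f t \<omega> \<partial>M) = (\<integral>\<^sup>+x. ennreal (f x) \<partial>\<nu>) * (\<integral>\<^sup>+\<omega>. CI Um t \<omega> \<partial>M)"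
    by (rule *; assumption)+
  have finS: "(\<integral>\<^sup>+\<omega>. CS Um f t \<omega> \<partial>M) < \<infinity>" unfolding eq using fin' finU by (simp add: ennreal_mult_less_top)
  note S' = integrable_enn2real[OF S finS] and T' = integrable_enn2real[OF T finU]
  have nnS: "(\<integral>\<^sup>+u. ennreal (indicator {0<..t} u *\<^sub>R (Um u \<omega> * f (jump (\<lambda>t. L t \<omega>) u))) \<partial>count_space UNIV) = CS Um f t \<omega>" for \<omega>
    unfolding nn_jump_integral_def using Um nonneg
    by (intro nn_integral_cong) (auto simp: ennreal_mult split: split_indicator)
  have nnT: "(\<integral>\<^sup>+s. ennreal (indicator {0<..t} s *\<^sub>R Um s \<omega>) \<partial>lborel) = CI Um t \<omega>" for \<omega>
    unfolding nn_time_integral_def by (intro nn_integral_cong) (auto split: split_indicator)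
  have mT: "(\<lambda>s. indicator {0<..t} s *\<^sub>R Um s \<omega>) \<in> borel_measurable lborel" for \<omega>
    by (rule left_limits_path_measurable[OF t lim])
  have pos: "0 \<le> indicator {0<..t} u *\<^sub>R (Um u \<omega> * f x)" "0 \<le> indicator {0<..t} u *\<^sub>R Um u \<omega>" for u \<omega> x
    using Um[of u \<omega>] nonneg[of x] by (auto split: split_indicator)
  have LS: "(LINT u:{0<..t}|count_space UNIV. Um u \<omega> * f (jump (\<lambda>t. L t \<omega>) u)) = enn2real (CS Um f t \<omega>)" for \<omega>
    unfolding set_lebesgue_integral_def nnS[symmetric] by (intro integral_eq_nn_integral) (use pos in auto)
  have LT: "(LINT s:{0<..t}|lborel. Um s \<omega>) = enn2real (CI Um t \<omega>)" for \<omega>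
    unfolding set_lebesgue_integral_def nnT[symmetric] by (intro integral_eq_nn_integral mT) (use pos in auto)
  have "AE \<omega> in M. set_integrable (count_space UNIV) {0<..t} (\<lambda>u. Um u \<omega> * f (jump (\<lambda>t. L t \<omega>) u))"
    using S'(3)
  proof eventually_elim
    case (elim \<omega>)
    show ?case unfolding set_integrable_def by (rule integrableI_nonneg) (use elim pos nnS in auto)
  qed
  moreover have "AE \<omega> in M. set_integrable lborel {0<..t} (\<lambda>s. Um s \<omega>)"
    using T'(3)
  proof eventually_elim
    case (elim \<omega>)
    show ?case unfolding set_integrable_def by (rule integrableI_nonneg[OF mT]) (use elim pos nnT in auto)
  qed
  moreover have "enn2real (\<integral>\<^sup>+\<omega>. CS Um f t \<omega> \<partial>M) = (\<integral>x. f x \<partial>\<nu>) * enn2real (\<integral>\<^sup>+\<omega>. CI Um t \<omega> \<partial>M)"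
    unfolding eq nu enn2real_mult using nonneg by (simp add: integral_nonneg_AE)
  ultimately show ?thesis unfolding compensated_def LS LT S'(2) T'(2) using S'(1) T'(1) by blast
qed

text \<open>Both the integrand and \<open>f\<close> are split into positive and negative parts;
  absolute integrability makes all four nonnegative combinations finite.\<close>

theorem compensation:
  assumes t: "0 < t" and U: "\<And>s. 0 \<le> s \<Longrightarrow> U s \<in> borel_measurable (F s)"
    and lim: "\<And>s \<omega>. 0 < s \<Longrightarrow> ((\<lambda>u. U u \<omega>) \<longlongrightarrow> Um s \<omega>) (at_left s)"
    and cont: "continuous_on UNIV f" and f0: "f 0 = 0"
    and fin: "integrable \<nu> f" and finU: "(\<integral>\<^sup>+\<omega>. CI (\<lambda>s \<omega>. \<bar>Um s \<omega>\<bar>) t \<omega> \<partial>M) < \<infinity>"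
  shows "compensated M \<nu> L Um f t"
proof -
  \<comment> \<open>Splits \<open>f\<close> first, for any nonnegative integrand below the absolute
    value of \<open>Um\<close>; it is then used for the two parts of \<open>Um\<close>.\<close>
  have *: "compensated M \<nu> L Vm (\<lambda>x. max 0 (f x) - max 0 (- f x)) t"
    if V: "\<And>s. 0 \<le> s \<Longrightarrow> V s \<in> borel_measurable (F s)"
      and lim': "\<And>s \<omega>. 0 < s \<Longrightarrow> ((\<lambda>u. V u \<omega>) \<longlongrightarrow> Vm s \<omega>) (at_left s)"
      and nn: "\<And>s \<omega>. 0 < s \<Longrightarrow> 0 \<le> Vm s \<omega>" and le: "\<And>s \<omega>. Vm s \<omega> \<le> \<bar>Um s \<omega>\<bar>" for V Vm
  proof (rule compensated_diff_right)
    have "(\<integral>\<^sup>+\<omega>. CI Vm t \<omega> \<partial>M) \<le> (\<integral>\<^sup>+\<omega>. CI (\<lambda>s \<omega>. \<bar>Um s \<omega>\<bar>) t \<omega> \<partial>M)"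
      unfolding nn_time_integral_def by (intro nn_integral_mono mult_left_mono ennreal_leI le) simp
    hence fin': "(\<integral>\<^sup>+\<omega>. CI Vm t \<omega> \<partial>M) < \<infinity>" using finU by (rule le_less_trans)
    show i: "integrable \<nu> (\<lambda>x. max 0 (f x))" "integrable \<nu> (\<lambda>x. max 0 (- f x))"
      using fin by (auto intro!: integrable_max)
    show "compensated M \<nu> L Vm (\<lambda>x. max 0 (f x)) t"
      by (rule compensated_nonneg[OF t V lim' nn _ _ _ _ fin']) (auto intro!: continuous_intros cont i simp: f0)
    show "compensated M \<nu> L Vm (\<lambda>x. max 0 (- f x)) t"
      by (rule compensated_nonneg[OF t V lim' nn _ _ _ _ fin']) (auto intro!: continuous_intros cont i simp: f0)
  qed
  have f: "max 0 (f x) - max 0 (- f x) = f x" for x by (simp add: max_def)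
  have "compensated M \<nu> L (\<lambda>s \<omega>. max 0 (Um s \<omega>) - max 0 (- Um s \<omega>)) f t"
  proof (rule compensated_diff_left)
    show "compensated M \<nu> L (\<lambda>s \<omega>. max 0 (Um s \<omega>)) f t"
    proof (rule *[of "\<lambda>s \<omega>. max 0 (U s \<omega>)" "\<lambda>s \<omega>. max 0 (Um s \<omega>)", unfolded f])
      show "(\<lambda>\<omega>. max 0 (U s \<omega>)) \<in> borel_measurable (F s)" if "0 \<le> s" for s using U[OF that] by measurable
    qed (auto intro!: tendsto_max lim)
    show "compensated M \<nu> L (\<lambda>s \<omega>. max 0 (- Um s \<omega>)) f t"
    proof (rule *[of "\<lambda>s \<omega>. max 0 (- U s \<omega>)" "\<lambda>s \<omega>. max 0 (- Um s \<omega>)", unfolded f])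
      show "(\<lambda>\<omega>. max 0 (- U s \<omega>)) \<in> borel_measurable (F s)" if "0 \<le> s" for s using U[OF that] by measurable
    qed (auto intro!: tendsto_max tendsto_minus lim)
  qed
  moreover have "max 0 (Um s \<omega>) - max 0 (- Um s \<omega>) = Um s \<omega>" for s \<omega> by (simp add: max_def)
  ultimately show ?thesis by simp
qed

end

section \<open>The volatility process\<close>

lemma mat_1_nth: "(mat 1 :: real^'n^'n) $ i $ j = (if i = j then 1 else 0)"
  by (simp add: mat_def)

lemma abs_matrix_mult_nth_le: "\<bar>((X :: real^'n^'m) ** (Y :: real^'p^'n)) $ i $ j\<bar> \<le> norm X * norm Y"
  using abs_matrix_nth_le_norm norm_matrix_mult_le by (rule order_trans)

lemma norm_matrix_le_l1: "norm (X :: real^'n^'m) \<le> (\<Sum>i\<in>UNIV. \<Sum>j\<in>UNIV. \<bar>X $ i $ j\<bar>)"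
proof -
  have "norm X \<le> (\<Sum>i\<in>UNIV. norm (X $ i))"
    by (simp add: norm_vec_def L2_set_le_sum)
  also have "\<dots> \<le> (\<Sum>i\<in>UNIV. \<Sum>j\<in>UNIV. \<bar>X $ i $ j\<bar>)"
    by (intro sum_mono norm_le_l1_cart)
  finally show ?thesis .
qed

text \<open>Path properties are required for every \<omega>, so left limits exist without
  exceptional sets; \<open>mucogarch_modification\<close> later supplies such versions. Only the
  volatility equation remains an almost sure statement.\<close>

locale mucogarch = levy_jumps M F L \<nu>
  for M :: "'a measure" and F and L :: "real \<Rightarrow> 'a \<Rightarrow> real^'d" and \<nu> +
  fixes A B C :: "real^'d^'d" and Y :: "real \<Rightarrow> 'a \<Rightarrow> real^'d^'d" and \<sigma> :: real
  assumes cadlag_Y: "cadlag (\<lambda>t. Y t \<omega>)"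
    and adapted_Y: "0 \<le> t \<Longrightarrow> Y t \<in> borel_measurable (F t)"
    and psd_Y: "0 \<le> t \<Longrightarrow> psd (Y t \<omega>)" and psd_C: "psd C"
    and integrable_outer: "integrable \<nu> (\<lambda>x. outer x x)"
    and integral_outer: "(\<integral>x. outer x x \<partial>\<nu>) = \<sigma> *\<^sub>R mat 1"
    and volatility_eq: "AE \<omega> in M. \<forall>t\<ge>0. \<exists>J.
      has_matrix_ls_integral
        (\<lambda>s. A ** psd_sqrt (C + left_lim (\<lambda>u. Y u \<omega>) s))
        (discont_qv (\<lambda>u. L u \<omega>))
        (\<lambda>s. psd_sqrt (C + left_lim (\<lambda>u. Y u \<omega>) s) ** transpose A) t J \<and>
      Y t \<omega> = Y 0 \<omega>
        + integral {0..t} (\<lambda>s. B ** left_lim (\<lambda>u. Y u \<omega>) s + left_lim (\<lambda>u. Y u \<omega>) s ** transpose B)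
        + J"
    and integrable_Y0: "integrable M (Y 0)"
begin

definition Ym :: "real \<Rightarrow> 'a \<Rightarrow> real^'d^'d" where "Ym s \<omega> = left_lim (\<lambda>u. Y u \<omega>) s"
definition S :: "real \<Rightarrow> 'a \<Rightarrow> real^'d^'d" where "S s \<omega> = psd_sqrt (C + Y s \<omega>)"
definition Sm :: "real \<Rightarrow> 'a \<Rightarrow> real^'d^'d" where "Sm s \<omega> = psd_sqrt (C + Ym s \<omega>)"

definition dd :: real where "dd = real CARD('d)"

lemma dd_pos: "0 < dd" by (simp add: dd_def)

lemma tendsto_Ym: "0 < s \<Longrightarrow> ((\<lambda>u. Y u \<omega>) \<longlongrightarrow> Ym s \<omega>) (at_left s)"
  and tendsto_Ym_Ym: "0 < s \<Longrightarrow> ((\<lambda>u. Ym u \<omega>) \<longlongrightarrow> Ym s \<omega>) (at_left s)"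
  using tendsto_left_lim[OF cadlag_Y] tendsto_left_lim_left_lim[OF cadlag_Y] by (simp_all add: Ym_def)

lemma Ym_0: "Ym 0 \<omega> = Y 0 \<omega>"
  by (simp add: Ym_def left_lim_0)

lemma eventually_at_left_nonneg: "0 < s \<Longrightarrow> \<forall>\<^sub>F u in at_left s. 0 \<le> (u :: real)"
  unfolding eventually_at_left_field by (intro exI[of _ 0]) auto

lemma psd_Ym: assumes "0 \<le> s" shows "psd (Ym s \<omega>)"
proof (cases "s = 0")
  case False
  have "\<forall>\<^sub>F u in at_left s. Y u \<omega> \<in> {X. psd X}"
    using eventually_at_left_nonneg[of s] assms False by (auto elim!: eventually_mono intro: psd_Y)
  hence "Ym s \<omega> \<in> {X. psd X}"
    using assms False by (intro Lim_in_closed_set[OF closed_psd _ _ tendsto_Ym]) auto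
  thus ?thesis by simp
qed (simp add: Ym_0 psd_Y)

lemma psd_CY: "0 \<le> s \<Longrightarrow> psd (C + Y s \<omega>)" and psd_CYm: "0 \<le> s \<Longrightarrow> psd (C + Ym s \<omega>)"
  by (intro psd_add psd_C psd_Y psd_Ym; assumption)+

text \<open>The psd cone is closed, so left limits remain in the set on which
  \<open>psd_sqrt\<close> is continuous.\<close>

lemma tendsto_S_Sm:
  assumes "0 < s" shows "((\<lambda>u. S u \<omega>) \<longlongrightarrow> Sm s \<omega>) (at_left s)"
  unfolding S_def Sm_def
proof (rule continuous_on_tendsto_compose[OF continuous_on_psd_sqrt])
  show "((\<lambda>u. C + Y u \<omega>) \<longlongrightarrow> C + Ym s \<omega>) (at_left s)"
    by (intro tendsto_intros tendsto_Ym assms)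
  show "\<forall>\<^sub>F u in at_left s. C + Y u \<omega> \<in> {X. psd X}"
    using eventually_at_left_nonneg[OF assms] by (auto elim!: eventually_mono intro: psd_CY)
qed (use assms in \<open>auto intro!: psd_CYm\<close>)

lemma tendsto_Sm_Sm:
  assumes "0 < s" shows "((\<lambda>u. Sm u \<omega>) \<longlongrightarrow> Sm s \<omega>) (at_left s)"
  unfolding Sm_def
proof (rule continuous_on_tendsto_compose[OF continuous_on_psd_sqrt])
  show "((\<lambda>u. C + Ym u \<omega>) \<longlongrightarrow> C + Ym s \<omega>) (at_left s)"
    by (intro tendsto_intros tendsto_Ym_Ym assms)
  show "\<forall>\<^sub>F u in at_left s. C + Ym u \<omega> \<in> {X. psd X}"
    unfolding eventually_at_left_field using assms by (intro exI[of _ 0]) (auto intro!: psd_CYm)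
qed (use assms in \<open>auto intro!: psd_CYm\<close>)

text \<open>The root is known to be continuous on the psd matrices only; multiplied by the indicator
  of that closed set it becomes a Borel function on all matrices, and the indicator is 1 along the
  path.\<close>

lemma S_measurable:
  assumes "0 \<le> s" shows "S s \<in> borel_measurable (F s)"
proof -
  have "(\<lambda>X. indicator {X :: real^'d^'d. psd X} X *\<^sub>R psd_sqrt X) \<in> borel_measurable borel"
    using continuous_on_psd_sqrt by (intro borel_measurable_continuous_on_indicator borel_closed closed_psd)
  moreover have "(\<lambda>\<omega>. C + Y s \<omega>) \<in> borel_measurable (F s)"
    using adapted_Y[OF assms] by measurable
  ultimately have "(\<lambda>\<omega>. indicator {X :: real^'d^'d. psd X} (C + Y s \<omega>) *\<^sub>R psd_sqrt (C + Y s \<omega>)) \<in> borel_measurable (F s)"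
    by (rule measurable_compose[rotated])
  thus ?thesis by (simp add: psd_CY[OF assms] S_def[abs_def])
qed

lemma Sm_mult_self: "0 \<le> s \<Longrightarrow> Sm s \<omega> ** Sm s \<omega> = C + Ym s \<omega>"
  unfolding Sm_def by (intro psd_sqrt_mult_self psd_CYm)

lemma norm_Sm_le:
  assumes "0 \<le> s" shows "(norm (Sm s \<omega>))\<^sup>2 \<le> dd * (norm C + norm (Ym s \<omega>))"
proof -
  have "(norm (Sm s \<omega>))\<^sup>2 \<le> dd * norm (C + Ym s \<omega>)"
    unfolding Sm_def dd_def by (rule norm_psd_sqrt_le[OF psd_CYm[OF assms]])
  also have "\<dots> \<le> dd * (norm C + norm (Ym s \<omega>))"
    using dd_pos by (intro mult_left_mono norm_triangle_ineq) auto
  finally show ?thesis .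
qed

lemma Ym_bounded: assumes "0 \<le> t" shows "\<exists>K. \<forall>s\<in>{0..t}. norm (Y s \<omega>) \<le> K \<and> norm (Ym s \<omega>) \<le> K"
proof -
  obtain K where K: "\<And>s. 0 \<le> s \<Longrightarrow> s \<le> t \<Longrightarrow> norm (Y s \<omega>) \<le> K"
    using cadlag_bounded[OF cadlag_Y assms, of \<omega>] unfolding Ball_def atLeastAtMost_iff by blast
  have "norm (Ym s \<omega>) \<le> K" if "0 \<le> s" "s \<le> t" for s
    unfolding Ym_def by (rule norm_left_lim_le[OF cadlag_Y that K])
  thus ?thesis using K by (intro exI[of _ K]) auto
qed

text \<open>The factor of the integrator's \<open>(k, l)\<close> entry in entry
  \<open>(i, j)\<close> of the stochastic integral. \<open>coef\<close> is adapted and can be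
  evaluated at grid points; \<open>coefm\<close> is its left limit, which is what gets
  integrated.\<close>

definition coef :: "'d \<Rightarrow> 'd \<Rightarrow> 'd \<Rightarrow> 'd \<Rightarrow> real \<Rightarrow> 'a \<Rightarrow> real" where
  "coef i j k l s \<omega> = (A ** S s \<omega>) $ i $ k * (S s \<omega> ** transpose A) $ l $ j"
definition coefm :: "'d \<Rightarrow> 'd \<Rightarrow> 'd \<Rightarrow> 'd \<Rightarrow> real \<Rightarrow> 'a \<Rightarrow> real" where
  "coefm i j k l s \<omega> = (A ** Sm s \<omega>) $ i $ k * (Sm s \<omega> ** transpose A) $ l $ j"

lemma coef_measurable: assumes "0 \<le> s" shows "coef i j k l s \<in> borel_measurable (F s)"
proof -
  have "continuous_on UNIV (\<lambda>X :: real^'d^'d. (A ** X) $ i $ k * (X ** transpose A) $ l $ j)"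
    by (intro continuous_intros continuous_on_matrix_mult)
  from borel_measurable_continuous_onI[OF this] show ?thesis
    unfolding coef_def[abs_def] using S_measurable[OF assms] by (rule measurable_compose[rotated])
qed

lemma tendsto_coef: "0 < s \<Longrightarrow> ((\<lambda>u. coef i j k l u \<omega>) \<longlongrightarrow> coefm i j k l s \<omega>) (at_left s)"
  and tendsto_coefm: "0 < s \<Longrightarrow> ((\<lambda>u. coefm i j k l u \<omega>) \<longlongrightarrow> coefm i j k l s \<omega>) (at_left s)"
  unfolding coef_def coefm_def
  by (intro tendsto_intros tendsto_matrix_mult tendsto_S_Sm tendsto_Sm_Sm; assumption)+

definition ca :: real where "ca = (norm A)\<^sup>2 * dd"

lemma ca_nonneg: "0 \<le> ca" using dd_pos by (simp add: ca_def)

text \<open>Each of the two square roots grows like the square root of the state, so their product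
  grows linearly; Gronwall depends on exactly this.\<close>

lemma abs_coefm_le:
  assumes "0 \<le> s" shows "\<bar>coefm i j k l s \<omega>\<bar> \<le> ca * (norm C + norm (Ym s \<omega>))"
proof -
  have "\<bar>coefm i j k l s \<omega>\<bar> \<le> (norm A * norm (Sm s \<omega>)) * (norm (Sm s \<omega>) * norm A)"
    unfolding coefm_def abs_mult
    using abs_matrix_mult_nth_le[of A "Sm s \<omega>" i k] abs_matrix_mult_nth_le[of "Sm s \<omega>" "transpose A" l j]
    by (intro mult_mono) auto
  also have "\<dots> = (norm A)\<^sup>2 * (norm (Sm s \<omega>))\<^sup>2" by (simp add: power2_eq_square)
  also have "\<dots> \<le> (norm A)\<^sup>2 * (dd * (norm C + norm (Ym s \<omega>)))"
    by (intro mult_left_mono norm_Sm_le assms) simp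
  finally show ?thesis by (simp add: ca_def mult.assoc)
qed

text \<open>Under the expectation only the terms with \<open>k = l\<close> survive; there the two
  roots meet and multiply to \<open>C + Ym\<close>, which makes the mean equation linear.\<close>

lemma sum_coefm_diagonal:
  assumes "0 \<le> s" shows "(\<Sum>k\<in>UNIV. coefm i j k k s \<omega>) = (A ** (C + Ym s \<omega>) ** transpose A) $ i $ j"
proof -
  have "A ** (C + Ym s \<omega>) ** transpose A = (A ** Sm s \<omega>) ** (Sm s \<omega> ** transpose A)"
    unfolding Sm_mult_self[OF assms, symmetric] by (simp add: matrix_mul_assoc)
  thus ?thesis by (simp add: coefm_def matrix_matrix_mult_def[of "A ** Sm s \<omega>"])
qed

definition nsq :: "real^'d \<Rightarrow> real" where "nsq x = (norm x)\<^sup>2"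

lemma nsq: "continuous_on UNIV nsq" "0 \<le> nsq x" "nsq 0 = 0"
  unfolding nsq_def[abs_def] by (auto intro!: continuous_intros)

lemma integrable_nsq: "integrable \<nu> nsq"
proof -
  have "integrable \<nu> (\<lambda>x. norm (outer x x))" using integrable_outer by (rule integrable_norm)
  thus ?thesis by (simp add: norm_outer nsq_def[abs_def] power2_eq_square)
qed

definition R :: real where "R = (\<integral>x. nsq x \<partial>\<nu>)"

lemma R_nonneg: "0 \<le> R" unfolding R_def using nsq(2) by (intro integral_nonneg_AE) auto

lemma nn_integral_nsq: "(\<integral>\<^sup>+x. ennreal (nsq x) \<partial>\<nu>) = ennreal R"
  unfolding R_def using integrable_nsq nsq(2) by (intro nn_integral_eq_integral) auto

lemma
  shows integrable_products: "integrable \<nu> (\<lambda>x. x $ k * x $ l)"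
    and integral_products: "(\<integral>x. x $ k * x $ l \<partial>\<nu>) = (if k = l then \<sigma> else 0)"
proof -
  have lin: "bounded_linear (\<lambda>Z :: real^'d^'d. Z $ k $ l)"
    by (intro bounded_linear_compose[OF bounded_linear_vec_nth bounded_linear_vec_nth])
  have "integrable \<nu> (\<lambda>x. outer x x $ k $ l)"
    by (rule integrable_bounded_linear[OF lin integrable_outer])
  thus "integrable \<nu> (\<lambda>x. x $ k * x $ l)" by (simp add: outer_def)
  have "(\<integral>x. outer x x $ k $ l \<partial>\<nu>) = (\<sigma> *\<^sub>R mat 1 :: real^'d^'d) $ k $ l"
    unfolding integral_outer[symmetric] by (rule integral_bounded_linear[OF lin integrable_outer])
  thus "(\<integral>x. x $ k * x $ l \<partial>\<nu>) = (if k = l then \<sigma> else 0)" by (simp add: outer_def mat_1_nth)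
qed

text \<open>Finite mean at each integer time gives almost sure finiteness there; countably many
  integers bound all times, so one null set serves every \<open>t\<close>.\<close>

lemma AE_jumps_square_summable:
  "AE \<omega> in M. \<forall>t :: real. set_integrable (count_space UNIV) {0<..t} (\<lambda>s. (norm (jump (\<lambda>t. L t \<omega>) s))\<^sup>2)"
proof -
  have "AE \<omega> in M. J nsq 0 (real n) \<omega> < \<infinity>" for n
  proof (rule integrable_enn2real(3))
    show "J nsq 0 (real n) \<in> borel_measurable M" by (rule J_measurable[OF nsq]) auto
    show "(\<integral>\<^sup>+\<omega>. J nsq 0 (real n) \<omega> \<partial>M) < \<infinity>"
      using nn_integral_J[OF nsq, of "real n"] by (simp add: nn_integral_nsq ennreal_mult_less_top)
  qed
  hence "AE \<omega> in M. \<forall>n. J nsq 0 (real n) \<omega> < \<infinity>" by (simp add: AE_all_countable)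
  thus ?thesis
  proof eventually_elim
    case (elim \<omega>)
    show ?case
    proof
      fix t :: real
      have "set_integrable (count_space UNIV) {0<..real (nat \<lceil>t\<rceil>)} (\<lambda>s. (norm (jump (\<lambda>t. L t \<omega>) s))\<^sup>2)"
        unfolding set_integrable_def
      proof (rule integrableI_nonneg)
        have "(\<integral>\<^sup>+u. ennreal (indicator {0<..real (nat \<lceil>t\<rceil>)} u *\<^sub>R (norm (jump (\<lambda>t. L t \<omega>) u))\<^sup>2) \<partial>count_space UNIV) =
            J nsq 0 (real (nat \<lceil>t\<rceil>)) \<omega>"
          unfolding jsum_def nsq_def by (intro nn_integral_cong) (auto split: split_indicator)
        thus "(\<integral>\<^sup>+u. ennreal (indicator {0<..real (nat \<lceil>t\<rceil>)} u *\<^sub>R (norm (jump (\<lambda>t. L t \<omega>) u))\<^sup>2) \<partial>count_space UNIV) < \<infinity>"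
          using elim by simp
      qed simp_all
      thus "set_integrable (count_space UNIV) {0<..t} (\<lambda>s. (norm (jump (\<lambda>t. L t \<omega>) s))\<^sup>2)"
        by (rule set_integrable_subset) (auto, linarith)
    qed
  qed
qed

text \<open>The stochastic integral, with the integral against \<open>discont_qv\<close> written as
  a sum over the jumps of \<open>L\<close>.\<close>

definition jumps :: "real \<Rightarrow> 'a \<Rightarrow> real^'d^'d" where
  "jumps t \<omega> = (\<chi> i j. \<Sum>k\<in>UNIV. \<Sum>l\<in>UNIV.
     LINT u:{0<..t}|count_space UNIV. coefm i j k l u \<omega> * (jump (\<lambda>t. L t \<omega>) u $ k * jump (\<lambda>t. L t \<omega>) u $ l))"

definition drift :: "real \<Rightarrow> 'a \<Rightarrow> real^'d^'d" where
  "drift t \<omega> = integral {0..t} (\<lambda>s. B ** Ym s \<omega> + Ym s \<omega> ** transpose B)"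

lemma AE_path_eq:
  "AE \<omega> in M. \<forall>t>0. Y t \<omega> = Y 0 \<omega> + drift t \<omega> + jumps t \<omega>"
  using volatility_eq AE_jumps_square_summable
proof eventually_elim
  case (elim \<omega>)
  show ?case
  proof (intro allI impI)
    fix t :: real assume t: "0 < t"
    hence t0: "0 \<le> t" by simp
    obtain X where X: "has_matrix_ls_integral (\<lambda>s. A ** Sm s \<omega>) (discont_qv (\<lambda>u. L u \<omega>)) (\<lambda>s. Sm s \<omega> ** transpose A) t X"
      and YX: "Y t \<omega> = Y 0 \<omega> + drift t \<omega> + X"
      using elim(1)[rule_format, OF t0] unfolding Sm_def Ym_def drift_def by blast
    obtain I where I: "\<And>i j k l. has_ls_integral (\<lambda>s. coefm i j k l s \<omega>) (\<lambda>s. discont_qv (\<lambda>u. L u \<omega>) s $ k $ l) t (I i j k l)"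
      and XI: "X = (\<chi> i j. \<Sum>k\<in>UNIV. \<Sum>l\<in>UNIV. I i j k l)"
      using X unfolding has_matrix_ls_integral_def coefm_def by blast
    obtain K where K: "\<And>s. s \<in> {0..t} \<Longrightarrow> norm (Ym s \<omega>) \<le> K" using Ym_bounded[OF t0, of \<omega>] by blast
    have "I i j k l = (LINT u:{0<..t}|count_space UNIV. coefm i j k l u \<omega> * (jump (\<lambda>t. L t \<omega>) u $ k * jump (\<lambda>t. L t \<omega>) u $ l))" for i j k l
    proof (rule has_ls_integral_discont_qv[OF I t])
      show "set_integrable (count_space UNIV) {0<..t} (\<lambda>s. (norm (jump (\<lambda>u. L u \<omega>) s))\<^sup>2)" using elim(2) by blast
      show "\<bar>coefm i j k l s \<omega>\<bar> \<le> ca * (norm C + K)" if "0 \<le> s" "s \<le> t" for s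
        using abs_coefm_le[OF that(1), of i j k l \<omega>] K[of s] that ca_nonneg
        by (smt (verit) atLeastAtMost_iff mult_left_mono)
      show "((\<lambda>u. coefm i j k l u \<omega>) \<longlongrightarrow> coefm i j k l s \<omega>) (at_left s)" if "0 < s" "s \<le> t" for s
        by (rule tendsto_coefm[OF that(1)])
    qed
    thus "Y t \<omega> = Y 0 \<omega> + drift t \<omega> + jumps t \<omega>"
      unfolding YX XI jumps_def by simp
  qed
qed

end

text \<open>Also valid without integrability, since the integral is then 0 by default; norm bounds
  based on it hold for every \<omega>.\<close>

lemma norm_integral_le_nn_integral: "ennreal (norm (integral\<^sup>L M f)) \<le> (\<integral>\<^sup>+x. ennreal (norm (f x)) \<partial>M)"
  by (cases "integrable M f") (simp_all add: integral_norm_bound_ennreal not_integrable_integral_eq)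

lemma nn_integral_exp_le:
  assumes "0 < c" "0 < t"
  shows "(\<integral>\<^sup>+s. indicator {0<..t} s * ennreal (exp (c * s)) \<partial>lborel) \<le> ennreal (exp (c * t) / c)"
proof -
  have "(\<integral>\<^sup>+s. indicator {0<..t} s * ennreal (exp (c * s)) \<partial>lborel) \<le> (\<integral>\<^sup>+s\<in>{0..t}. ennreal (exp (c * s)) \<partial>lborel)"
    by (intro nn_integral_mono) (auto split: split_indicator)
  also have "\<dots> = ennreal (exp (c * t) / c - exp (c * 0) / c)"
    using assms by (intro nn_integral_FTC_Icc) (auto intro!: derivative_eq_intros)
  also have "\<dots> \<le> ennreal (exp (c * t) / c)" using assms by (intro ennreal_leI) simp
  finally show ?thesis .
qed

text \<open>Gronwall's inequality without continuity: the weight \<open>exp (- 2 \<gamma> s)\<close> turns the integral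
  operator into a contraction of the supremum with constant 1/2.\<close>

lemma gronwall_nn:
  fixes \<psi> :: "real \<Rightarrow> ennreal"
  assumes \<gamma>: "0 < \<gamma>" and \<alpha>: "0 \<le> \<alpha>"
    and bd: "\<And>s. 0 < s \<Longrightarrow> s \<le> T \<Longrightarrow> \<psi> s \<le> ennreal K"
    and ineq: "\<And>t. 0 < t \<Longrightarrow> t \<le> T \<Longrightarrow> \<psi> t \<le> ennreal \<alpha> + ennreal \<gamma> * (\<integral>\<^sup>+s. indicator {0<..t} s * \<psi> s \<partial>lborel)"
    and t: "0 < t" "t \<le> T"
  shows "\<psi> t \<le> ennreal (2 * \<alpha> * exp (2 * \<gamma> * T))"
proof -
  define w where "w s = ennreal (exp (- (2 * \<gamma> * s)))" for s
  have w1: "ennreal (exp (2 * \<gamma> * s)) * w s = 1" for s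
    unfolding w_def by (simp add: ennreal_mult[symmetric] exp_add[symmetric])
  \<comment> \<open>The hypothesis \<open>bd\<close> makes this supremum finite, which is what
    allows \<open>X \<le> \<alpha> + X/2\<close> to be solved for \<open>X\<close>.\<close>
  define X where "X = (SUP s\<in>{0<..T}. w s * \<psi> s)"
  have "w s * \<psi> s \<le> ennreal K" if "0 < s" "s \<le> T" for s
  proof -
    have "w s \<le> 1" using that \<gamma> by (simp add: w_def)
    hence "w s * \<psi> s \<le> 1 * ennreal K" by (intro mult_mono bd that) auto
    thus ?thesis by simp
  qed
  hence "X \<le> ennreal K" unfolding X_def by (intro SUP_least) auto
  hence X_fin: "X < \<infinity>" by (rule le_less_trans) simp
  have X: "w s * \<psi> s \<le> X" if "0 < s" "s \<le> T" for s
    unfolding X_def using that by (intro SUP_upper) auto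
  have \<psi>_le: "\<psi> s \<le> X * ennreal (exp (2 * \<gamma> * s))" if "0 < s" "s \<le> T" for s
  proof -
    have "\<psi> s = (ennreal (exp (2 * \<gamma> * s)) * w s) * \<psi> s" by (simp only: w1 mult_1)
    also have "\<dots> = ennreal (exp (2 * \<gamma> * s)) * (w s * \<psi> s)" by (simp only: mult.assoc)
    also have "\<dots> \<le> ennreal (exp (2 * \<gamma> * s)) * X" by (intro mult_left_mono X that) simp
    finally show ?thesis by (simp only: mult.commute)
  qed
  have "w s * \<psi> s \<le> ennreal \<alpha> + X * ennreal (1/2)" if s: "0 < s" "s \<le> T" for s
  proof -
    have "(\<integral>\<^sup>+u. indicator {0<..s} u * \<psi> u \<partial>lborel) \<le> (\<integral>\<^sup>+u. X * (indicator {0<..s} u * ennreal (exp (2 * \<gamma> * u))) \<partial>lborel)"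
      using s by (intro nn_integral_mono) (auto intro!: \<psi>_le split: split_indicator)
    also have "\<dots> = X * (\<integral>\<^sup>+u. indicator {0<..s} u * ennreal (exp (2 * \<gamma> * u)) \<partial>lborel)"
      by (rule nn_integral_cmult) measurable
    also have "\<dots> \<le> X * ennreal (exp (2 * \<gamma> * s) / (2 * \<gamma>))"
      using \<gamma> s by (intro mult_left_mono nn_integral_exp_le) auto
    finally have "\<psi> s \<le> ennreal \<alpha> + ennreal \<gamma> * (X * ennreal (exp (2 * \<gamma> * s) / (2 * \<gamma>)))"
      using ineq[OF s] by (meson add_left_mono mult_left_mono order_trans zero_le)
    also have "ennreal \<gamma> * (X * ennreal (exp (2 * \<gamma> * s) / (2 * \<gamma>))) = X * (ennreal (exp (2 * \<gamma> * s)) * ennreal (1/2))"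
    proof -
      have "ennreal \<gamma> * ennreal (exp (2 * \<gamma> * s) / (2 * \<gamma>)) = ennreal (exp (2 * \<gamma> * s)) * ennreal (1/2)"
      proof -
        have "ennreal \<gamma> * ennreal (exp (2 * \<gamma> * s) / (2 * \<gamma>)) = ennreal (\<gamma> * (exp (2 * \<gamma> * s) / (2 * \<gamma>)))"
          using \<gamma> by (intro ennreal_mult'[symmetric]) simp
        also have "\<dots> = ennreal (exp (2 * \<gamma> * s) * (1/2))"
          using \<gamma> by (intro arg_cong[where f = ennreal]) simp
        also have "\<dots> = ennreal (exp (2 * \<gamma> * s)) * ennreal (1/2)" by (intro ennreal_mult') simp
        finally show ?thesis .
      qed
      thus ?thesis by (metis mult.left_commute)
    qed
    finally have "w s * \<psi> s \<le> w s * (ennreal \<alpha> + X * (ennreal (exp (2 * \<gamma> * s)) * ennreal (1/2)))"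
      by (rule mult_left_mono) simp
    also have "\<dots> = w s * ennreal \<alpha> + (ennreal (exp (2 * \<gamma> * s)) * w s) * (X * ennreal (1/2))"
      by (simp add: distrib_left mult_ac)
    also have "\<dots> \<le> ennreal \<alpha> + X * ennreal (1/2)"
    proof -
      have "w s \<le> 1" using s \<gamma> by (simp add: w_def)
      from mult_right_mono[OF this, of "ennreal \<alpha>"] show ?thesis unfolding w1 by (simp add: add_right_mono)
    qed
    finally show ?thesis .
  qed
  hence "X \<le> ennreal \<alpha> + X * ennreal (1/2)" unfolding X_def by (intro SUP_least) auto
  moreover obtain x where x: "0 \<le> x" "X = ennreal x" using X_fin by (cases X) auto
  moreover have "ennreal x * ennreal (1/2) = ennreal (x * (1/2))"
    using x(1) by (intro ennreal_mult'[symmetric])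
  moreover have "ennreal \<alpha> + ennreal (x * (1/2)) = ennreal (\<alpha> + x * (1/2))"
    using x(1) \<alpha> by (intro ennreal_plus[symmetric]) auto
  ultimately have "ennreal x \<le> ennreal (\<alpha> + x * (1/2))" by (simp only:)
  hence "x \<le> \<alpha> + x * (1/2)" using x(1) \<alpha> by (subst (asm) ennreal_le_iff) auto
  hence "x \<le> 2 * \<alpha>" by simp
  have "\<psi> t \<le> X * ennreal (exp (2 * \<gamma> * t))" by (rule \<psi>_le[OF t])
  also have "\<dots> \<le> ennreal (2 * \<alpha>) * ennreal (exp (2 * \<gamma> * T))"
    using \<open>x \<le> 2 * \<alpha>\<close> t \<gamma> unfolding x by (intro mult_mono ennreal_leI) auto
  finally show ?thesis using \<alpha> by (simp add: ennreal_mult)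
qed

lemma nn_time_integral_mono:
  "(\<And>s. 0 < s \<Longrightarrow> s \<le> t \<Longrightarrow> h s \<le> g s) \<Longrightarrow> t \<le> t' \<Longrightarrow> nn_time_integral h t \<le> nn_time_integral g t'"
  unfolding nn_time_integral_def by (intro nn_integral_mono) (auto intro!: ennreal_leI split: split_indicator)

lemma nn_jump_integral_mono:
  "(\<And>s. 0 < s \<Longrightarrow> s \<le> t \<Longrightarrow> h s \<le> g s) \<Longrightarrow> t \<le> t' \<Longrightarrow> nn_jump_integral h f l t \<le> nn_jump_integral g f l t'"
  unfolding nn_jump_integral_def
  by (intro nn_integral_mono) (auto intro!: mult_right_mono ennreal_leI split: split_indicator)

section \<open>Pathwise bounds for drift and jumps\<close>

context mucogarch
begin

definition W :: "real \<Rightarrow> 'a \<Rightarrow> real^'d^'d" where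
  "W t \<omega> = (LINT s:{0<..t}|lborel. Ym s \<omega>)"

lemma set_integrable_Ym:
  assumes t: "0 < t" shows "set_integrable lborel {0<..t} (\<lambda>s. Ym s \<omega>)"
proof -
  obtain K where K: "\<And>s. s \<in> {0..t} \<Longrightarrow> norm (Ym s \<omega>) \<le> K" using Ym_bounded[of t \<omega>] t by force
  show ?thesis unfolding set_integrable_def
  proof (rule Bochner_Integration.integrable_bound)
    show "integrable lborel (\<lambda>s. indicator {0<..t} s *\<^sub>R K)"
      using t by (intro integrable_scaleR_left integrable_real_indicator) auto
    show "(\<lambda>s. indicator {0<..t} s *\<^sub>R Ym s \<omega>) \<in> borel_measurable lborel"
      by (rule left_limits_path_measurable[OF t tendsto_Ym])
    show "AE s in lborel. norm (indicator {0<..t} s *\<^sub>R Ym s \<omega>) \<le> norm (indicator {0<..t} s *\<^sub>R K)"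
    proof (intro AE_I2)
      fix s
      show "norm (indicator {0<..t} s *\<^sub>R Ym s \<omega>) \<le> norm (indicator {0<..t} s *\<^sub>R K)"
        using K[of s] by (cases "s \<in> {0<..t}") auto
    qed
  qed
qed

lemma set_integral_bounded_linear_Ym:
  fixes T :: "real^'d^'d \<Rightarrow> 'b::{banach, second_countable_topology}"
  assumes t: "0 < t" and T: "bounded_linear T"
  shows "(LINT s:{0<..t}|lborel. T (Ym s \<omega>)) = T (W t \<omega>)"
proof -
  have "(LINT s:{0<..t}|lborel. T (Ym s \<omega>)) = (\<integral>s. T (indicator {0<..t} s *\<^sub>R Ym s \<omega>) \<partial>lborel)"
    unfolding set_lebesgue_integral_def linear_cmul[OF bounded_linear.linear[OF T]] ..
  also have "\<dots> = T (W t \<omega>)"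
    unfolding W_def set_lebesgue_integral_def
    using set_integrable_Ym[OF t] by (intro integral_bounded_linear T) (simp add: set_integrable_def)
  finally show ?thesis .
qed

lemma bounded_linear_lyapunov: "bounded_linear (\<lambda>X :: real^'d^'d. B ** X + X ** transpose B)"
  by (intro bounded_linear_add bounded_bilinear.bounded_linear_right[OF bounded_bilinear_matrix_mult]
      bounded_bilinear.bounded_linear_left[OF bounded_bilinear_matrix_mult])

text \<open>The Lyapunov map is linear and can be taken out of the integral. The gauge integral over
  \<open>{0..t}\<close> and the Lebesgue integral over \<open>{0<..t}\<close> differ by the single
  point 0.\<close>

lemma drift_eq:
  assumes t: "0 < t" shows "drift t \<omega> = B ** W t \<omega> + W t \<omega> ** transpose B"
proof -
  note i = set_borel_integral_eq_integral[OF set_integrable_Ym[OF t, of \<omega>]]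
  have "((\<lambda>s. Ym s \<omega>) has_integral W t \<omega>) {0<..t}"
    unfolding W_def i(2) using i(1) by (rule integrable_integral)
  hence "((\<lambda>s. Ym s \<omega>) has_integral W t \<omega>) {0..t}"
    by (rule has_integral_spike_set_eq[THEN iffD1, rotated -1])
      (auto intro: negligible_subset[of "{0}"])
  from has_integral_linear[OF this bounded_linear_lyapunov] show ?thesis
    unfolding drift_def by (intro integral_unique) (simp add: o_def)
qed

text \<open>Two multiplications by \<open>B\<close> give \<open>cb\<close>. In \<open>cj\<close> the
  power \<open>dd ^ 4\<close> counts the indices \<open>i, j, k, l\<close> of the entrywise bound,
  and \<open>ca\<close> bounds a single coefficient.\<close>

definition cb :: real where "cb = 2 * norm B"
definition cj :: real where "cj = dd ^ 4 * ca"

lemma norm_drift_le: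
  assumes t: "0 < t" shows "ennreal (norm (drift t \<omega>)) \<le> ennreal cb * CI (\<lambda>s \<omega>. norm (Ym s \<omega>)) t \<omega>"
proof -
  have "norm (drift t \<omega>) \<le> norm B * norm (W t \<omega>) + norm (W t \<omega>) * norm B"
    unfolding drift_eq[OF t] using norm_matrix_mult_le[of B "W t \<omega>"] norm_matrix_mult_le[of "W t \<omega>" "transpose B"]
    by (intro norm_triangle_le add_mono) auto
  hence "ennreal (norm (drift t \<omega>)) \<le> ennreal (cb * norm (W t \<omega>))"
    by (intro ennreal_leI) (simp add: cb_def algebra_simps)
  also have "\<dots> = ennreal cb * ennreal (norm (W t \<omega>))" by (simp add: cb_def ennreal_mult)
  also have "ennreal (norm (W t \<omega>)) \<le> CI (\<lambda>s \<omega>. norm (Ym s \<omega>)) t \<omega>"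
  proof -
    have "ennreal (norm (W t \<omega>)) \<le> (\<integral>\<^sup>+s. ennreal (norm (indicator {0<..t} s *\<^sub>R Ym s \<omega>)) \<partial>lborel)"
      unfolding W_def set_lebesgue_integral_def by (rule norm_integral_le_nn_integral)
    also have "\<dots> = CI (\<lambda>s \<omega>. norm (Ym s \<omega>)) t \<omega>"
      unfolding nn_time_integral_def by (intro nn_integral_cong) (auto split: split_indicator)
    finally show ?thesis .
  qed
  finally show ?thesis by (simp add: mult_left_mono)
qed

lemma norm_jumps_le:
  "ennreal (norm (jumps t \<omega>)) \<le> ennreal cj * CS (\<lambda>s \<omega>. norm C + norm (Ym s \<omega>)) nsq t \<omega>"
proof -
  let ?S = "CS (\<lambda>s \<omega>. norm C + norm (Ym s \<omega>)) nsq t \<omega>"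
  let ?I = "\<lambda>i j k l. LINT u:{0<..t}|count_space UNIV. coefm i j k l u \<omega> * (jump (\<lambda>t. L t \<omega>) u $ k * jump (\<lambda>t. L t \<omega>) u $ l)"
  have I: "ennreal \<bar>?I i j k l\<bar> \<le> ennreal ca * ?S" for i j k l
  proof -
    have "ennreal \<bar>?I i j k l\<bar> \<le> (\<integral>\<^sup>+u. ennreal (norm (indicator {0<..t} u *\<^sub>R (coefm i j k l u \<omega> * (jump (\<lambda>t. L t \<omega>) u $ k * jump (\<lambda>t. L t \<omega>) u $ l)))) \<partial>count_space UNIV)"
      unfolding set_lebesgue_integral_def real_norm_def[symmetric] by (rule norm_integral_le_nn_integral)
    also have "\<dots> \<le> (\<integral>\<^sup>+u. ennreal ca * (indicator {0<..t} u * (ennreal (norm C + norm (Ym u \<omega>)) * ennreal (nsq (jump (\<lambda>t. L t \<omega>) u)))) \<partial>count_space UNIV)"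
    proof (rule nn_integral_mono)
      fix u
      show "ennreal (norm (indicator {0<..t} u *\<^sub>R (coefm i j k l u \<omega> * (jump (\<lambda>t. L t \<omega>) u $ k * jump (\<lambda>t. L t \<omega>) u $ l))))
        \<le> ennreal ca * (indicator {0<..t} u * (ennreal (norm C + norm (Ym u \<omega>)) * ennreal (nsq (jump (\<lambda>t. L t \<omega>) u))))"
      proof (cases "u \<in> {0<..t}")
        case True
        have "\<bar>coefm i j k l u \<omega>\<bar> * (\<bar>jump (\<lambda>t. L t \<omega>) u $ k\<bar> * \<bar>jump (\<lambda>t. L t \<omega>) u $ l\<bar>) \<le>
            (ca * (norm C + norm (Ym u \<omega>))) * nsq (jump (\<lambda>t. L t \<omega>) u)"
          unfolding nsq_def power2_eq_square using True ca_nonneg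
          by (intro mult_mono abs_coefm_le component_le_norm_cart) auto
        hence "ennreal (\<bar>coefm i j k l u \<omega>\<bar> * (\<bar>jump (\<lambda>t. L t \<omega>) u $ k\<bar> * \<bar>jump (\<lambda>t. L t \<omega>) u $ l\<bar>)) \<le>
            ennreal ((ca * (norm C + norm (Ym u \<omega>))) * nsq (jump (\<lambda>t. L t \<omega>) u))"
          by (rule ennreal_leI)
        also have "\<dots> = ennreal ca * (ennreal (norm C + norm (Ym u \<omega>)) * ennreal (nsq (jump (\<lambda>t. L t \<omega>) u)))"
          using ca_nonneg nsq(2) by (simp add: ennreal_mult mult.assoc del: ennreal_plus)
        finally show ?thesis using True by (simp add: abs_mult del: ennreal_plus)
      qed simp
    qed
    also have "\<dots> = ennreal ca * ?S" unfolding nn_jump_integral_def by (rule nn_integral_cmult) simp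
    finally show ?thesis .
  qed
  have "ennreal (norm (jumps t \<omega>)) \<le> ennreal (\<Sum>i\<in>UNIV. \<Sum>j\<in>UNIV. \<bar>jumps t \<omega> $ i $ j\<bar>)"
    by (intro ennreal_leI norm_matrix_le_l1)
  also have "\<dots> \<le> ennreal (\<Sum>i\<in>UNIV. \<Sum>j\<in>UNIV. \<Sum>k\<in>UNIV. \<Sum>l\<in>UNIV. \<bar>?I i j k l\<bar>)"
    unfolding jumps_def vec_lambda_beta
    by (intro ennreal_leI sum_mono order_trans[OF sum_abs] sum_abs)
  also have "\<dots> = (\<Sum>i\<in>UNIV. \<Sum>j\<in>UNIV. \<Sum>k\<in>UNIV. \<Sum>l\<in>UNIV. ennreal \<bar>?I i j k l\<bar>)"
    by (simp add: sum_ennreal sum_nonneg)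
  also have "\<dots> \<le> (\<Sum>i\<in>(UNIV::'d set). \<Sum>j\<in>(UNIV::'d set). \<Sum>k\<in>(UNIV::'d set). \<Sum>l\<in>(UNIV::'d set). ennreal ca * ?S)"
    by (intro sum_mono I)
  also have "\<dots> = ennreal cj * ?S"
  proof -
    have "ennreal cj = ennreal dd ^ 4 * ennreal ca"
      using dd_pos ca_nonneg by (simp add: cj_def ennreal_mult ennreal_power)
    thus ?thesis by (simp add: dd_def ennreal_of_nat_eq_real_of_nat power4_eq_xxxx mult.assoc)
  qed
  finally show ?thesis .
qed

lemma AE_norm_path_le:
  "AE \<omega> in M. \<forall>t>0. ennreal (norm (Y t \<omega>)) \<le> ennreal (norm (Y 0 \<omega>))
    + ennreal cb * CI (\<lambda>s \<omega>. norm (Ym s \<omega>)) t \<omega> + ennreal cj * CS (\<lambda>s \<omega>. norm C + norm (Ym s \<omega>)) nsq t \<omega>"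
  using AE_path_eq
proof eventually_elim
  case (elim \<omega>)
  show ?case
  proof (intro allI impI)
    fix t :: real assume t: "0 < t"
    have "norm (Y t \<omega>) \<le> norm (Y 0 \<omega>) + norm (drift t \<omega>) + norm (jumps t \<omega>)"
      using elim t norm_triangle_ineq[of "Y 0 \<omega> + drift t \<omega>" "jumps t \<omega>"] norm_triangle_ineq[of "Y 0 \<omega>" "drift t \<omega>"] by simp
    hence "ennreal (norm (Y t \<omega>)) \<le> ennreal (norm (Y 0 \<omega>)) + ennreal (norm (drift t \<omega>)) + ennreal (norm (jumps t \<omega>))"
      by (simp add: ennreal_plus[symmetric] ennreal_leI del: ennreal_plus)
    also have "\<dots> \<le> ennreal (norm (Y 0 \<omega>)) + ennreal cb * CI (\<lambda>s \<omega>. norm (Ym s \<omega>)) t \<omega>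
        + ennreal cj * CS (\<lambda>s \<omega>. norm C + norm (Ym s \<omega>)) nsq t \<omega>"
      by (intro add_mono order_refl norm_drift_le[OF t] norm_jumps_le)
    finally show "ennreal (norm (Y t \<omega>)) \<le> ennreal (norm (Y 0 \<omega>))
        + ennreal cb * CI (\<lambda>s \<omega>. norm (Ym s \<omega>)) t \<omega> + ennreal cj * CS (\<lambda>s \<omega>. norm C + norm (Ym s \<omega>)) nsq t \<omega>" .
  qed
qed

lemma pair_lborel_M: "pair_sigma_finite lborel M"
  by (intro pair_sigma_finite.intro sigma_finite_lborel prob_space_imp_sigma_finite prob_space_axioms)

text \<open>Tonelli; joint measurability comes from the left limits, although \<open>U\<close> is
  measurable only at each fixed time.\<close>

lemma
  fixes U Um :: "real \<Rightarrow> 'a \<Rightarrow> real"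
  assumes t: "0 < t" and U: "\<And>s. 0 \<le> s \<Longrightarrow> U s \<in> borel_measurable M"
    and lim: "\<And>s \<omega>. 0 < s \<Longrightarrow> ((\<lambda>u. U u \<omega>) \<longlongrightarrow> Um s \<omega>) (at_left s)"
  shows nn_integral_CI: "(\<integral>\<^sup>+\<omega>. CI Um t \<omega> \<partial>M) = (\<integral>\<^sup>+s. indicator {0<..t} s * (\<integral>\<^sup>+\<omega>. ennreal (Um s \<omega>) \<partial>M) \<partial>lborel)"
    and Um_measurable: "\<And>s. 0 < s \<Longrightarrow> Um s \<in> borel_measurable M"
proof -
  interpret P: pair_sigma_finite lborel M by (rule pair_lborel_M)
  show Um: "Um s \<in> borel_measurable M" if s: "0 < s" for s
  proof (rule borel_measurable_LIMSEQ_real)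
    show "(\<lambda>n. U (grid 0 s n (cell 0 s n s)) \<omega>) \<longlonglongrightarrow> Um s \<omega>" for \<omega>
      by (rule grid_tendsto_left_lim[OF lim[OF s] s order_refl])
    show "U (grid 0 s n (cell 0 s n s)) \<in> borel_measurable M" for n
      using grid_mono[of 0 s 0 _ n] s by (intro U) (simp add: grid_0)
  qed
  have [measurable]: "(\<lambda>(s, \<omega>). indicator {0<..t} s *\<^sub>R Um s \<omega>) \<in> borel_measurable (lborel \<Otimes>\<^sub>M M)"
    by (rule left_limits_jointly_measurable[OF t U lim])
  have m: "(\<lambda>(s, \<omega>). ennreal (indicator {0<..t} s *\<^sub>R Um s \<omega>)) \<in> borel_measurable (lborel \<Otimes>\<^sub>M M)"
    by measurable
  have CI: "CI Um t \<omega> = (\<integral>\<^sup>+s. ennreal (indicator {0<..t} s *\<^sub>R Um s \<omega>) \<partial>lborel)" for \<omega>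
    unfolding nn_time_integral_def by (intro nn_integral_cong) (auto split: split_indicator)
  have "(\<integral>\<^sup>+\<omega>. CI Um t \<omega> \<partial>M) = (\<integral>\<^sup>+s. \<integral>\<^sup>+\<omega>. ennreal (indicator {0<..t} s *\<^sub>R Um s \<omega>) \<partial>M \<partial>lborel)"
    unfolding CI using P.Fubini'[OF m] .
  also have "\<dots> = (\<integral>\<^sup>+s. indicator {0<..t} s * (\<integral>\<^sup>+\<omega>. ennreal (Um s \<omega>) \<partial>M) \<partial>lborel)"
    by (intro nn_integral_cong) (auto split: split_indicator)
  finally show "(\<integral>\<^sup>+\<omega>. CI Um t \<omega> \<partial>M) = (\<integral>\<^sup>+s. indicator {0<..t} s * (\<integral>\<^sup>+\<omega>. ennreal (Um s \<omega>) \<partial>M) \<partial>lborel)" .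
qed

end

section \<open>Localisation and a moment bound uniform in the level\<close>

context mucogarch
begin

text \<open>Plays the role of a stopping time. \<open>Hi\<close> looks at the path up to and
  including \<open>u\<close> and is adapted; its left limit \<open>Hm\<close> looks strictly before
  \<open>s\<close>, so a large jump at \<open>s\<close> itself is ignored, while \<open>Ym s\<close>
  is still bounded by \<open>K\<close>.\<close>

definition Hi :: "real \<Rightarrow> real \<Rightarrow> 'a \<Rightarrow> real" where
  "Hi K u \<omega> = (if \<forall>v\<in>{0..u}. norm (Y v \<omega>) \<le> K then 1 else 0)"

definition Hm :: "real \<Rightarrow> real \<Rightarrow> 'a \<Rightarrow> real" where
  "Hm K s \<omega> = (if \<forall>v\<in>{0..<s}. norm (Y v \<omega>) \<le> K then 1 else 0)"

lemma Hm_cases: "Hm K s \<omega> = 0 \<or> Hm K s \<omega> = 1" and Hm_bounds: "0 \<le> Hm K s \<omega>" "Hm K s \<omega> \<le> 1"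
  by (simp_all add: Hm_def)

lemma Hm_antimono: "s \<le> t \<Longrightarrow> Hm K t \<omega> = 1 \<Longrightarrow> Hm K s \<omega> = 1"
  by (auto simp: Hm_def split: if_splits)

lemma norm_Ym_le_if_Hm:
  assumes "0 < s" "Hm K s \<omega> = 1" shows "norm (Ym s \<omega>) \<le> K"
proof -
  have "\<forall>v\<in>{0..<s}. norm (Y v \<omega>) \<le> K" using assms(2) by (simp add: Hm_def split: if_splits)
  hence "\<forall>\<^sub>F u in at_left s. norm (Y u \<omega>) \<le> K"
    unfolding eventually_at_left_field using assms(1) by (intro exI[of _ 0]) auto
  thus ?thesis by (rule tendsto_upperbound[OF tendsto_norm[OF tendsto_Ym[OF assms(1)]]]) simp
qed

text \<open>By right-continuity an excess over \<open>K\<close> before time \<open>u\<close> already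
  occurs at a rational time, so countably many times decide the event.\<close>

lemma Hi_measurable:
  assumes u: "0 \<le> u" shows "Hi K u \<in> borel_measurable (F u)"
proof -
  \<comment> \<open>The end point \<open>u\<close> is included separately: to its right the path is
    not part of the information at time \<open>u\<close>.\<close>
  define Q where "Q = insert u (\<rat> \<inter> {0..u})"
  have Q: "countable Q" unfolding Q_def by (intro countable_insert countable_Int1 countable_rat)
  have Q0: "0 \<le> v" "v \<le> u" if "v \<in> Q" for v using that u by (auto simp: Q_def)
  have eq: "(\<forall>v\<in>{0..u}. norm (Y v \<omega>) \<le> K) \<longleftrightarrow> (\<forall>v\<in>Q. norm (Y v \<omega>) \<le> K)" for \<omega>
  proof
    assume *: "\<forall>v\<in>Q. norm (Y v \<omega>) \<le> K"
    show "\<forall>v\<in>{0..u}. norm (Y v \<omega>) \<le> K"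
    proof (rule ballI, rule ccontr)
      fix v assume v: "v \<in> {0..u}" "\<not> norm (Y v \<omega>) \<le> K"
      have "v \<noteq> u" using * v by (auto simp: Q_def)
      hence "v < u" using v by simp
      have "((\<lambda>t. norm (Y t \<omega>)) \<longlongrightarrow> norm (Y v \<omega>)) (at_right v)"
        using cadlag_Y[of \<omega>] v by (intro tendsto_norm) (simp add: cadlag_def)
      hence "\<forall>\<^sub>F q in at_right v. K < norm (Y q \<omega>)" using v by (intro order_tendstoD) auto
      then obtain b where b: "v < b" "\<And>q. v < q \<Longrightarrow> q < b \<Longrightarrow> K < norm (Y q \<omega>)"
        unfolding eventually_at_right_field by blast
      obtain q where q: "q \<in> \<rat>" "v < q" "q < min b u"
        using Rats_dense_in_real[of v "min b u"] b(1) \<open>v < u\<close> by auto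
      have "q \<in> Q" using q v by (auto simp: Q_def)
      thus False using * b(2)[of q] q by force
    qed
  qed (use Q0 in auto)
  have range: "range (from_nat_into Q) = Q" using Q by (intro range_from_nat_into) (auto simp: Q_def)
  have [measurable]: "Y (from_nat_into Q n) \<in> borel_measurable (F u)" for n
    using measurable_F_mono[OF Q0 adapted_Y[OF Q0(1)]] range by blast
  have "Measurable.pred (F u) (\<lambda>\<omega>. \<forall>n. norm (Y (from_nat_into Q n) \<omega>) \<le> K)" by measurable
  moreover have "(\<forall>n. norm (Y (from_nat_into Q n) \<omega>) \<le> K) \<longleftrightarrow> (\<forall>v\<in>Q. norm (Y v \<omega>) \<le> K)" for \<omega>
    by (subst range[symmetric]) simp
  ultimately have [measurable]: "Measurable.pred (F u) (\<lambda>\<omega>. \<forall>v\<in>Q. norm (Y v \<omega>) \<le> K)" by simp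
  thus ?thesis unfolding Hi_def[abs_def] eq by measurable
qed

text \<open>The offset \<open>c\<close> serves both terms of the path inequality: 0 for the drift,
  \<open>norm C\<close> for the growth bound of the jumps.\<close>

definition cut :: "real \<Rightarrow> real \<Rightarrow> real \<Rightarrow> 'a \<Rightarrow> real" where
  "cut c K u \<omega> = Hi K u \<omega> * (c + norm (Y u \<omega>))"

definition cutm :: "real \<Rightarrow> real \<Rightarrow> real \<Rightarrow> 'a \<Rightarrow> real" where
  "cutm c K s \<omega> = Hm K s \<omega> * (c + norm (Ym s \<omega>))"

lemma cut_measurable: "0 \<le> u \<Longrightarrow> cut c K u \<in> borel_measurable (F u)"
  unfolding cut_def[abs_def] using Hi_measurable[of u K] adapted_Y[of u] by measurable

lemma cut_measurable_M: "0 \<le> u \<Longrightarrow> cut c K u \<in> borel_measurable M"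
  using measurable_F_imp_M[OF _ cut_measurable] .

text \<open>Left of \<open>s\<close> the indicator \<open>Hi\<close> is eventually constant: if the
  level is exceeded before \<open>s\<close>, it is 0 from then on, otherwise it is 1
  throughout.\<close>

lemma tendsto_cut:
  assumes s: "0 < s" shows "((\<lambda>u. cut c K u \<omega>) \<longlongrightarrow> cutm c K s \<omega>) (at_left s)"
proof -
  have "\<forall>\<^sub>F u in at_left s. Hi K u \<omega> = Hm K s \<omega>"
  proof (cases "\<forall>v\<in>{0..<s}. norm (Y v \<omega>) \<le> K")
    case True
    thus ?thesis unfolding eventually_at_left_field using s
      by (intro exI[of _ 0]) (auto simp: Hi_def Hm_def)
  next
    case False
    then obtain v where v: "0 \<le> v" "v < s" "\<not> norm (Y v \<omega>) \<le> K" by auto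
    have "Hi K u \<omega> = 0" if "v < u" for u
      using v that unfolding Hi_def by (auto intro!: bexI[of _ v])
    moreover have "Hm K s \<omega> = 0" using False unfolding Hm_def by simp
    ultimately show ?thesis unfolding eventually_at_left_field using v(2) by (intro exI[of _ v]) simp
  qed
  hence "((\<lambda>u. Hi K u \<omega>) \<longlongrightarrow> Hm K s \<omega>) (at_left s)" by (rule tendsto_eventually)
  thus ?thesis unfolding cut_def cutm_def by (intro tendsto_intros tendsto_Ym s)
qed

text \<open>If the level has not been exceeded before \<open>t\<close>, the same holds at all
  earlier times, so the indicators may be inserted under the integrals. The inequality is taken at
  times \<open>u < t\<close> and passed to the left limit, because only the state before the jump at
  \<open>t\<close> is controlled.\<close>

lemma AE_cutm_le:
  "AE \<omega> in M. \<forall>t>0. ennreal (cutm 0 K t \<omega>) \<le> ennreal (norm (Y 0 \<omega>))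
    + ennreal cb * CI (cutm 0 K) t \<omega> + ennreal cj * CS (cutm (norm C) K) nsq t \<omega>"
  using AE_norm_path_le
proof eventually_elim
  case (elim \<omega>)
  show ?case
  proof (intro allI impI)
    fix t :: real assume t: "0 < t"
    let ?R = "ennreal (norm (Y 0 \<omega>)) + ennreal cb * CI (cutm 0 K) t \<omega> + ennreal cj * CS (cutm (norm C) K) nsq t \<omega>"
    show "ennreal (cutm 0 K t \<omega>) \<le> ?R"
    proof (cases "Hm K t \<omega> = 1")
      case True
      have "ennreal (norm (Y u \<omega>)) \<le> ?R" if u: "0 < u" "u < t" for u
      proof -
        have Hs: "Hm K s \<omega> = 1" if "s \<le> u" for s using that u by (intro Hm_antimono[OF _ True]) simp
        have "CI (\<lambda>s \<omega>. norm (Ym s \<omega>)) u \<omega> \<le> CI (cutm 0 K) t \<omega>"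
          using u Hs by (intro nn_time_integral_mono) (auto simp: cutm_def)
        moreover have "CS (\<lambda>s \<omega>. norm C + norm (Ym s \<omega>)) nsq u \<omega> \<le> CS (cutm (norm C) K) nsq t \<omega>"
          using u Hs by (intro nn_jump_integral_mono) (auto simp: cutm_def)
        ultimately show ?thesis
          using elim[rule_format, OF u(1)] by (meson add_mono mult_left_mono order_refl order_trans zero_le)
      qed
      hence "\<forall>\<^sub>F u in at_left t. ennreal (norm (Y u \<omega>)) \<le> ?R"
        unfolding eventually_at_left_field using t by (intro exI[of _ 0]) auto
      hence "ennreal (norm (Ym t \<omega>)) \<le> ?R"
        by (rule tendsto_upperbound[OF tendsto_ennrealI[OF tendsto_norm[OF tendsto_Ym[OF t]]]]) simp
      thus ?thesis by (simp add: cutm_def True)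
    next
      case False
      hence "cutm 0 K t \<omega> = 0" using Hm_cases[of K t \<omega>] by (simp add: cutm_def)
      thus ?thesis by simp
    qed
  qed
qed

definition e0 :: real where "e0 = (\<integral>\<omega>. norm (Y 0 \<omega>) \<partial>M)"

lemma nn_integral_Y0: "(\<integral>\<^sup>+\<omega>. ennreal (norm (Y 0 \<omega>)) \<partial>M) = ennreal e0"
  unfolding e0_def using integrable_Y0 by (intro nn_integral_eq_integral) auto

lemma e0_nonneg: "0 \<le> e0" unfolding e0_def by (intro integral_nonneg_AE) auto

lemma cb_nonneg: "0 \<le> cb" and cj_nonneg: "0 \<le> cj"
  using ca_nonneg dd_pos by (simp_all add: cb_def cj_def)

lemma CI_const_add:
  assumes t: "0 < t" and h: "(\<lambda>s. indicator {0<..t} s *\<^sub>R h s) \<in> borel_measurable lborel"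
    and c: "0 \<le> c" and g: "\<And>s. 0 < s \<Longrightarrow> 0 \<le> h s \<and> g s \<le> c + h s"
  shows "nn_time_integral g t \<le> ennreal (c * t) + nn_time_integral h t"
proof -
  have "nn_time_integral g t \<le> (\<integral>\<^sup>+s. indicator {0<..t} s * ennreal c + ennreal (indicator {0<..t} s *\<^sub>R h s) \<partial>lborel)"
    unfolding nn_time_integral_def
  proof (rule nn_integral_mono)
    fix s
    show "indicator {0<..t} s * ennreal (g s) \<le> indicator {0<..t} s * ennreal c + ennreal (indicator {0<..t} s *\<^sub>R h s)"
      using g[of s] c by (cases "s \<in> {0<..t}") (simp_all add: ennreal_plus[symmetric] ennreal_leI del: ennreal_plus)
  qed
  also have "\<dots> = (\<integral>\<^sup>+s. indicator {0<..t} s * ennreal c \<partial>lborel) + (\<integral>\<^sup>+s. ennreal (indicator {0<..t} s *\<^sub>R h s) \<partial>lborel)"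
    by (rule nn_integral_add[OF _ measurable_compose[OF h measurable_ennreal]]) simp
  also have "(\<integral>\<^sup>+s. indicator {0<..t} s * ennreal c \<partial>lborel) = ennreal (c * t)"
    using t c by (subst nn_integral_multc) (simp_all add: ennreal_mult mult.commute)
  also have "(\<integral>\<^sup>+s. ennreal (indicator {0<..t} s *\<^sub>R h s) \<partial>lborel) = nn_time_integral h t"
    unfolding nn_time_integral_def by (intro nn_integral_cong) (auto split: split_indicator)
  finally show ?thesis .
qed

lemma CS_nsq:
  assumes t: "0 < t" and U: "\<And>s. 0 \<le> s \<Longrightarrow> U s \<in> borel_measurable (F s)"
    and lim: "\<And>s \<omega>. 0 < s \<Longrightarrow> ((\<lambda>u. U u \<omega>) \<longlongrightarrow> Um s \<omega>) (at_left s)"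
  shows "CS Um nsq t \<in> borel_measurable M" "CI Um t \<in> borel_measurable M"
    "(\<integral>\<^sup>+\<omega>. CS Um nsq t \<omega> \<partial>M) = ennreal R * (\<integral>\<^sup>+\<omega>. CI Um t \<omega> \<partial>M)"
proof -
  have "(\<integral>\<^sup>+x. ennreal (nsq x) \<partial>\<nu>) < \<infinity>" by (simp add: nn_integral_nsq)
  note * = compensation_nonneg[OF t U lim nsq this, unfolded nn_integral_nsq]
  show "CS Um nsq t \<in> borel_measurable M" "CI Um t \<in> borel_measurable M"
    "(\<integral>\<^sup>+\<omega>. CS Um nsq t \<omega> \<partial>M) = ennreal R * (\<integral>\<^sup>+\<omega>. CI Um t \<omega> \<partial>M)"
    by (rule *; assumption)+
qed

definition \<psi> :: "real \<Rightarrow> real \<Rightarrow> ennreal" where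
  "\<psi> K t = (\<integral>\<^sup>+\<omega>. ennreal (cutm 0 K t \<omega>) \<partial>M)"

text \<open>\<open>\<alpha> T\<close> collects the initial mean and the contribution of
  \<open>C\<close> up to time \<open>T\<close>; \<open>\<gamma>\<close> is the rate. The summand 1
  makes \<open>\<gamma>\<close> strictly positive even if \<open>A\<close> and \<open>B\<close>
  vanish, as \<open>gronwall_nn\<close> requires.\<close>

definition \<alpha> :: "real \<Rightarrow> real" where "\<alpha> T = e0 + cj * R * norm C * T"
definition \<gamma> :: real where "\<gamma> = cb + cj * R + 1"

lemma \<alpha>_nonneg: "0 \<le> T \<Longrightarrow> 0 \<le> \<alpha> T" and \<gamma>_pos: "0 < \<gamma>"
  using e0_nonneg cj_nonneg cb_nonneg R_nonneg by (simp_all add: \<alpha>_def \<gamma>_def add_nonneg_pos)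

lemma linear_bound:
  fixes x :: ennreal
  assumes "0 \<le> t" "t \<le> T"
  shows "ennreal e0 + ennreal cb * x + ennreal cj * (ennreal R * (ennreal (norm C * t) + x)) \<le> ennreal (\<alpha> T) + ennreal \<gamma> * x"
proof -
  have "ennreal e0 + ennreal cb * x + ennreal cj * (ennreal R * (ennreal (norm C * t) + x)) =
      (ennreal e0 + ennreal (cj * R * norm C * t)) + (ennreal cb + ennreal (cj * R)) * x"
    using cj_nonneg R_nonneg assms(1) by (simp add: ennreal_mult distrib_left distrib_right mult_ac add_ac)
  also have "\<dots> = ennreal (e0 + cj * R * norm C * t) + ennreal (cb + cj * R) * x"
    using cj_nonneg R_nonneg assms(1) e0_nonneg cb_nonneg by simp
  also have "\<dots> \<le> ennreal (\<alpha> T) + ennreal \<gamma> * x"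
  proof (intro add_mono mult_right_mono ennreal_leI)
    show "e0 + cj * R * norm C * t \<le> \<alpha> T"
      unfolding \<alpha>_def using assms(2) cj_nonneg R_nonneg by (intro add_left_mono mult_left_mono) auto
  qed (simp_all add: \<gamma>_def)
  finally show ?thesis .
qed

text \<open>The level \<open>K\<close> is the a priori bound that Gronwall asks for, yet it does not
  occur in the result; therefore \<open>K\<close> can be sent to infinity afterwards. The
  compensation formula turns the jump term into a time integral of the same kind as the
  drift.\<close>

lemma \<psi>_le_bound:
  assumes t: "0 < t" "t \<le> T" shows "\<psi> K t \<le> ennreal (2 * \<alpha> T * exp (2 * \<gamma> * T))"
proof (rule gronwall_nn[OF \<gamma>_pos \<alpha>_nonneg _ _ t])
  show "0 \<le> T" using t by simp
  show "\<psi> K s \<le> ennreal K" if s: "0 < s" "s \<le> T" for s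
  proof -
    have "ennreal (cutm 0 K s \<omega>) \<le> ennreal K" for \<omega>
    proof (cases "Hm K s \<omega> = 1")
      case True
      thus ?thesis using norm_Ym_le_if_Hm[OF s(1) True] by (simp add: cutm_def ennreal_leI)
    next
      case False
      hence "cutm 0 K s \<omega> = 0" using Hm_cases[of K s \<omega>] by (simp add: cutm_def)
      thus ?thesis by simp
    qed
    hence "\<psi> K s \<le> (\<integral>\<^sup>+\<omega>. ennreal K \<partial>M)" unfolding \<psi>_def by (intro nn_integral_mono)
    thus ?thesis by (simp add: emeasure_space_1)
  qed
  show "\<psi> K t \<le> ennreal (\<alpha> T) + ennreal \<gamma> * (\<integral>\<^sup>+s. indicator {0<..t} s * \<psi> K s \<partial>lborel)"
    if t: "0 < t" "t \<le> T" for t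
  proof -
    have Y0[measurable]: "Y 0 \<in> borel_measurable M" using integrable_Y0 by simp
    note m0 = CS_nsq[OF t(1) cut_measurable tendsto_cut, of 0 K]
    note mC = CS_nsq[OF t(1) cut_measurable tendsto_cut, of "norm C" K]
    have CI0: "(\<integral>\<^sup>+\<omega>. CI (cutm 0 K) t \<omega> \<partial>M) = (\<integral>\<^sup>+s. indicator {0<..t} s * \<psi> K s \<partial>lborel)"
      unfolding \<psi>_def by (rule nn_integral_CI[OF t(1) cut_measurable_M tendsto_cut])
    have "CI (cutm (norm C) K) t \<omega> \<le> ennreal (norm C * t) + CI (cutm 0 K) t \<omega>" for \<omega>
    proof (rule CI_const_add[OF t(1) left_limits_path_measurable[OF t(1) tendsto_cut]])
      fix s :: real assume "0 < s"
      show "0 \<le> cutm 0 K s \<omega> \<and> cutm (norm C) K s \<omega> \<le> norm C + cutm 0 K s \<omega>"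
        using Hm_bounds[of K s \<omega>] by (simp add: cutm_def distrib_left mult_left_le_one_le)
    qed simp_all
    hence "(\<integral>\<^sup>+\<omega>. CI (cutm (norm C) K) t \<omega> \<partial>M) \<le> (\<integral>\<^sup>+\<omega>. ennreal (norm C * t) + CI (cutm 0 K) t \<omega> \<partial>M)"
      by (intro nn_integral_mono)
    also have "\<dots> = ennreal (norm C * t) + (\<integral>\<^sup>+\<omega>. CI (cutm 0 K) t \<omega> \<partial>M)"
      using m0(2) by (subst nn_integral_add) (simp_all add: emeasure_space_1)
    finally have CIC: "(\<integral>\<^sup>+\<omega>. CI (cutm (norm C) K) t \<omega> \<partial>M) \<le> ennreal (norm C * t) + (\<integral>\<^sup>+\<omega>. CI (cutm 0 K) t \<omega> \<partial>M)" .
    have "\<psi> K t \<le> (\<integral>\<^sup>+\<omega>. ennreal (norm (Y 0 \<omega>))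
        + ennreal cb * CI (cutm 0 K) t \<omega> + ennreal cj * CS (cutm (norm C) K) nsq t \<omega> \<partial>M)"
      unfolding \<psi>_def using AE_cutm_le[of K] t(1) by (intro nn_integral_mono_AE) (auto elim!: eventually_mono)
    also have "\<dots> = ennreal e0 + ennreal cb * (\<integral>\<^sup>+\<omega>. CI (cutm 0 K) t \<omega> \<partial>M)
        + ennreal cj * (ennreal R * (\<integral>\<^sup>+\<omega>. CI (cutm (norm C) K) t \<omega> \<partial>M))"
      using m0(2) mC(1,2) by (simp add: nn_integral_add nn_integral_cmult nn_integral_Y0 mC(3))
    also have "\<dots> \<le> ennreal e0 + ennreal cb * (\<integral>\<^sup>+\<omega>. CI (cutm 0 K) t \<omega> \<partial>M)
        + ennreal cj * (ennreal R * (ennreal (norm C * t) + (\<integral>\<^sup>+\<omega>. CI (cutm 0 K) t \<omega> \<partial>M)))"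
      by (intro add_mono mult_left_mono CIC order_refl) auto
    also have "\<dots> \<le> ennreal (\<alpha> T) + ennreal \<gamma> * (\<integral>\<^sup>+\<omega>. CI (cutm 0 K) t \<omega> \<partial>M)"
      using t by (intro linear_bound) auto
    finally show ?thesis unfolding CI0 .
  qed
qed

text \<open>Every path is bounded on \<open>{0..t}\<close>, so the localising indicators increase to
  1 with the level and monotone convergence removes them.\<close>

lemma nn_integral_Ym_le:
  assumes t: "0 < t" "t \<le> T"
  shows "(\<integral>\<^sup>+\<omega>. ennreal (norm (Ym t \<omega>)) \<partial>M) \<le> ennreal (2 * \<alpha> T * exp (2 * \<gamma> * T))"
proof (rule LIMSEQ_le_const2)
  show "(\<lambda>n. \<psi> (real n) t) \<longlonglongrightarrow> (\<integral>\<^sup>+\<omega>. ennreal (norm (Ym t \<omega>)) \<partial>M)"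
    unfolding \<psi>_def
  proof (rule nn_integral_LIMSEQ)
    show "incseq (\<lambda>n \<omega>. ennreal (cutm 0 (real n) t \<omega>))"
      unfolding incseq_def le_fun_def
    proof (intro allI impI ennreal_leI)
      fix m n :: nat and \<omega> assume "m \<le> n"
      hence "Hm (real m) t \<omega> \<le> Hm (real n) t \<omega>" by (auto simp: Hm_def intro: order_trans)
      thus "cutm 0 (real m) t \<omega> \<le> cutm 0 (real n) t \<omega>" by (simp add: cutm_def mult_right_mono)
    qed
    show "(\<lambda>\<omega>. ennreal (cutm 0 (real n) t \<omega>)) \<in> borel_measurable M" for n
      using Um_measurable[OF t(1) cut_measurable_M tendsto_cut t(1), of 0 "real n"] by measurable
    show "(\<lambda>n. ennreal (cutm 0 (real n) t \<omega>)) \<longlonglongrightarrow> ennreal (norm (Ym t \<omega>))" for \<omega>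
    proof (rule tendsto_eventually)
      obtain K where K: "\<forall>s\<in>{0..t}. norm (Y s \<omega>) \<le> K \<and> norm (Ym s \<omega>) \<le> K" using Ym_bounded[of t \<omega>] t by force
      show "\<forall>\<^sub>F n in sequentially. ennreal (cutm 0 (real n) t \<omega>) = ennreal (norm (Ym t \<omega>))"
        using eventually_ge_at_top[of "nat \<lceil>K\<rceil>"]
      proof eventually_elim
        case (elim n)
        hence "K \<le> real n" by linarith
        hence "\<forall>v\<in>{0..<t}. norm (Y v \<omega>) \<le> real n" using K by (auto intro: order_trans)
        hence "Hm (real n) t \<omega> = 1" unfolding Hm_def by simp
        thus ?case by (simp add: cutm_def)
      qed
    qed
  qed
qed (use \<psi>_le_bound[OF t] in auto)

end

section \<open>Integrability and expectations\<close>

context mucogarch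
begin

lemma Y_measurable_M [measurable]: "0 \<le> t \<Longrightarrow> Y t \<in> borel_measurable M"
  using measurable_F_imp_M[OF _ adapted_Y] .

lemma norm_Y_adapted: "0 \<le> s \<Longrightarrow> (\<lambda>\<omega>. c + norm (Y s \<omega>)) \<in> borel_measurable (F s)"
  using adapted_Y[of s] by measurable

lemma norm_Y_measurable_M: "0 \<le> s \<Longrightarrow> (\<lambda>\<omega>. c + norm (Y s \<omega>)) \<in> borel_measurable M"
  using measurable_F_imp_M[OF _ norm_Y_adapted] .

lemma tendsto_norm_Y: "0 < s \<Longrightarrow> ((\<lambda>u. c + norm (Y u \<omega>)) \<longlongrightarrow> c + norm (Ym s \<omega>)) (at_left s)"
  by (intro tendsto_intros tendsto_Ym)

lemma nn_integral_CI_norm: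
  assumes t: "0 < t" and c: "0 \<le> c"
  shows "(\<integral>\<^sup>+\<omega>. CI (\<lambda>s \<omega>. c + norm (Ym s \<omega>)) t \<omega> \<partial>M) < \<infinity>"
proof -
  have "(\<integral>\<^sup>+\<omega>. CI (\<lambda>s \<omega>. c + norm (Ym s \<omega>)) t \<omega> \<partial>M) =
      (\<integral>\<^sup>+s. indicator {0<..t} s * (\<integral>\<^sup>+\<omega>. ennreal (c + norm (Ym s \<omega>)) \<partial>M) \<partial>lborel)"
    by (rule nn_integral_CI[OF t norm_Y_measurable_M tendsto_norm_Y])
  also have "\<dots> \<le> (\<integral>\<^sup>+s. indicator {0<..t} s * (ennreal c + ennreal (2 * \<alpha> t * exp (2 * \<gamma> * t))) \<partial>lborel)"
  proof (rule nn_integral_mono)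
    fix s
    show "indicator {0<..t} s * (\<integral>\<^sup>+\<omega>. ennreal (c + norm (Ym s \<omega>)) \<partial>M) \<le>
        indicator {0<..t} s * (ennreal c + ennreal (2 * \<alpha> t * exp (2 * \<gamma> * t)))"
    proof (cases "s \<in> {0<..t}")
      case True
      hence s: "0 < s" "s \<le> t" by auto
      have "(\<lambda>\<omega>. 0 + norm (Ym s \<omega>)) \<in> borel_measurable M"
        by (rule Um_measurable[OF t norm_Y_measurable_M tendsto_norm_Y s(1)])
      hence "(\<integral>\<^sup>+\<omega>. ennreal (c + norm (Ym s \<omega>)) \<partial>M) = ennreal c + (\<integral>\<^sup>+\<omega>. ennreal (norm (Ym s \<omega>)) \<partial>M)"
        using c by (simp add: nn_integral_add emeasure_space_1)
      thus ?thesis using nn_integral_Ym_le[OF s] by (simp add: add_left_mono mult_left_mono)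
    qed simp
  qed
  also have "\<dots> = (ennreal c + ennreal (2 * \<alpha> t * exp (2 * \<gamma> * t))) * ennreal t"
    using t by (subst nn_integral_multc) (simp_all add: mult.commute)
  also have "\<dots> < \<infinity>" by (simp add: ennreal_mult_less_top)
  finally show ?thesis .
qed

text \<open>The right-hand side of the path inequality at time \<open>T\<close>. It increases in
  time, so it dominates the whole path on \<open>{0..T}\<close> by one integrable variable, as
  dominated convergence needs. The summand \<open>0 +\<close> fits the general offset of
  \<open>norm_Y_adapted\<close>.\<close>

definition D :: "real \<Rightarrow> 'a \<Rightarrow> ennreal" where
  "D T \<omega> = ennreal (norm (Y 0 \<omega>)) + ennreal cb * CI (\<lambda>s \<omega>. 0 + norm (Ym s \<omega>)) T \<omega>
     + ennreal cj * CS (\<lambda>s \<omega>. norm C + norm (Ym s \<omega>)) nsq T \<omega>"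

lemma D_finite:
  assumes T: "0 < T" shows "D T \<in> borel_measurable M" "(\<integral>\<^sup>+\<omega>. D T \<omega> \<partial>M) < \<infinity>"
proof -
  note m0 = CS_nsq[OF T norm_Y_adapted tendsto_norm_Y, of 0]
  note mC = CS_nsq[OF T norm_Y_adapted tendsto_norm_Y, of "norm C"]
  have [measurable]: "Y 0 \<in> borel_measurable M" by simp
  note [measurable] = m0(2) mC(1)
  show "D T \<in> borel_measurable M" unfolding D_def[abs_def] by measurable
  have "(\<integral>\<^sup>+\<omega>. D T \<omega> \<partial>M) = ennreal e0 + ennreal cb * (\<integral>\<^sup>+\<omega>. CI (\<lambda>s \<omega>. 0 + norm (Ym s \<omega>)) T \<omega> \<partial>M)
     + ennreal cj * (ennreal R * (\<integral>\<^sup>+\<omega>. CI (\<lambda>s \<omega>. norm C + norm (Ym s \<omega>)) T \<omega> \<partial>M))"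
    using m0(2) mC(1,2) by (simp add: D_def nn_integral_add nn_integral_cmult nn_integral_Y0 mC(3))
  also have "\<dots> < \<infinity>"
    using nn_integral_CI_norm[OF T order_refl] nn_integral_CI_norm[OF T norm_ge_zero, of C]
    by (simp add: ennreal_mult_less_top)
  finally show "(\<integral>\<^sup>+\<omega>. D T \<omega> \<partial>M) < \<infinity>" .
qed

lemma AE_norm_Y_le_D:
  assumes T: "0 < T" shows "AE \<omega> in M. \<forall>t\<in>{0..T}. norm (Y t \<omega>) \<le> enn2real (D T \<omega>)"
  using AE_norm_path_le integrable_enn2real(3)[OF D_finite[OF T]]
proof eventually_elim
  case (elim \<omega>)
  show ?case
  proof
    fix t assume t: "t \<in> {0..T}"
    have "ennreal (norm (Y t \<omega>)) \<le> D T \<omega>"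
    proof (cases "t = 0")
      case True
      have "ennreal (norm (Y 0 \<omega>)) \<le> D T \<omega>" unfolding D_def add.assoc by (rule add_increasing2) simp_all
      thus ?thesis using True by simp
    next
      case False
      hence "0 < t" "t \<le> T" using t by auto
      have "ennreal (norm (Y t \<omega>)) \<le> ennreal (norm (Y 0 \<omega>))
        + ennreal cb * CI (\<lambda>s \<omega>. norm (Ym s \<omega>)) t \<omega> + ennreal cj * CS (\<lambda>s \<omega>. norm C + norm (Ym s \<omega>)) nsq t \<omega>"
        using elim(1) \<open>0 < t\<close> by blast
      also have "\<dots> \<le> D T \<omega>" unfolding D_def using \<open>t \<le> T\<close>
        by (intro add_mono mult_left_mono nn_time_integral_mono nn_jump_integral_mono order_refl) auto
      finally show ?thesis .
    qed
    hence "enn2real (ennreal (norm (Y t \<omega>))) \<le> enn2real (D T \<omega>)"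
      using elim(2) by (intro enn2real_mono) auto
    thus "norm (Y t \<omega>) \<le> enn2real (D T \<omega>)" by simp
  qed
qed

lemma integrable_Y:
  assumes "0 \<le> t" shows "integrable M (Y t)"
proof -
  \<comment> \<open>The majorant is available for positive horizons only, while \<open>t\<close> may
    be 0.\<close>
  have T: "0 < t + 1" using assms by simp
  show ?thesis
  proof (rule Bochner_Integration.integrable_bound[OF integrable_enn2real(1)[OF D_finite[OF T]]])
    show "AE \<omega> in M. norm (Y t \<omega>) \<le> norm (enn2real (D (t + 1) \<omega>))"
      using AE_norm_Y_le_D[OF T] by eventually_elim (use assms in auto)
  qed (use assms in simp)
qed

text \<open>Means of the process and of its left limits. The path equation involves the latter;
  their equality is shown only after \<open>m\<close> is known to be continuous.\<close>

definition m :: "real \<Rightarrow> real^'d^'d" where "m t = (\<integral>\<omega>. Y t \<omega> \<partial>M)"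
definition Q :: "real \<Rightarrow> real^'d^'d" where "Q t = (\<integral>\<omega>. Ym t \<omega> \<partial>M)"

lemma Ym_measurable: "0 < s \<Longrightarrow> Ym s \<in> borel_measurable M"
proof (rule borel_measurable_LIMSEQ_metric)
  assume s: "0 < s"
  show "(\<lambda>n. Y (grid 0 s n (cell 0 s n s)) \<omega>) \<longlonglongrightarrow> Ym s \<omega>" for \<omega>
    by (rule grid_tendsto_left_lim[OF tendsto_Ym[OF s] s order_refl])
  show "Y (grid 0 s n (cell 0 s n s)) \<in> borel_measurable M" for n
    using grid_mono[of 0 s 0 _ n] s by (intro Y_measurable_M) (simp add: grid_0)
qed

lemma m_tendsto_Q:
  assumes s: "0 < s" shows "(\<lambda>n. m (grid 0 s n (cell 0 s n s))) \<longlonglongrightarrow> Q s"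
proof -
  have "(\<lambda>n. m (grid 0 s (Suc n) (cell 0 s (Suc n) s))) \<longlonglongrightarrow> Q s"
    unfolding m_def Q_def
  proof (rule integral_dominated_convergence)
    have g: "0 \<le> grid 0 s (Suc n) (cell 0 s (Suc n) s)" "grid 0 s (Suc n) (cell 0 s (Suc n) s) \<le> s" for n
      using grid_mono[of 0 s 0 _ "Suc n"] cell_bounds(2)[OF s order_refl, of "Suc n"] s by (simp_all add: grid_0)
    show "Y (grid 0 s (Suc n) (cell 0 s (Suc n) s)) \<in> borel_measurable M" for n
      using g by simp
    show "integrable M (\<lambda>\<omega>. enn2real (D s \<omega>))" by (rule integrable_enn2real(1)[OF D_finite[OF s]])
    show "AE \<omega> in M. norm (Y (grid 0 s (Suc n) (cell 0 s (Suc n) s)) \<omega>) \<le> enn2real (D s \<omega>)" for n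
      using AE_norm_Y_le_D[OF s] by eventually_elim (use g in auto)
    show "AE \<omega> in M. (\<lambda>n. Y (grid 0 s (Suc n) (cell 0 s (Suc n) s)) \<omega>) \<longlonglongrightarrow> Ym s \<omega>"
      by (intro AE_I2 LIMSEQ_Suc[of "\<lambda>n. Y (grid 0 s n (cell 0 s n s)) _"] grid_tendsto_left_lim[OF tendsto_Ym[OF s] s order_refl])
  qed (rule Ym_measurable[OF s])
  thus ?thesis by (rule LIMSEQ_imp_Suc)
qed

lemma integrable_product:
  assumes t: "0 < t" shows "integrable (lborel \<Otimes>\<^sub>M M) (\<lambda>(s, \<omega>). indicator {0<..t} s *\<^sub>R Ym s \<omega>)"
proof (rule integrableI_bounded)
  show meas: "(\<lambda>(s, \<omega>). indicator {0<..t} s *\<^sub>R Ym s \<omega>) \<in> borel_measurable (lborel \<Otimes>\<^sub>M M)"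
    by (rule left_limits_jointly_measurable[OF t Y_measurable_M tendsto_Ym])
  have "(\<integral>\<^sup>+p. ennreal (norm (case p of (s, \<omega>) \<Rightarrow> indicator {0<..t} s *\<^sub>R Ym s \<omega>)) \<partial>(lborel \<Otimes>\<^sub>M M)) =
      (\<integral>\<^sup>+s. \<integral>\<^sup>+\<omega>. ennreal (norm (indicator {0<..t} s *\<^sub>R Ym s \<omega>)) \<partial>M \<partial>lborel)"
    using meas by (subst nn_integral_fst[symmetric]) auto
  also have "\<dots> = (\<integral>\<^sup>+s. indicator {0<..t} s * (\<integral>\<^sup>+\<omega>. ennreal (0 + norm (Ym s \<omega>)) \<partial>M) \<partial>lborel)"
    by (intro nn_integral_cong) (auto split: split_indicator)
  also have "\<dots> = (\<integral>\<^sup>+\<omega>. CI (\<lambda>s \<omega>. 0 + norm (Ym s \<omega>)) t \<omega> \<partial>M)"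
    by (rule nn_integral_CI[OF t norm_Y_measurable_M tendsto_norm_Y, symmetric])
  also have "\<dots> < \<infinity>" by (rule nn_integral_CI_norm[OF t order_refl])
  finally show "(\<integral>\<^sup>+p. ennreal (norm (case p of (s, \<omega>) \<Rightarrow> indicator {0<..t} s *\<^sub>R Ym s \<omega>)) \<partial>(lborel \<Otimes>\<^sub>M M)) < \<infinity>" .
qed

lemma
  assumes t: "0 < t"
  shows integrable_W: "integrable M (W t)"
    and set_integrable_Q: "set_integrable lborel {0<..t} Q"
    and integral_W: "(\<integral>\<omega>. W t \<omega> \<partial>M) = (LINT s:{0<..t}|lborel. Q s)"
proof -
  interpret P: pair_sigma_finite lborel M by (rule pair_lborel_M)
  have W: "W t \<omega> = (\<integral>s. indicator {0<..t} s *\<^sub>R Ym s \<omega> \<partial>lborel)" for \<omega>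
    by (simp add: W_def set_lebesgue_integral_def)
  show "integrable M (W t)" unfolding W[abs_def] by (rule P.integrable_snd[OF integrable_product[OF t]])
  show "set_integrable lborel {0<..t} Q"
    using P.integrable_fst'[OF integrable_product[OF t]] by (simp add: set_integrable_def Q_def)
  show "(\<integral>\<omega>. W t \<omega> \<partial>M) = (LINT s:{0<..t}|lborel. Q s)"
    unfolding W using P.Fubini_integral[OF integrable_product[OF t]]
    by (simp add: set_lebesgue_integral_def Q_def)
qed

text \<open>Linear growth of the coefficient, together with the finite mean of the time integral of
  \<open>norm C + norm (Ym s \<omega>)\<close>, gives the absolute integrability that
  \<open>compensation\<close> asks for.\<close>

lemma compensated_coefm:
  assumes t: "0 < t" shows "compensated M \<nu> L (coefm i j k l) (\<lambda>x. x $ k * x $ l) t"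
proof (rule compensation[OF t coef_measurable tendsto_coef])
  show "continuous_on UNIV (\<lambda>x :: real^'d. x $ k * x $ l)" by (intro continuous_intros)
  show "integrable \<nu> (\<lambda>x. x $ k * x $ l)" by (rule integrable_products)
  have "CI (\<lambda>s \<omega>. \<bar>coefm i j k l s \<omega>\<bar>) t \<omega> \<le> ennreal ca * CI (\<lambda>s \<omega>. norm C + norm (Ym s \<omega>)) t \<omega>" for \<omega>
  proof -
    have [measurable]: "(\<lambda>s. indicator {0<..t} s *\<^sub>R (norm C + norm (Ym s \<omega>))) \<in> borel_measurable lborel"
      by (rule left_limits_path_measurable[OF t tendsto_norm_Y])
    have "CI (\<lambda>s \<omega>. \<bar>coefm i j k l s \<omega>\<bar>) t \<omega> \<le>
        (\<integral>\<^sup>+s. ennreal ca * ennreal (indicator {0<..t} s *\<^sub>R (norm C + norm (Ym s \<omega>))) \<partial>lborel)"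
      unfolding nn_time_integral_def
    proof (rule nn_integral_mono)
      fix s
      show "indicator {0<..t} s * ennreal \<bar>coefm i j k l s \<omega>\<bar> \<le> ennreal ca * ennreal (indicator {0<..t} s *\<^sub>R (norm C + norm (Ym s \<omega>)))"
        using abs_coefm_le[of s i j k l \<omega>] ca_nonneg
        by (cases "s \<in> {0<..t}") (simp_all add: ennreal_mult[symmetric] ennreal_leI del: ennreal_plus)
    qed
    also have "\<dots> = ennreal ca * (\<integral>\<^sup>+s. ennreal (indicator {0<..t} s *\<^sub>R (norm C + norm (Ym s \<omega>))) \<partial>lborel)"
      by (rule nn_integral_cmult) (rule measurable_compose[OF left_limits_path_measurable[OF t tendsto_norm_Y] measurable_ennreal])
    also have "(\<integral>\<^sup>+s. ennreal (indicator {0<..t} s *\<^sub>R (norm C + norm (Ym s \<omega>))) \<partial>lborel) = CI (\<lambda>s \<omega>. norm C + norm (Ym s \<omega>)) t \<omega>"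
      unfolding nn_time_integral_def by (intro nn_integral_cong) (auto split: split_indicator)
    finally show ?thesis .
  qed
  hence "(\<integral>\<^sup>+\<omega>. CI (\<lambda>s \<omega>. \<bar>coefm i j k l s \<omega>\<bar>) t \<omega> \<partial>M) \<le> (\<integral>\<^sup>+\<omega>. ennreal ca * CI (\<lambda>s \<omega>. norm C + norm (Ym s \<omega>)) t \<omega> \<partial>M)"
    by (intro nn_integral_mono)
  also have "\<dots> = ennreal ca * (\<integral>\<^sup>+\<omega>. CI (\<lambda>s \<omega>. norm C + norm (Ym s \<omega>)) t \<omega> \<partial>M)"
    by (rule nn_integral_cmult[OF CS_nsq(2)[OF t norm_Y_adapted tendsto_norm_Y]])
  also have "\<dots> < \<infinity>" using nn_integral_CI_norm[OF t norm_ge_zero, of C] by (simp add: ennreal_mult_less_top)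
  finally show "(\<integral>\<^sup>+\<omega>. CI (\<lambda>s \<omega>. \<bar>coefm i j k l s \<omega>\<bar>) t \<omega> \<partial>M) < \<infinity>" .
qed simp_all

lemma bounded_linear_congruence: "bounded_linear (\<lambda>X :: real^'d^'d. A ** X ** transpose A)"
  by (intro bounded_linear_compose[OF bounded_bilinear.bounded_linear_left[OF bounded_bilinear_matrix_mult]
        bounded_bilinear.bounded_linear_right[OF bounded_bilinear_matrix_mult]])

lemma bounded_linear_nth_nth: "bounded_linear (\<lambda>Z :: real^'d^'d. Z $ i $ j)"
  by (intro bounded_linear_compose[OF bounded_linear_vec_nth bounded_linear_vec_nth])

text \<open>A single coefficient is not linear in \<open>Ym\<close>, but the diagonal sum is, so the
  congruence by \<open>A\<close> moves outside the time integral. The exceptional null set comes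
  from the integrability of the single coefficients.\<close>

lemma AE_sum_coefm_integral:
  assumes t: "0 < t"
  shows "AE \<omega> in M. (\<Sum>k\<in>UNIV. LINT s:{0<..t}|lborel. coefm i j k k s \<omega>) =
    (A ** (t *\<^sub>R C + W t \<omega>) ** transpose A) $ i $ j"
proof -
  have "AE \<omega> in M. \<forall>k. set_integrable lborel {0<..t} (\<lambda>s. coefm i j k k s \<omega>)"
    using compensated_coefm[OF t] by (simp add: AE_all_countable compensated_def)
  thus ?thesis
  proof eventually_elim
    case (elim \<omega>)
    let ?T = "\<lambda>X :: real^'d^'d. (A ** X ** transpose A) $ i $ j"
    have lin: "bounded_linear ?T" by (rule bounded_linear_compose[OF bounded_linear_nth_nth bounded_linear_congruence])
    have intT: "set_integrable lborel {0<..t} (\<lambda>s. ?T (Ym s \<omega>))"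
      using integrable_bounded_linear[OF lin, of lborel "\<lambda>s. indicator {0<..t} s *\<^sub>R Ym s \<omega>"] set_integrable_Ym[OF t, of \<omega>]
      by (simp add: set_integrable_def linear_cmul[OF bounded_linear.linear[OF lin]])
    have intC: "set_integrable lborel {0<..t} (\<lambda>s. ?T C)"
      unfolding set_integrable_def using t by (intro integrable_scaleR_left integrable_real_indicator) auto
    have "(\<Sum>k\<in>UNIV. LINT s:{0<..t}|lborel. coefm i j k k s \<omega>) = (LINT s:{0<..t}|lborel. \<Sum>k\<in>UNIV. coefm i j k k s \<omega>)"
      unfolding set_lebesgue_integral_def scaleR_sum_right using elim
      by (intro Bochner_Integration.integral_sum[symmetric]) (simp add: set_integrable_def)
    also have "\<dots> = (LINT s:{0<..t}|lborel. ?T C + ?T (Ym s \<omega>))"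
    proof (intro set_lebesgue_integral_cong allI impI)
      fix s assume "s \<in> {0<..t}"
      hence "(\<Sum>k\<in>UNIV. coefm i j k k s \<omega>) = ?T (C + Ym s \<omega>)" by (intro sum_coefm_diagonal) simp
      thus "(\<Sum>k\<in>UNIV. coefm i j k k s \<omega>) = ?T C + ?T (Ym s \<omega>)" by (simp add: linear_add[OF bounded_linear.linear[OF lin]])
    qed simp
    also have "\<dots> = t * ?T C + ?T (W t \<omega>)"
      unfolding set_integral_add(2)[OF intC intT] set_integral_bounded_linear_Ym[OF t lin]
      using t by (simp add: set_lebesgue_integral_def)
    also have "\<dots> = ?T (t *\<^sub>R C + W t \<omega>)"
      by (simp only: linear_add[OF bounded_linear.linear[OF lin]] linear_cmul[OF bounded_linear.linear[OF lin]] real_scaleR_def)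
    finally show ?case .
  qed
qed

text \<open>The isotropy of \<nu> acts here: mixed second moments vanish, and all diagonal ones
  equal \<open>\<sigma>\<close>.\<close>

lemma integral_jumps_nth:
  assumes t: "0 < t"
  shows "(\<integral>\<omega>. jumps t \<omega> $ i $ j \<partial>M) = \<sigma> * (A ** (t *\<^sub>R C + (\<integral>\<omega>. W t \<omega> \<partial>M)) ** transpose A) $ i $ j"
proof -
  let ?X = "\<lambda>k l \<omega>. LINT u:{0<..t}|count_space UNIV. coefm i j k l u \<omega> * (jump (\<lambda>t. L t \<omega>) u $ k * jump (\<lambda>t. L t \<omega>) u $ l)"
  let ?Z = "\<lambda>k l \<omega>. LINT s:{0<..t}|lborel. coefm i j k l s \<omega>"
  have X: "integrable M (?X k l)" and Z: "integrable M (?Z k l)"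
    and XZ: "(\<integral>\<omega>. ?X k l \<omega> \<partial>M) = (if k = l then \<sigma> else 0) * (\<integral>\<omega>. ?Z k l \<omega> \<partial>M)" for k l
    using compensated_coefm[OF t, of i j k l] unfolding compensated_def integral_products by simp_all
  have "(\<integral>\<omega>. jumps t \<omega> $ i $ j \<partial>M) = (\<Sum>k\<in>UNIV. \<Sum>l\<in>UNIV. (\<integral>\<omega>. ?X k l \<omega> \<partial>M))"
    using X by (simp add: jumps_def Bochner_Integration.integral_sum)
  also have "\<dots> = (\<Sum>k\<in>UNIV. \<sigma> * (\<integral>\<omega>. ?Z k k \<omega> \<partial>M))"
    unfolding XZ by (simp add: if_distrib[of "\<lambda>x. x * _"] cong: if_cong)
  also have "\<dots> = \<sigma> * (\<integral>\<omega>. (\<Sum>k\<in>UNIV. ?Z k k \<omega>) \<partial>M)"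
    using Z by (simp add: sum_distrib_left Bochner_Integration.integral_sum)
  also have "(\<integral>\<omega>. (\<Sum>k\<in>UNIV. ?Z k k \<omega>) \<partial>M) = (\<integral>\<omega>. (A ** (t *\<^sub>R C + W t \<omega>) ** transpose A) $ i $ j \<partial>M)"
  proof (rule integrable_AE_eq(2)[OF _ AE_sum_coefm_integral[OF t]])
    show "integrable M (\<lambda>\<omega>. (A ** (t *\<^sub>R C + W t \<omega>) ** transpose A) $ i $ j)"
      using integrable_W[OF t] by (intro integrable_bounded_linear[OF bounded_linear_compose[OF bounded_linear_nth_nth bounded_linear_congruence]]) simp
  qed
  also have "\<dots> = (A ** (\<integral>\<omega>. t *\<^sub>R C + W t \<omega> \<partial>M) ** transpose A) $ i $ j"
    using integrable_W[OF t] by (intro integral_bounded_linear[OF bounded_linear_compose[OF bounded_linear_nth_nth bounded_linear_congruence]]) simp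
  also have "(\<integral>\<omega>. t *\<^sub>R C + W t \<omega> \<partial>M) = t *\<^sub>R C + (\<integral>\<omega>. W t \<omega> \<partial>M)"
    using integrable_W[OF t] by (simp add: prob_space)
  finally show ?thesis .
qed

lemma expectation_eq:
  assumes t: "0 < t"
  defines "E \<equiv> \<integral>\<omega>. W t \<omega> \<partial>M"
  shows "m t = m 0 + (B ** E + E ** transpose B) + \<sigma> *\<^sub>R (A ** (t *\<^sub>R C + E) ** transpose A)"
proof -
  have d: "integrable M (drift t)" "(\<integral>\<omega>. drift t \<omega> \<partial>M) = B ** E + E ** transpose B"
    using integrable_bounded_linear[OF bounded_linear_lyapunov integrable_W[OF t]]
      integral_bounded_linear[OF bounded_linear_lyapunov integrable_W[OF t]]
    unfolding drift_eq[OF t, abs_def] E_def by simp_all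
  \<comment> \<open>Solving the path equation for the jump part yields its integrability as a matrix
    from that of the other terms.\<close>
  have eq: "AE \<omega> in M. jumps t \<omega> = Y t \<omega> - Y 0 \<omega> - drift t \<omega>"
    using AE_path_eq by eventually_elim (use t in simp)
  have i: "integrable M (\<lambda>\<omega>. Y t \<omega> - Y 0 \<omega> - drift t \<omega>)"
    using t by (intro Bochner_Integration.integrable_diff integrable_Y d) auto
  note j = integrable_AE_eq[OF i eq]
  have "(\<integral>\<omega>. jumps t \<omega> \<partial>M) $ i $ j = (\<sigma> *\<^sub>R (A ** (t *\<^sub>R C + E) ** transpose A)) $ i $ j" for i j
    using integral_bounded_linear[OF bounded_linear_nth_nth j(1), of i j] integral_jumps_nth[OF t, of i j]
    by (simp add: E_def)
  hence "(\<integral>\<omega>. jumps t \<omega> \<partial>M) = \<sigma> *\<^sub>R (A ** (t *\<^sub>R C + E) ** transpose A)" by (simp add: vec_eq_iff)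
  moreover have "(\<integral>\<omega>. jumps t \<omega> \<partial>M) = m t - m 0 - (B ** E + E ** transpose B)"
    unfolding j(2) m_def d(2)[symmetric] using t integrable_Y[of t] integrable_Y[of 0] d(1) by simp
  ultimately show ?thesis by (simp add: algebra_simps)
qed

end

section \<open>The linear equation for the mean\<close>

context mucogarch
begin

lemma Q_has_integral:
  assumes t: "0 < t"
  shows "Q integrable_on {0..t}" and "(\<integral>\<omega>. W t \<omega> \<partial>M) = integral {0..t} Q"
proof -
  note i = set_borel_integral_eq_integral[OF set_integrable_Q[OF t]]
  have "(Q has_integral (\<integral>\<omega>. W t \<omega> \<partial>M)) {0<..t}"
    unfolding integral_W[OF t] i(2) using i(1) by (rule integrable_integral)
  hence *: "(Q has_integral (\<integral>\<omega>. W t \<omega> \<partial>M)) {0..t}"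
    by (rule has_integral_spike_set_eq[THEN iffD1, rotated -1])
      (auto intro: negligible_subset[of "{0}"])
  show "Q integrable_on {0..t}" using * by blast
  show "(\<integral>\<omega>. W t \<omega> \<partial>M) = integral {0..t} Q" using * by (rule integral_unique[symmetric])
qed

text \<open>The operator that \<open>BB\<close> represents once matrices are vectorized.\<close>

definition step :: "real^'d^'d \<Rightarrow> real^'d^'d" where
  "step E = (B ** E + E ** transpose B) + \<sigma> *\<^sub>R (A ** E ** transpose A)"

lemma bounded_linear_step: "bounded_linear step"
  unfolding step_def[abs_def]
  by (intro bounded_linear_add[OF bounded_linear_lyapunov] bounded_linear_compose[OF bounded_linear_scaleR_right bounded_linear_congruence])

lemma m_eq_Q:
  assumes "0 \<le> t"
  shows "m t = m 0 + step (integral {0..t} Q) + (t * \<sigma>) *\<^sub>R (A ** C ** transpose A)"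
proof (cases "t = 0")
  case True
  thus ?thesis by (simp add: linear_0[OF bounded_linear.linear[OF bounded_linear_step]])
next
  case False
  hence t: "0 < t" using assms by simp
  let ?T = "\<lambda>X :: real^'d^'d. A ** X ** transpose A"
  have "?T (t *\<^sub>R C + integral {0..t} Q) = t *\<^sub>R ?T C + ?T (integral {0..t} Q)"
    by (simp only: linear_add[OF bounded_linear.linear[OF bounded_linear_congruence]]
        linear_cmul[OF bounded_linear.linear[OF bounded_linear_congruence]])
  thus ?thesis unfolding expectation_eq[OF t] Q_has_integral(2)[OF t] step_def
    by (simp add: algebra_simps)
qed

text \<open>Although the paths jump, the mean is an affine image of an indefinite integral plus a
  term linear in time.\<close>

lemma continuous_on_m: "continuous_on {0..T} m"
proof (cases "0 < T")
  case True
  have "continuous_on {0..T} (\<lambda>t. m 0 + step (integral {0..t} Q) + (t * \<sigma>) *\<^sub>R (A ** C ** transpose A))"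
    by (intro continuous_intros bounded_linear.continuous_on[OF bounded_linear_step]
        indefinite_integral_continuous_1 Q_has_integral(1) True)
  thus ?thesis by (rule continuous_on_eq) (auto simp: m_eq_Q[symmetric])
next
  case False
  have "{0..T} = {} \<or> {0..T} = {0}" using False by force
  thus ?thesis by auto
qed

text \<open>Along the left grid points \<open>m\<close> tends both to the mean of the left limit, by
  dominated convergence, and to \<open>m s\<close>, by continuity. This closes the integral equation
  in \<open>m\<close> alone.\<close>

lemma Q_eq_m: assumes "0 \<le> s" shows "Q s = m s"
proof (cases "s = 0")
  case True
  thus ?thesis by (simp add: Q_def m_def Ym_0[abs_def])
next
  case False
  hence s: "0 < s" using assms by simp
  have "(\<lambda>n. m (grid 0 s n (cell 0 s n s))) \<longlonglongrightarrow> m s"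
  proof (rule continuous_on_tendsto_compose[OF continuous_on_m[of s]])
    show "(\<lambda>n. grid 0 s n (cell 0 s n s)) \<longlonglongrightarrow> s"
      using filterlim_grid_cell[OF s order_refl] by (simp add: filterlim_at)
    show "\<forall>\<^sub>F n in sequentially. grid 0 s n (cell 0 s n s) \<in> {0..s}"
      using eventually_gt_at_top[of 0]
    proof eventually_elim
      case (elim n)
      show ?case using cell_bounds(2)[OF s order_refl elim] grid_mono[of 0 s 0 "cell 0 s n s" n] s by (simp add: grid_0)
    qed
  qed (use s in simp)
  thus ?thesis using m_tendsto_Q[OF s] LIMSEQ_unique by blast
qed

lemma m_eq:
  assumes "0 \<le> t"
  shows "m t = m 0 + step (integral {0..t} m) + (t * \<sigma>) *\<^sub>R (A ** C ** transpose A)"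
proof -
  have "integral {0..t} Q = integral {0..t} m" by (rule integral_cong) (simp add: Q_eq_m)
  thus ?thesis using m_eq_Q[OF assms] by simp
qed

definition BB :: "real^('d \<times> 'd)^('d \<times> 'd)" where
  "BB = B \<otimes> mat 1 + mat 1 \<otimes> B + \<sigma> *\<^sub>R (A \<otimes> A)"

lemma BB_mvec: "BB *v mvec X = mvec (step X)"
  by (simp add: BB_def step_def matrix_vector_mult_add_rdistrib scaleR_matrix_vector_assoc[symmetric]
      kron_mult_mvec mvec_add mvec_scaleR transpose_mat add.commute)

definition b :: "real^('d \<times> 'd)" where "b = \<sigma> *\<^sub>R ((A \<otimes> A) *v mvec C)"

lemma integral_mvec_Y:
  assumes "0 \<le> t" shows "integrable M (\<lambda>\<omega>. mvec (Y t \<omega>))" "(\<integral>\<omega>. mvec (Y t \<omega>) \<partial>M) = mvec (m t)"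
  using integrable_bounded_linear[OF bounded_linear_mvec integrable_Y[OF assms]]
    integral_bounded_linear[OF bounded_linear_mvec integrable_Y[OF assms]] by (simp_all add: m_def)

lemma mvec_m_eq:
  assumes "0 \<le> t" shows "mvec (m t) = mvec (m 0) + integral {0..t} (\<lambda>u. BB *v mvec (m u) + b)"
proof -
  have im: "m integrable_on {0..t}" by (intro integrable_continuous_real continuous_on_m)
  have lin: "bounded_linear (\<lambda>X. mvec (step X))" by (rule bounded_linear_compose[OF bounded_linear_mvec bounded_linear_step])
  have "((\<lambda>u. BB *v mvec (m u) + b) has_integral (mvec (step (integral {0..t} m)) + t *\<^sub>R b)) {0..t}"
  proof (rule has_integral_add)
    show "((\<lambda>u. BB *v mvec (m u)) has_integral mvec (step (integral {0..t} m))) {0..t}"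
      using has_integral_linear[OF integrable_integral[OF im] lin] by (simp add: o_def BB_mvec)
    show "((\<lambda>u. b) has_integral t *\<^sub>R b) {0..t}"
      using has_integral_const_real[of b 0 t] assms by simp
  qed
  hence "integral {0..t} (\<lambda>u. BB *v mvec (m u) + b) = mvec (step (integral {0..t} m)) + t *\<^sub>R b"
    by (rule integral_unique)
  thus ?thesis
    by (subst m_eq[OF assms]) (simp add: b_def kron_mult_mvec mvec_add mvec_scaleR)
qed

theorem mean_formula:
  assumes t: "0 \<le> t"
  shows "mvec (m t) = mexp (t *\<^sub>R BB) *v mvec (m 0) + integral {0..t} (\<lambda>s. mexp ((t - s) *\<^sub>R BB)) *v b"
proof (rule linear_ode_solution[OF t])
  show "continuous_on {0..t} (\<lambda>s. mvec (m s))"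
    by (rule bounded_linear.continuous_on[OF bounded_linear_mvec continuous_on_m])
qed (rule mvec_m_eq)

text \<open>For constant \<open>m\<close> the integral equation at \<open>t = 1\<close> reduces to
  the vanishing of the affine right-hand side.\<close>

theorem stationary_mean:
  assumes "\<And>t. 0 \<le> t \<Longrightarrow> m t = m 0"
  shows "step (m 0) = - (\<sigma> *\<^sub>R (A ** C ** transpose A))"
proof -
  have "integral {0..1} m = integral {0..1 :: real} (\<lambda>_. m 0)"
    by (rule integral_cong, rule assms) simp
  hence I: "integral {0..1} m = m 0" by simp
  define X where "X = step (m 0) + \<sigma> *\<^sub>R (A ** C ** transpose A)"
  have "m 1 = m 0 + X" using m_eq[of 1] unfolding I X_def by simp
  moreover have "m 1 = m 0" by (rule assms) simp
  ultimately have "X = 0" by (metis add_cancel_left_right)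
  thus ?thesis by (simp add: X_def eq_neg_iff_add_eq_0)
qed

end

section \<open>Modification on a null set\<close>

lemma (in prob_space) indep_set_mono:
  assumes indep: "indep_set A B" and sub: "A' \<subseteq> A" "B' \<subseteq> B" shows "indep_set A' B'"
proof (rule indep_setI)
  show "A' \<subseteq> events" "B' \<subseteq> events" using indep_setD_ev1[OF indep] indep_setD_ev2[OF indep] sub by auto
  show "prob (a \<inter> b) = prob a * prob b" if "a \<in> A'" "b \<in> B'" for a b
    using indep_setD[OF indep] that sub by blast
qed

text \<open>Independence, given for the sigma-algebra and the preimages under \<open>X\<close>,
  passes to \<open>Z\<close> and \<open>g\<close> composed with \<open>X\<close>; their joint law is
  a product, and Tonelli separates the two factors.\<close>

lemma (in prob_space) indep_set_nn_integral_mult: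
  fixes Z :: "'a \<Rightarrow> ennreal"
  assumes G: "subalgebra M G" and X[measurable]: "X \<in> borel_measurable M"
    and indep: "indep_set (sets G) {X -` S \<inter> space M | S. S \<in> sets borel}"
    and Z: "Z \<in> borel_measurable G" and g[measurable]: "g \<in> borel_measurable borel"
  shows "(\<integral>\<^sup>+\<omega>. Z \<omega> * g (X \<omega>) \<partial>M) = (\<integral>\<^sup>+\<omega>. Z \<omega> \<partial>M) * (\<integral>\<^sup>+\<omega>. g (X \<omega>) \<partial>M)"
proof -
  let ?X = "{X -` S \<inter> space M | S. S \<in> sets borel}" and ?Z = "{Z -` S \<inter> space M | S. S \<in> sets borel}"
  have ZM[measurable]: "Z \<in> borel_measurable M" by (rule measurable_from_subalg[OF G Z])
  have "Int_stable ?X"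
  proof (rule Int_stableI)
    fix A B assume "A \<in> ?X" "B \<in> ?X"
    then obtain S T where "A = X -` S \<inter> space M" "S \<in> sets borel" "B = X -` T \<inter> space M" "T \<in> sets borel" by auto
    thus "A \<inter> B \<in> ?X" by (intro CollectI exI[of _ "S \<inter> T"]) auto
  qed
  hence *: "indep_set (sigma_sets (space M) (sets G)) (sigma_sets (space M) ?X)"
    by (intro indep_set_sigma_sets[OF indep] sets.Int_stable)
  have "?Z \<subseteq> sets G"
    using measurable_sets[OF Z] G by (auto simp: subalgebra_def)
  hence sub: "sigma_sets (space M) ?Z \<subseteq> sigma_sets (space M) (sets G)" by (rule sigma_sets_mono')
  let ?Y = "\<lambda>\<omega>. g (X \<omega>)"
  have "{?Y -` S \<inter> space M | S. S \<in> sets borel} \<subseteq> ?X"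
  proof safe
    fix S :: "ennreal set" assume "S \<in> sets borel"
    hence "g -` S \<in> sets borel" using measurable_sets[OF g] by simp
    thus "\<exists>T. ?Y -` S \<inter> space M = X -` T \<inter> space M \<and> T \<in> sets borel" by (intro exI[of _ "g -` S"]) auto
  qed
  hence sub': "sigma_sets (space M) {?Y -` S \<inter> space M | S. S \<in> sets borel} \<subseteq> sigma_sets (space M) ?X" by (rule sigma_sets_mono')
  have [measurable]: "?Y \<in> borel_measurable M" by measurable
  have "indep_var borel Z borel ?Y"
    unfolding indep_var_eq using indep_set_mono[OF * sub sub'] by simp
  hence D: "distr M (borel \<Otimes>\<^sub>M borel) (\<lambda>\<omega>. (Z \<omega>, ?Y \<omega>)) = distr M borel Z \<Otimes>\<^sub>M distr M borel ?Y"
    unfolding indep_var_distribution_eq by simp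
  interpret DY: prob_space "distr M borel ?Y" by (rule prob_space_distr) simp
  have "(\<integral>\<^sup>+\<omega>. Z \<omega> * g (X \<omega>) \<partial>M) = (\<integral>\<^sup>+p. fst p * snd p \<partial>distr M (borel \<Otimes>\<^sub>M borel) (\<lambda>\<omega>. (Z \<omega>, ?Y \<omega>)))"
    by (subst nn_integral_distr) simp_all
  also have "\<dots> = (\<integral>\<^sup>+z. \<integral>\<^sup>+y. z * y \<partial>distr M borel ?Y \<partial>distr M borel Z)"
    unfolding D by (subst DY.nn_integral_fst[symmetric]) simp_all
  also have "\<dots> = (\<integral>\<^sup>+z. z * (\<integral>\<^sup>+y. y \<partial>distr M borel ?Y) \<partial>distr M borel Z)"
    by (intro nn_integral_cong nn_integral_cmult) simp
  also have "\<dots> = (\<integral>\<^sup>+z. z \<partial>distr M borel Z) * (\<integral>\<^sup>+y. y \<partial>distr M borel ?Y)"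
    by (rule nn_integral_multc) simp
  also have "\<dots> = (\<integral>\<^sup>+\<omega>. Z \<omega> \<partial>M) * (\<integral>\<^sup>+\<omega>. g (X \<omega>) \<partial>M)"
    by (simp add: nn_integral_distr)
  finally show ?thesis .
qed

text \<open>Independence of the past factorizes the integral, and equality in law shifts the
  increment to start at 0; this is the assumption \<open>increment\<close> of
  \<open>levy_jumps\<close>.\<close>

lemma (in usual_filtered_prob_space) levy_process_increment:
  fixes L :: "real \<Rightarrow> 'a \<Rightarrow> real^'d"
  assumes L: "levy_process M F L" and st: "0 \<le> s" "s \<le> t"
    and Z: "Z \<in> borel_measurable (F s)" and g[measurable]: "g \<in> borel_measurable borel"
  shows "(\<integral>\<^sup>+\<omega>. Z \<omega> * g (L t \<omega> - L s \<omega>) \<partial>M) = (\<integral>\<^sup>+\<omega>. Z \<omega> \<partial>M) * (\<integral>\<^sup>+\<omega>. g (L (t - s) \<omega>) \<partial>M)"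
proof -
  have LM: "L u \<in> borel_measurable M" if "0 \<le> u" for u
    using L that measurable_from_subalg[OF subalgebra_F[OF that]] by (auto simp: levy_process_def adapted_def)
  note [measurable] = LM[OF st(1)] LM[OF order_trans[OF st]]
  have [measurable]: "L (t - s) \<in> borel_measurable M" using st by (intro LM) simp
  have ind: "indep_set (sets (F s)) {(\<lambda>\<omega>. L t \<omega> - L s \<omega>) -` S \<inter> space M | S. S \<in> sets borel}"
    and eq: "distr M borel (\<lambda>\<omega>. L t \<omega> - L s \<omega>) = distr M borel (L (t - s))"
    using L st by (auto simp: levy_process_def)
  have "(\<integral>\<^sup>+\<omega>. g (L t \<omega> - L s \<omega>) \<partial>M) = (\<integral>\<^sup>+\<omega>. g (L (t - s) \<omega>) \<partial>M)"
    using arg_cong[OF eq, of "\<lambda>N. integral\<^sup>N N g"] by (simp add: nn_integral_distr)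
  thus ?thesis using indep_set_nn_integral_mult[OF subalgebra_F[OF st(1)] _ ind Z g] by simp
qed

lemma cadlag_const: "cadlag (\<lambda>_. c)"
  by (auto simp: cadlag_def)

text \<open>Paths are made cadlag everywhere by setting both processes to 0 on a null set, which belongs
  to every sigma-algebra of the filtration.\<close>

lemma mucogarch_modification:
  fixes L :: "real \<Rightarrow> 'a \<Rightarrow> real^'d"
  assumes "usual_filtered_prob_space M F" and L: "levy_process M F L"
    and \<nu>: "has_levy_measure M L \<nu>" and C: "pd C"
    and Y: "mucogarch_volatility M F L A B C Y"
    and outer: "integrable \<nu> (\<lambda>x. outer x x)" "(LINT x|\<nu>. outer x x) = \<sigma> *\<^sub>R mat 1"
    and Y0: "integrable M (\<lambda>\<omega>. norm (Y 0 \<omega>))"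
  obtains L' Y' where "mucogarch M F L' \<nu> A B C Y' \<sigma>"
    "\<And>t. 0 \<le> t \<Longrightarrow> AE \<omega> in M. Y' t \<omega> = Y t \<omega>"
proof -
  interpret usual_filtered_prob_space M F by fact
  have "AE \<omega> in M. cadlag (\<lambda>t. L t \<omega>) \<and> cadlag (\<lambda>t. Y t \<omega>) \<and> (\<forall>t\<ge>0. psd (Y t \<omega>))"
    using L Y by (auto simp: levy_process_def mucogarch_volatility_def intro: AE_conjI)
  then obtain N where N: "N \<in> null_sets M"
    and good: "\<And>\<omega>. \<omega> \<in> space M \<Longrightarrow> \<omega> \<notin> N \<Longrightarrow> cadlag (\<lambda>t. L t \<omega>) \<and> cadlag (\<lambda>t. Y t \<omega>) \<and> (\<forall>t\<ge>0. psd (Y t \<omega>))"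
    unfolding eventually_ae_filter by blast
  \<comment> \<open>Points outside \<open>space M\<close> are included in the alteration, since the
    locale demands regular paths for every \<omega> of the type. The zero path is cadlag and
    psd.\<close>
  define L' where "L' t \<omega> = (if \<omega> \<in> space M - N then L t \<omega> else 0)" for t \<omega>
  define Y' where "Y' t \<omega> = (if \<omega> \<in> space M - N then Y t \<omega> else 0)" for t \<omega>
  have ae: "AE \<omega> in M. \<forall>t. L' t \<omega> = L t \<omega> \<and> Y' t \<omega> = Y t \<omega>"
    using AE_not_in[OF N] by (intro AE_I'[OF N]) (auto simp: L'_def Y'_def)
  have NF: "N \<in> sets (F t)" if "0 \<le> t" for t
    using F_complete[OF N order_refl] F_mono[of 0 t] that by auto
  have good_F: "{\<omega> \<in> space (F t). \<omega> \<in> space M - N} \<in> sets (F t)" if t: "0 \<le> t" for t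
  proof -
    have "{\<omega> \<in> space (F t). \<omega> \<in> space M - N} = space (F t) - N"
      using subalgebra_F[OF t] by (auto simp: subalgebra_def)
    thus ?thesis using NF[OF t] by simp
  qed
  have L_F: "L t \<in> borel_measurable (F t)" and Y_F: "Y t \<in> borel_measurable (F t)" if "0 \<le> t" for t
    using L Y that by (auto simp: levy_process_def mucogarch_volatility_def adapted_def)
  have "mucogarch M F L' \<nu> A B C Y' \<sigma>"
  proof
    show "cadlag (\<lambda>t. L' t \<omega>)" for \<omega>
    proof (cases "\<omega> \<in> space M - N")
      case True
      hence "(\<lambda>t. L' t \<omega>) = (\<lambda>t. L t \<omega>)" unfolding L'_def by simp
      thus ?thesis using good[of \<omega>] True by simp
    next
      case False
      hence "(\<lambda>t. L' t \<omega>) = (\<lambda>_. 0)" unfolding L'_def by (simp only: if_False)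
      thus ?thesis by (simp only: cadlag_const)
    qed
    show "cadlag (\<lambda>t. Y' t \<omega>)" for \<omega>
    proof (cases "\<omega> \<in> space M - N")
      case True
      hence "(\<lambda>t. Y' t \<omega>) = (\<lambda>t. Y t \<omega>)" unfolding Y'_def by simp
      thus ?thesis using good[of \<omega>] True by simp
    next
      case False
      hence "(\<lambda>t. Y' t \<omega>) = (\<lambda>_. 0)" unfolding Y'_def by (simp only: if_False)
      thus ?thesis by (simp only: cadlag_const)
    qed
    show "L' t \<in> borel_measurable (F t)" "Y' t \<in> borel_measurable (F t)" if "0 \<le> t" for t
      unfolding L'_def[abs_def] Y'_def[abs_def]
      by (rule measurable_If[OF L_F[OF that] _ good_F[OF that]], simp)
        (rule measurable_If[OF Y_F[OF that] _ good_F[OF that]], simp)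
    show "psd (Y' t \<omega>)" if "0 \<le> t" for t \<omega>
      using good[of \<omega>] that by (auto simp: Y'_def psd_0)
    show "psd C" by (rule pd_imp_psd[OF C])
    show "(\<integral>\<^sup>+\<omega>. Z \<omega> * g (L' t \<omega> - L' s \<omega>) \<partial>M) = (\<integral>\<^sup>+\<omega>. Z \<omega> \<partial>M) * (\<integral>\<^sup>+\<omega>. g (L' (t - s) \<omega>) \<partial>M)"
      if "0 \<le> s" "s \<le> t" "Z \<in> borel_measurable (F s)" "g \<in> borel_measurable borel" for s t Z and g :: "real^'d \<Rightarrow> ennreal"
    proof -
      have "(\<integral>\<^sup>+\<omega>. Z \<omega> * g (L' t \<omega> - L' s \<omega>) \<partial>M) = (\<integral>\<^sup>+\<omega>. Z \<omega> * g (L t \<omega> - L s \<omega>) \<partial>M)"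
        using ae by (intro nn_integral_cong_AE) (auto elim!: eventually_mono)
      moreover have "(\<integral>\<^sup>+\<omega>. g (L' (t - s) \<omega>) \<partial>M) = (\<integral>\<^sup>+\<omega>. g (L (t - s) \<omega>) \<partial>M)"
        using ae by (intro nn_integral_cong_AE) (auto elim!: eventually_mono)
      ultimately show ?thesis using levy_process_increment[OF L that] by simp
    qed
    show "has_levy_measure M L' \<nu>"
      unfolding has_levy_measure_def
    proof (intro conjI ballI)
      show "sets \<nu> = sets borel" using \<nu> by (simp add: has_levy_measure_def)
      fix S :: "(real^'d) set" assume S: "S \<in> sets borel"
      have "emeasure \<nu> S = (\<integral>\<^sup>+\<omega>. emeasure (count_space UNIV) {s\<in>{0<..1}. jump (\<lambda>t. L t \<omega>) s \<in> S - {0}} \<partial>M)"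
        using \<nu>[unfolded has_levy_measure_def, THEN conjunct2] S by (rule bspec)
      also have "\<dots> = (\<integral>\<^sup>+\<omega>. emeasure (count_space UNIV) {s\<in>{0<..1}. jump (\<lambda>t. L' t \<omega>) s \<in> S - {0}} \<partial>M)"
        using ae by (intro nn_integral_cong_AE) (auto elim!: eventually_mono)
      finally show "emeasure \<nu> S = (\<integral>\<^sup>+\<omega>. emeasure (count_space UNIV) {s\<in>{0<..1}. jump (\<lambda>t. L' t \<omega>) s \<in> S - {0}} \<partial>M)" .
    qed
    have "AE \<omega> in M. \<forall>t\<ge>0. \<exists>J.
      has_matrix_ls_integral
        (\<lambda>s. A ** psd_sqrt (C + left_lim (\<lambda>u. Y u \<omega>) s))
        (discont_qv (\<lambda>u. L u \<omega>))
        (\<lambda>s. psd_sqrt (C + left_lim (\<lambda>u. Y u \<omega>) s) ** transpose A) t J \<and>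
      Y t \<omega> = Y 0 \<omega>
        + integral {0..t} (\<lambda>s. B ** left_lim (\<lambda>u. Y u \<omega>) s + left_lim (\<lambda>u. Y u \<omega>) s ** transpose B)
        + J" using Y unfolding mucogarch_volatility_def by blast
    thus "AE \<omega> in M. \<forall>t\<ge>0. \<exists>J.
      has_matrix_ls_integral
        (\<lambda>s. A ** psd_sqrt (C + left_lim (\<lambda>u. Y' u \<omega>) s))
        (discont_qv (\<lambda>u. L' u \<omega>))
        (\<lambda>s. psd_sqrt (C + left_lim (\<lambda>u. Y' u \<omega>) s) ** transpose A) t J \<and>
      Y' t \<omega> = Y' 0 \<omega>
        + integral {0..t} (\<lambda>s. B ** left_lim (\<lambda>u. Y' u \<omega>) s + left_lim (\<lambda>u. Y' u \<omega>) s ** transpose B)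
        + J"
      using ae
    proof eventually_elim
      case (elim \<omega>)
      have "(\<lambda>u. Y' u \<omega>) = (\<lambda>u. Y u \<omega>)" "(\<lambda>u. L' u \<omega>) = (\<lambda>u. L u \<omega>)" using elim(2) by auto
      thus ?case using elim by simp
    qed
    have "integrable M (Y 0)"
      using Y0 by (subst (asm) integrable_norm_iff) (rule measurable_from_subalg[OF subalgebra_F Y_F]; simp)
    thus "integrable M (Y' 0)"
      by (rule integrable_AE_eq(1)) (use ae in \<open>auto elim!: eventually_mono\<close>)
  qed (use outer in auto)
  thus ?thesis
  proof (rule that)
    show "AE \<omega> in M. Y' t \<omega> = Y t \<omega>" for t using ae by (auto elim!: eventually_mono)
  qed
qed

theorem theorem4p8:
  fixes M :: "'a measure" and F :: "real \<Rightarrow> 'a measure"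
    and L :: "real \<Rightarrow> 'a \<Rightarrow> real^'d" and \<nu>\<^sub>L :: "(real^'d) measure"
    and A B C :: "real^'d^'d" and Y V :: "real \<Rightarrow> 'a \<Rightarrow> real^'d^'d"
    and \<sigma>\<^sub>L :: real and BB :: "real^('d \<times> 'd)^('d \<times> 'd)"
  assumes "usual_filtered_prob_space M F"
    and "levy_process M F L"
    and "has_levy_measure M L \<nu>\<^sub>L"
    and "pd C"
    and "mucogarch_volatility M F L A B C Y"
    and "\<And>t \<omega>. V t \<omega> = C + Y t \<omega>"
    and "\<sigma>\<^sub>L \<ge> 0"
    and "integrable \<nu>\<^sub>L (\<lambda>x. outer x x)"
    and "(LINT x|\<nu>\<^sub>L. outer x x) = \<sigma>\<^sub>L *\<^sub>R mat 1"
    and "BB = B \<otimes> mat 1 + mat 1 \<otimes> B + \<sigma>\<^sub>L *\<^sub>R (A \<otimes> A)"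
  shows
    "(integrable M (\<lambda>\<omega>. norm (Y 0 \<omega>)) \<longrightarrow>
        (\<forall>t\<ge>0. integrable M (\<lambda>\<omega>. mvec (Y t \<omega>)) \<and>
          (LINT \<omega>|M. mvec (Y t \<omega>)) =
            mexp (t *\<^sub>R BB) *v (LINT \<omega>|M. mvec (Y 0 \<omega>))
            + integral {0..t} (\<lambda>s. mexp ((t - s) *\<^sub>R BB)) *v (\<sigma>\<^sub>L *\<^sub>R ((A \<otimes> A) *v mvec C))) \<and>
        (invertible BB \<longrightarrow> (\<forall>t\<ge>0.
          (LINT \<omega>|M. mvec (Y t \<omega>)) =
            mexp (t *\<^sub>R BB) *v ((LINT \<omega>|M. mvec (Y 0 \<omega>))
              + \<sigma>\<^sub>L *\<^sub>R (matrix_inv BB *v ((A \<otimes> A) *v mvec C)))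
            - \<sigma>\<^sub>L *\<^sub>R (matrix_inv BB *v ((A \<otimes> A) *v mvec C))))) \<and>
     (second_order_stationary M Y \<longrightarrow>
        B ** (LINT \<omega>|M. Y 0 \<omega>) + (LINT \<omega>|M. Y 0 \<omega>) ** transpose B
          + \<sigma>\<^sub>L *\<^sub>R (A ** (LINT \<omega>|M. Y 0 \<omega>) ** transpose A)
          = - (\<sigma>\<^sub>L *\<^sub>R (A ** C ** transpose A)) \<and>
        (invertible BB \<longrightarrow>
          (LINT \<omega>|M. mvec (Y 0 \<omega>)) = - (\<sigma>\<^sub>L *\<^sub>R (matrix_inv BB *v ((A \<otimes> A) *v mvec C))) \<and>
          (LINT \<omega>|M. mvec (V 0 \<omega>)) = matrix_inv BB *v ((B \<otimes> mat 1 + mat 1 \<otimes> B) *v mvec C)))"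
proof -
  interpret usual_filtered_prob_space M F by fact
  \<comment> \<open>The mean formula and the stationary equation are obtained in one block, as both
    come from the modified processes, whose means agree with those of \<open>Y\<close>. For the
    second, a constant mean is all that is used of stationarity.\<close>
  have i: "integrable M (\<lambda>\<omega>. mvec (Y t \<omega>)) \<and>
      (LINT \<omega>|M. mvec (Y t \<omega>)) = mexp (t *\<^sub>R BB) *v (LINT \<omega>|M. mvec (Y 0 \<omega>))
        + integral {0..t} (\<lambda>s. mexp ((t - s) *\<^sub>R BB)) *v (\<sigma>\<^sub>L *\<^sub>R ((A \<otimes> A) *v mvec C))"
    and stat: "(\<And>t. 0 \<le> t \<Longrightarrow> (LINT \<omega>|M. Y t \<omega>) = (LINT \<omega>|M. Y 0 \<omega>)) \<Longrightarrow>
      B ** (LINT \<omega>|M. Y 0 \<omega>) + (LINT \<omega>|M. Y 0 \<omega>) ** transpose B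
          + \<sigma>\<^sub>L *\<^sub>R (A ** (LINT \<omega>|M. Y 0 \<omega>) ** transpose A)
          = - (\<sigma>\<^sub>L *\<^sub>R (A ** C ** transpose A)) \<and>
      BB *v (LINT \<omega>|M. mvec (Y 0 \<omega>)) = - (\<sigma>\<^sub>L *\<^sub>R ((A \<otimes> A) *v mvec C))"
    if int0: "integrable M (\<lambda>\<omega>. norm (Y 0 \<omega>))" and t: "0 \<le> t" for t
  proof -
    obtain L' Y' where X: "mucogarch M F L' \<nu>\<^sub>L A B C Y' \<sigma>\<^sub>L"
      and ae: "\<And>t. 0 \<le> t \<Longrightarrow> AE \<omega> in M. Y' t \<omega> = Y t \<omega>"
      by (rule mucogarch_modification[OF assms(1-5,8,9) int0]) (rule that)
    interpret X: mucogarch M F L' \<nu>\<^sub>L A B C Y' \<sigma>\<^sub>L by (rule X)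
    have BB: "BB = X.BB" unfolding assms(10) X.BB_def ..
    have aev: "AE \<omega> in M. mvec (Y t \<omega>) = mvec (Y' t \<omega>)" and aey: "AE \<omega> in M. Y t \<omega> = Y' t \<omega>" if "0 \<le> t" for t
      using ae[OF that] by (auto elim!: eventually_mono)
    have vec: "integrable M (\<lambda>\<omega>. mvec (Y t \<omega>))" "(LINT \<omega>|M. mvec (Y t \<omega>)) = mvec (X.m t)" if "0 \<le> t" for t
      using integrable_AE_eq[OF X.integral_mvec_Y(1)[OF that] aev[OF that]] X.integral_mvec_Y(2)[OF that] by simp_all
    have m: "(LINT \<omega>|M. Y t \<omega>) = X.m t" if "0 \<le> t" for t
      using integrable_AE_eq(2)[OF X.integrable_Y[OF that] aey[OF that]] by (simp add: X.m_def)
    show "integrable M (\<lambda>\<omega>. mvec (Y t \<omega>)) \<and>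
      (LINT \<omega>|M. mvec (Y t \<omega>)) = mexp (t *\<^sub>R BB) *v (LINT \<omega>|M. mvec (Y 0 \<omega>))
        + integral {0..t} (\<lambda>s. mexp ((t - s) *\<^sub>R BB)) *v (\<sigma>\<^sub>L *\<^sub>R ((A \<otimes> A) *v mvec C))"
      using X.mean_formula[OF t] vec(1)[OF t] unfolding vec(2)[OF t] vec(2)[OF order_refl] BB X.b_def by blast
    assume const: "\<And>t. 0 \<le> t \<Longrightarrow> (LINT \<omega>|M. Y t \<omega>) = (LINT \<omega>|M. Y 0 \<omega>)"
    have mc: "X.m t = X.m 0" if "0 \<le> t" for t
      using const[OF that] unfolding m[OF that] m[OF order_refl] .
    have step: "X.step (X.m 0) = - (\<sigma>\<^sub>L *\<^sub>R (A ** C ** transpose A))"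
      by (rule X.stationary_mean) (rule mc)
    have "BB *v mvec (X.m 0) = - (\<sigma>\<^sub>L *\<^sub>R ((A \<otimes> A) *v mvec C))"
      unfolding BB X.BB_mvec step kron_mult_mvec by (simp add: mvec_def vec_eq_iff)
    thus "B ** (LINT \<omega>|M. Y 0 \<omega>) + (LINT \<omega>|M. Y 0 \<omega>) ** transpose B
          + \<sigma>\<^sub>L *\<^sub>R (A ** (LINT \<omega>|M. Y 0 \<omega>) ** transpose A)
          = - (\<sigma>\<^sub>L *\<^sub>R (A ** C ** transpose A)) \<and>
      BB *v (LINT \<omega>|M. mvec (Y 0 \<omega>)) = - (\<sigma>\<^sub>L *\<^sub>R ((A \<otimes> A) *v mvec C))"
      using step unfolding vec(2)[OF order_refl] m[OF order_refl] X.step_def by blast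
  qed
  show ?thesis
  proof (intro conjI impI allI)
    fix t :: real
    assume int0: "integrable M (\<lambda>\<omega>. norm (Y 0 \<omega>))" and t: "0 \<le> t"
    show "integrable M (\<lambda>\<omega>. mvec (Y t \<omega>))" using i[OF int0 t] by blast
    show mean: "(LINT \<omega>|M. mvec (Y t \<omega>)) = mexp (t *\<^sub>R BB) *v (LINT \<omega>|M. mvec (Y 0 \<omega>))
        + integral {0..t} (\<lambda>s. mexp ((t - s) *\<^sub>R BB)) *v (\<sigma>\<^sub>L *\<^sub>R ((A \<otimes> A) *v mvec C))"
      using i[OF int0 t] by blast
    assume inv: "invertible BB"
    show "(LINT \<omega>|M. mvec (Y t \<omega>)) =
            mexp (t *\<^sub>R BB) *v ((LINT \<omega>|M. mvec (Y 0 \<omega>))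
              + \<sigma>\<^sub>L *\<^sub>R (matrix_inv BB *v ((A \<otimes> A) *v mvec C)))
            - \<sigma>\<^sub>L *\<^sub>R (matrix_inv BB *v ((A \<otimes> A) *v mvec C))"
      unfolding mean integral_mexp_mult[OF t inv]
      by (simp only: matrix_vector_mult_scaleR matrix_vector_right_distrib add_diff_eq)
  next
    assume "second_order_stationary M Y"
    note stationary = this[unfolded second_order_stationary_def]
    have Y0: "Y 0 \<in> borel_measurable M" "integrable M (\<lambda>\<omega>. (norm (Y 0 \<omega>))\<^sup>2)"
      using stationary[THEN conjunct1, rule_format, of 0] by simp_all
    note const = stationary[THEN conjunct2, THEN conjunct1, rule_format]
    \<comment> \<open>Finite second moments supply the first moment that the mean equation
      presupposes.\<close>
    have int0: "integrable M (\<lambda>\<omega>. norm (Y 0 \<omega>))"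
    proof (rule Bochner_Integration.integrable_bound)
      show "integrable M (\<lambda>\<omega>. 1 + (norm (Y 0 \<omega>))\<^sup>2)" using Y0(2) by simp
      \<comment> \<open>From the square of \<open>x - 1/2\<close>, which gives even
        \<open>x \<le> 1/4 + x\<^sup>2\<close>.\<close>
      have "x \<le> 1 + x\<^sup>2" for x :: real using zero_le_power2[of "x - 1/2"] by (simp add: power2_eq_square algebra_simps)
      thus "AE \<omega> in M. norm (norm (Y 0 \<omega>)) \<le> norm (1 + (norm (Y 0 \<omega>))\<^sup>2)" by (intro AE_I2) simp
    qed (use Y0(1) in measurable)
    note s = stat[OF int0 order_refl const]
    show "B ** (LINT \<omega>|M. Y 0 \<omega>) + (LINT \<omega>|M. Y 0 \<omega>) ** transpose B
          + \<sigma>\<^sub>L *\<^sub>R (A ** (LINT \<omega>|M. Y 0 \<omega>) ** transpose A)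
          = - (\<sigma>\<^sub>L *\<^sub>R (A ** C ** transpose A))"
      using s by blast
    assume inv: "invertible BB"
    define x where "x = (LINT \<omega>|M. mvec (Y 0 \<omega>))"
    have BBx: "BB *v x = - (\<sigma>\<^sub>L *\<^sub>R ((A \<otimes> A) *v mvec C))" using s unfolding x_def by blast
    have inv_mult: "matrix_inv BB *v (BB *v y) = y" for y
      by (simp add: matrix_vector_mul_assoc matrix_inv_left_right[OF inv])
    have x: "x = - (\<sigma>\<^sub>L *\<^sub>R (matrix_inv BB *v ((A \<otimes> A) *v mvec C)))"
    proof -
      have "x = matrix_inv BB *v (BB *v x)" by (rule inv_mult[symmetric])
      also have "\<dots> = - (\<sigma>\<^sub>L *\<^sub>R (matrix_inv BB *v ((A \<otimes> A) *v mvec C)))"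
        unfolding BBx
        by (simp only: bounded_bilinear.minus_right[OF bounded_bilinear_matrix_vector_mult] matrix_vector_mult_scaleR)
      finally show ?thesis .
    qed
    thus "(LINT \<omega>|M. mvec (Y 0 \<omega>)) = - (\<sigma>\<^sub>L *\<^sub>R (matrix_inv BB *v ((A \<otimes> A) *v mvec C)))"
      unfolding x_def .
    have "(LINT \<omega>|M. mvec (V 0 \<omega>)) = (LINT \<omega>|M. mvec C + mvec (Y 0 \<omega>))"
      by (simp add: assms(6) mvec_add)
    also have "\<dots> = mvec C + x"
      using i[OF int0 order_refl] by (simp add: x_def prob_space)
    also have "\<dots> = matrix_inv BB *v (BB *v (mvec C + x))" by (rule inv_mult[symmetric])
    \<comment> \<open>In \<open>BB *v (mvec C + x)\<close> the term with
      \<open>A \<otimes> A\<close> applied to \<open>mvec C\<close> cancels against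
      \<open>BB *v x\<close>, leaving the part of \<open>BB\<close> that comes from
      \<open>B\<close>.\<close>
    also have "BB *v (mvec C + x) = (B \<otimes> mat 1 + mat 1 \<otimes> B) *v mvec C"
    proof -
      have "BB *v mvec C = (B \<otimes> mat 1 + mat 1 \<otimes> B) *v mvec C + \<sigma>\<^sub>L *\<^sub>R ((A \<otimes> A) *v mvec C)"
        unfolding assms(10) by (simp only: matrix_vector_mult_add_rdistrib scaleR_matrix_vector_assoc)
      thus ?thesis unfolding matrix_vector_right_distrib BBx by simp
    qed
    finally show "(LINT \<omega>|M. mvec (V 0 \<omega>)) = matrix_inv BB *v ((B \<otimes> mat 1 + mat 1 \<otimes> B) *v mvec C)" .
  qed
qed

end
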